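(* The class of $\mathrm{R}^{\natural}$-minor functions is not equal to the class of valuated generalized matroids: there exists a valuated generalized matroid that is not an $\mathrm{R}^{\natural}$-minor function. In particular, the matroid based valuation conjecture is false: the class of matroid based valuations is not equal to the class of monotone valuated generalized matroids that take the value zero on the empty set and do not attain the value $-\infty$.
   Context: All ground sets are finite; a maximum over the empty set is $-\infty$. Valuated generalized matroid: a function $f\colon 2^V\to\mathbb{R}\cup\{-\infty\}$ such that (a) for all $X,Y\subseteq V$ with $|X|<|Y|$: $f(X)+f(Y)\le\max_{j\in Y\setminus X}\{f(X+j)+f(Y-j)\}$; and (b) for all $X,Y\subseteq V$ with $|X|=|Y|$ and all $i\in X\setminus Y$: $f(X)+f(Y)\le\max_{j\in Y\setminus X}\{f(X-i+j)+f(Y+i-j)\}$. A generalized matroid on $U$ is a family $\mathcal{I}\subseteq 2^U$ of the form $\{I: g(I)=0\}$ for a valuated generalized matroid $g$ on $U$ with values in $\{0,-\infty\}$. Monotone means $f(X)\le f(Y)$ whenever $X\subseteq Y$. $\mathrm{R}^{\natural}$-minor function: $f\colon 2^V\to\mathbb{R}\cup\{-\infty\}$ is $\mathrm{R}^{\natural}$-minor if there exist a finite set $W$ disjoint from $V$, a bipartite graph $G=(V\cup W,U;E)$ with weights $c\in\mathbb{R}^E$, and a generalized matroid $\mathcal{I}$ on $U$, such that for all $X\subseteq V$, $f(X)$ is the maximum weight of a matching of $G$ whose set of endpoints in $V\cup W$ is exactly $X\cup W$ and whose set of endpoints in $U$ belongs to $\mathcal{I}$ ($-\infty$ if there is none).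 Matroid based valuations: a weighted matroid rank function on $V$ is $r^w(X)=\max\{\sum_{i\in I}w_i: I\subseteq X,\ I\in\mathcal{I}\}$ with $\mathcal{I}$ the family of independent sets of a matroid on $V$ and $w\in\mathbb{R}_{\ge0}^V$. The merge of $f,g$ on $2^V$ is $(f*g)(X)=\max\{f(Y)+g(X\setminus Y):Y\subseteq X\}$. The endowment of $f$ by $T\subseteq V$ is the function $\Delta_T(f)$ on $2^{V\setminus T}$ with $\Delta_T(f)(X)=f(X\cup T)-f(T)$. Matroid based valuations are the functions obtained from weighted matroid rank functions by arbitrary (finite) repeated application of merge and endowment. *)

theory Defs
  imports "HOL-Library.Extended_Real"
begin

text \<open>
  A set function on a finite ground set V with values in the reals extended by minus infinity is
  a function \<open>f :: 'a set \<Rightarrow> ereal\<close> that avoids \<open>\<infinity>\<close> on the subsets of V; its values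
  on other sets are irrelevant, and every predicate below depends only on the restriction of f to
  \<open>Pow V\<close>. Maxima over finite sets are written as suprema in \<open>ereal\<close>, so that the supremum over
  the empty set is \<open>-\<infinity>\<close>.
\<close>

definition valuated_gmatroid :: "'a set \<Rightarrow> ('a set \<Rightarrow> ereal) \<Rightarrow> bool" where
  "valuated_gmatroid V f \<longleftrightarrow>
     finite V \<and>
     (\<forall>X\<subseteq>V. f X \<noteq> \<infinity>) \<and>
     (\<forall>X\<subseteq>V. \<forall>Y\<subseteq>V. card X < card Y \<longrightarrow>
        f X + f Y \<le> (SUP j\<in>Y - X. f (insert j X) + f (Y - {j}))) \<and>
     (\<forall>X\<subseteq>V. \<forall>Y\<subseteq>V. card X = card Y \<longrightarrow> (\<forall>i\<in>X - Y.
        f X + f Y \<le> (SUP j\<in>Y - X. f (insert j (X - {i})) + f (insert i Y - {j}))))"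

definition gmatroid :: "'a set \<Rightarrow> 'a set set \<Rightarrow> bool" where
  "gmatroid U \<I> \<longleftrightarrow>
     (\<exists>g. valuated_gmatroid U g \<and> (\<forall>X\<subseteq>U. g X \<in> {0, -\<infinity>}) \<and> \<I> = {I. I \<subseteq> U \<and> g I = 0})"

definition monotone_setfun :: "'a set \<Rightarrow> ('a set \<Rightarrow> ereal) \<Rightarrow> bool" where
  "monotone_setfun V f \<longleftrightarrow> (\<forall>X Y. X \<subseteq> Y \<and> Y \<subseteq> V \<longrightarrow> f X \<le> f Y)"

text \<open>
  An edge of a bipartite graph with colour classes A and U is an ordered pair in \<open>A \<times> U\<close>. The
  position in the pair distinguishes the two sides, so A and U may share elements of the type.
\<close>

definition matching :: "('a \<times> 'b) set \<Rightarrow> ('a \<times> 'b) set \<Rightarrow> bool" where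
  "matching E M \<longleftrightarrow> M \<subseteq> E \<and> inj_on fst M \<and> inj_on snd M"

text \<open>
  All ground sets here are finite subsets of \<open>nat\<close>; since \<open>nat\<close> is infinite, every choice of
  finite sets V, W, U is covered up to renaming of elements.
\<close>

definition R_natural_minor :: "nat set \<Rightarrow> (nat set \<Rightarrow> ereal) \<Rightarrow> bool" where
  "R_natural_minor V f \<longleftrightarrow>
     finite V \<and>
     (\<exists>(W :: nat set) (U :: nat set) (E :: (nat \<times> nat) set) (c :: nat \<times> nat \<Rightarrow> real) \<I>.
        finite W \<and> W \<inter> V = {} \<and> finite U \<and> E \<subseteq> (V \<union> W) \<times> U \<and> gmatroid U \<I> \<and>
        (\<forall>X\<subseteq>V. f X =
           (SUP M\<in>{M. matching E M \<and> fst ` M = X \<union> W \<and> snd ` M \<in> \<I>}. ereal (\<Sum>e\<in>M. c e))))"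

definition matroid :: "'a set \<Rightarrow> 'a set set \<Rightarrow> bool" where
  "matroid V \<I> \<longleftrightarrow>
     finite V \<and> \<I> \<subseteq> Pow V \<and> {} \<in> \<I> \<and>
     (\<forall>I\<in>\<I>. \<forall>J\<subseteq>I. J \<in> \<I>) \<and>
     (\<forall>I\<in>\<I>. \<forall>J\<in>\<I>. card I < card J \<longrightarrow> (\<exists>j\<in>J - I. insert j I \<in> \<I>))"

definition weighted_rank :: "'a set set \<Rightarrow> ('a \<Rightarrow> real) \<Rightarrow> 'a set \<Rightarrow> ereal" where
  "weighted_rank \<I> w X = (SUP I\<in>{I\<in>\<I>. I \<subseteq> X}. ereal (\<Sum>i\<in>I. w i))"

definition merge :: "('a set \<Rightarrow> ereal) \<Rightarrow> ('a set \<Rightarrow> ereal) \<Rightarrow> 'a set \<Rightarrow> ereal" where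
  "merge f g X = (SUP Y\<in>Pow X. f Y + g (X - Y))"

definition endowment :: "'a set \<Rightarrow> ('a set \<Rightarrow> ereal) \<Rightarrow> 'a set \<Rightarrow> ereal" where
  "endowment T f X = f (X \<union> T) - f T"

text \<open>
  The rule \<open>agree\<close> only identifies functions that coincide on \<open>Pow V\<close>. The functions generated are
  finite on \<open>Pow V\<close>, so the subtraction in \<open>endowment\<close> is never applied to infinite values.
\<close>

inductive matroid_based_valuation :: "'a set \<Rightarrow> ('a set \<Rightarrow> ereal) \<Rightarrow> bool" where
  rank: "matroid V \<I> \<Longrightarrow> (\<forall>i\<in>V. 0 \<le> w i) \<Longrightarrow> matroid_based_valuation V (weighted_rank \<I> w)"
| merge: "matroid_based_valuation V f \<Longrightarrow> matroid_based_valuation V g \<Longrightarrow>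
    matroid_based_valuation V (merge f g)"
| endow: "matroid_based_valuation V f \<Longrightarrow> T \<subseteq> V \<Longrightarrow>
    matroid_based_valuation (V - T) (endowment T f)"
| agree: "matroid_based_valuation V f \<Longrightarrow> (\<forall>X\<subseteq>V. g X = f X) \<Longrightarrow> matroid_based_valuation V g"

end

theory Submission
  imports "HOL-Analysis.Henstock_Kurzweil_Integration" Defs
begin

text \<open>
  The counterexample has rank 4 on the union of seven disjoint pairs. The unions of two pairs, except for one
  of them, are penalized, and the union of the pairs 0 and 1 gets a strictly smaller penalty than the others.
  On 4-sets, both kinds of functions in question are of the form: X is mapped to the maximum weight of a
  basis of a matroid on labelled elements that uses each label in \<open>X \<union> W\<close> exactly once and no other label.

  For such a function, weighted matroid intersection yields a potential on the labels for each of the larger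
  penalties. The maximum weight of a basis is submodular in the weights, so these potentials can be
  combined by \<open>inf\<close> and \<open>sup\<close> into potentials \<open>p0, \<dots>, p3\<close> of the pairs 0, ..., 3 with
  \<open>sup p0 p1 = sup p2 p3\<close>. As the union of the pairs 0 and 1 is penalized, Rado's condition fails for it in
  the matroid of maximum weight bases. This matroid is a direct sum over the weight layers, hence the pairs 0
  and 1 have a positive connectivity defect in some layer. The defect of a minor is at most the defect in the
  whole matroid: for restrictions because \<open>sup p0 p1\<close> is tight, for contractions because the potentials
  of the pairs 2 and 3 translate the defect into one with a tight infimum. Integrating over all
  thresholds shows that \<open>inf p0 p1\<close> certifies the larger penalty also for the pairs 0 and 1.
\<close>

section \<open>Rank functions and maximum weight bases of matroids\<close>

text \<open>The pairs 4, 5 and 6 are hubs. The obstacle they remove: tightness is inherited by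
  \<open>inf\<close> and \<open>sup\<close> only where \<open>pair_rank\<close> is modular, and for
  two single pairs with a special union it is not, as 2 + 2 > 3 + 0. So the \<open>inf\<close> of
  potentials of two such pairs is not tight for free. The potential of a pair i is therefore the
  median of its potentials with the three hubs. Two majorities out of three share an index, and this
  bounds the \<open>inf\<close> of two medians by a potential whose tightness does follow from
  modularity. The same excess 2 + 2 - 3 - 0 = 1 is the total connectivity defect of the pairs 0 and
  1 over all weight layers. The pairs 2 and 3 have 2 + 2 = 4 + 0 instead, which is what yields a
  tight potential for the empty index set. Restricted to the pairs 0 to 3, the special sets are the
  five four-element circuits of the Vamos matroid. The outcome is a rigidity statement: a
  representable function of this shape that penalizes the pairs 0 and 1 at all must penalize them by
  at least the amount common to the other special sets. Penalties 1 and 2 contradict it.\<close>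

lemma matroidD:
  assumes "matroid E \<I>"
  shows "finite E" "\<I> \<subseteq> Pow E" "{} \<in> \<I>" "\<And>I J. I \<in> \<I> \<Longrightarrow> J \<subseteq> I \<Longrightarrow> J \<in> \<I>"
    "\<And>I J. I \<in> \<I> \<Longrightarrow> J \<in> \<I> \<Longrightarrow> card I < card J \<Longrightarrow> \<exists>j\<in>J - I. insert j I \<in> \<I>"
proof -
  note * = assms[unfolded matroid_def]
  show "finite E" by (rule conjunct1[OF *])
  show "\<I> \<subseteq> Pow E" by (rule *[THEN conjunct2, THEN conjunct1])
  show "{} \<in> \<I>" by (rule *[THEN conjunct2, THEN conjunct2, THEN conjunct1])
  show "J \<in> \<I>" if "I \<in> \<I>" "J \<subseteq> I" for I J
    using *[THEN conjunct2, THEN conjunct2, THEN conjunct2, THEN conjunct1] that by simp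
  show "\<exists>j\<in>J - I. insert j I \<in> \<I>" if "I \<in> \<I>" "J \<in> \<I>" "card I < card J" for I J
    using *[THEN conjunct2, THEN conjunct2, THEN conjunct2, THEN conjunct2] that by simp
qed

text \<open>Truncation at the common size of the label sets turns the independent sets that
  represent a value into bases.\<close>

lemma matroid_truncation:
  assumes "matroid E \<I>"
  shows "matroid E {X \<in> \<I>. card X \<le> r}"
proof -
  note E = matroidD(1-3)[OF assms] and her = matroidD(4)[OF assms] and aug = matroidD(5)[OF assms]
  have fin: "finite X" if "X \<in> \<I>" for X
    using finite_subset[OF _ E(1), of X] E(2) that by auto
  show ?thesis
    unfolding matroid_def
  proof (intro conjI ballI allI impI)
    fix I J assume I: "I \<in> {X \<in> \<I>. card X \<le> r}" and "J \<subseteq> I"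
    then show "J \<in> {X \<in> \<I>. card X \<le> r}"
      using her[of I J] card_mono[of I J] fin[of I] by auto
  next
    fix I J assume *: "I \<in> {X \<in> \<I>. card X \<le> r}" "J \<in> {X \<in> \<I>. card X \<le> r}" "card I < card J"
    then obtain j where "j \<in> J - I" "insert j I \<in> \<I>" using aug by blast
    moreover have "card (insert j I) \<le> r" using * fin[of I] card_insert_le_m1
      by (simp add: card_insert_if)
    ultimately show "\<exists>j\<in>J - I. insert j I \<in> {X \<in> \<I>. card X \<le> r}" by blast
  qed (use E in auto)
qed

text \<open>The rank is a parameter because the intersection theorem needs two matroids on different
  ground sets with one and the same rank.\<close>

locale ranked_matroid =
  fixes E :: "'a set" and \<I> :: "'a set set" and r :: nat
  assumes matroid: "matroid E \<I>"
    and card_le: "X \<in> \<I> \<Longrightarrow> card X \<le> r"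
    and ex_basis: "\<exists>X\<in>\<I>. card X = r"
begin

definition bases :: "'a set set" where
  "bases = {B \<in> \<I>. card B = r}"

text \<open>Integer valued, because differences of ranks such as \<open>layer_rank\<close> and the
  connectivity defects are formed throughout.\<close>

definition rk :: "'a set \<Rightarrow> int" where
  "rk S = int (Max (card ` {X \<in> \<I>. X \<subseteq> S}))"

definition spans :: "'a set \<Rightarrow> 'a set \<Rightarrow> bool" where
  "spans B S \<longleftrightarrow> int (card (B \<inter> S)) = rk S"

definition max_weight :: "('a \<Rightarrow> real) \<Rightarrow> real" where
  "max_weight x = Max (sum x ` bases)"

text \<open>
  The layer \<open>x = s\<close> carries the minor obtained by contracting the elements of larger weight and deleting
  those of smaller weight. The maximum weight bases are the bases of the direct sum of these minors,
  so \<open>layered_rank x\<close> is the rank function of the matroid of maximum weight bases.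
\<close>

definition layer_rank :: "('a \<Rightarrow> real) \<Rightarrow> real \<Rightarrow> 'a set \<Rightarrow> int" where
  "layer_rank x s K = rk ({e \<in> E. x e > s} \<union> {e \<in> E \<inter> K. x e = s}) - rk {e \<in> E. x e > s}"

definition layered_rank :: "('a \<Rightarrow> real) \<Rightarrow> 'a set \<Rightarrow> int" where
  "layered_rank x K = (\<Sum>s\<in>x ` E. layer_rank x s K)"

lemma finite_ground: "finite E"
  using matroid unfolding matroid_def by blast

lemma indep_subset: "X \<in> \<I> \<Longrightarrow> X \<subseteq> E"
  using matroid unfolding matroid_def by blast

lemma finite_indep: "X \<in> \<I> \<Longrightarrow> finite X"
  using finite_ground indep_subset finite_subset by blast

lemma finite_family: "finite \<I>"
  by (rule finite_subset[of _ "Pow E"]) (use finite_ground indep_subset in auto)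

lemma empty_indep: "{} \<in> \<I>"
  using matroid unfolding matroid_def by blast

lemma indep_hereditary: "X \<in> \<I> \<Longrightarrow> Y \<subseteq> X \<Longrightarrow> Y \<in> \<I>"
  using matroid unfolding matroid_def by blast

lemma augment: "X \<in> \<I> \<Longrightarrow> Y \<in> \<I> \<Longrightarrow> card X < card Y \<Longrightarrow> \<exists>y\<in>Y - X. insert y X \<in> \<I>"
  using matroid unfolding matroid_def by blast

lemma extend_indep:
  assumes "X \<in> \<I>" "Y \<in> \<I>" "card X \<le> card Y"
  shows "\<exists>Z\<in>\<I>. X \<subseteq> Z \<and> Z \<subseteq> X \<union> Y \<and> card Z = card Y"
  using assms
proof (induction "card Y - card X" arbitrary: X)
  case 0
  then show ?case by (intro bexI[of _ X]) auto
next
  case (Suc n)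
  then obtain y where y: "y \<in> Y - X" "insert y X \<in> \<I>"
    using augment[of X Y] by fastforce
  then have "card (insert y X) = Suc (card X)"
    using finite_indep Suc.prems by simp
  then have "\<exists>Z\<in>\<I>. insert y X \<subseteq> Z \<and> Z \<subseteq> insert y X \<union> Y \<and> card Z = card Y"
    using Suc.hyps(1)[of "insert y X"] Suc.hyps(2) Suc.prems y by simp
  then show ?case using y by blast
qed

lemma finite_basis: "B \<in> bases \<Longrightarrow> finite B"
  and basis_subset: "B \<in> bases \<Longrightarrow> B \<subseteq> E"
  and card_basis: "B \<in> bases \<Longrightarrow> card B = r"
  and basis_indep: "B \<in> bases \<Longrightarrow> B \<in> \<I>"
  using finite_indep indep_subset by (auto simp: bases_def)

lemma finite_bases: "finite bases"
  using finite_family by (simp add: bases_def)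

lemma bases_nonempty: "bases \<noteq> {}"
  using ex_basis by (auto simp: bases_def)

lemma rk_obtain:
  obtains X where "X \<in> \<I>" "X \<subseteq> S" "int (card X) = rk S"
proof -
  have "Max (card ` {X \<in> \<I>. X \<subseteq> S}) \<in> card ` {X \<in> \<I>. X \<subseteq> S}"
    by (rule Max_in) (use finite_family empty_indep in auto)
  then show ?thesis using that by (auto simp: rk_def)
qed

lemma indep_le_rk: "X \<in> \<I> \<Longrightarrow> X \<subseteq> S \<Longrightarrow> int (card X) \<le> rk S"
  unfolding rk_def using finite_family by (auto intro!: Max_ge)

lemma rk_mono: "S \<subseteq> T \<Longrightarrow> rk S \<le> rk T"
  by (metis indep_le_rk order_trans rk_obtain)

lemma basis_inter_le: "B \<in> bases \<Longrightarrow> int (card (B \<inter> S)) \<le> rk S"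
  by (meson basis_indep indep_hereditary indep_le_rk inf_le1 inf_le2)

lemma rk_submodular: "rk (S \<union> T) + rk (S \<inter> T) \<le> rk S + rk T"
proof -
  obtain X where X: "X \<in> \<I>" "X \<subseteq> S \<inter> T" "int (card X) = rk (S \<inter> T)" by (rule rk_obtain)
  obtain Y where Y: "Y \<in> \<I>" "Y \<subseteq> S \<union> T" "int (card Y) = rk (S \<union> T)" by (rule rk_obtain)
  have "card X \<le> card Y" using X Y rk_mono[of "S \<inter> T" "S \<union> T"] by force
  then obtain Z where Z: "Z \<in> \<I>" "X \<subseteq> Z" "Z \<subseteq> X \<union> Y" "card Z = card Y"
    using extend_indep X Y by blast
  have fin: "finite Z" using Z finite_indep by blast
  have "Z = (Z \<inter> S) \<union> (Z \<inter> T)" using Z X Y by blast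
  then have "card Z + card (Z \<inter> S \<inter> T) = card (Z \<inter> S) + card (Z \<inter> T)"
    using card_Un_Int[of "Z \<inter> S" "Z \<inter> T"] fin by (simp add: Int_ac)
  moreover have "card X \<le> card (Z \<inter> S \<inter> T)" using X Z fin by (intro card_mono) auto
  moreover have "int (card (Z \<inter> S)) \<le> rk S" "int (card (Z \<inter> T)) \<le> rk T"
    by (meson Z(1) indep_hereditary indep_le_rk inf_le1 inf_le2)+
  ultimately show ?thesis using X Y Z by linarith
qed

lemma rk_Un_le: "finite T \<Longrightarrow> rk (S \<union> T) \<le> rk S + int (card T)"
proof -
  assume T: "finite T"
  obtain X where X: "X \<in> \<I>" "X \<subseteq> T" "int (card X) = rk T" by (rule rk_obtain)
  have "rk T \<le> int (card T)" using X card_mono[OF T, of X] by simp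
  moreover have "rk (S \<inter> T) \<ge> 0" by (metis of_nat_0_le_iff rk_obtain)
  ultimately show ?thesis using rk_submodular[of S T] by linarith
qed

lemma spans_Un_Int:
  assumes "B \<in> bases" "spans B S" "spans B T"
  shows "spans B (S \<union> T)" "spans B (S \<inter> T)"
proof -
  have "card (B \<inter> S) + card (B \<inter> T) = card (B \<inter> (S \<union> T)) + card (B \<inter> (S \<inter> T))"
    using card_Un_Int[of "B \<inter> S" "B \<inter> T"] finite_basis[OF assms(1)]
    by (simp add: Int_Un_distrib Int_ac)
  moreover note basis_inter_le[OF assms(1), of "S \<union> T"] basis_inter_le[OF assms(1), of "S \<inter> T"]
    rk_submodular[of S T]
  ultimately show "spans B (S \<union> T)" "spans B (S \<inter> T)" using assms unfolding spans_def by linarith+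
qed

lemma spans_modular:
  assumes "B \<in> bases" "spans B S" "spans B T"
  shows "rk (S \<union> T) + rk (S \<inter> T) = rk S + rk T"
proof -
  have "card (B \<inter> S) + card (B \<inter> T) = card (B \<inter> (S \<union> T)) + card (B \<inter> (S \<inter> T))"
    using card_Un_Int[of "B \<inter> S" "B \<inter> T"] finite_basis[OF assms(1)]
    by (simp add: Int_Un_distrib Int_ac)
  then show ?thesis using spans_Un_Int[OF assms] assms unfolding spans_def by linarith
qed

section \<open>Weights of bases as integrals over thresholds\<close>

lemma max_weight_ge: "B \<in> bases \<Longrightarrow> sum x B \<le> max_weight x"
  unfolding max_weight_def using finite_bases by (auto intro: Max_ge)

lemma max_weight_obtain:
  obtains B where "B \<in> bases" "sum x B = max_weight x"
proof -
  have "max_weight x \<in> sum x ` bases" unfolding max_weight_def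
    by (rule Max_in) (use finite_bases bases_nonempty in auto)
  then show ?thesis using that by auto
qed

text \<open>The greedy property: if B met L in too few elements, some e of L could enter B, and the
  element that leaves would lie outside L and hence weigh strictly less.\<close>

lemma max_basis_exchange:
  assumes B: "B \<in> bases" "sum x B = max_weight x"
    and up: "\<And>e f. e \<in> L \<Longrightarrow> f \<in> E - L \<Longrightarrow> x f < x e"
  shows "spans B L"
proof (rule ccontr)
  assume "\<not> spans B L"
  then have lt: "int (card (B \<inter> L)) < rk L"
    using basis_inter_le[OF B(1), of L] unfolding spans_def by linarith
  obtain X where X: "X \<in> \<I>" "X \<subseteq> L" "int (card X) = rk L" by (rule rk_obtain)
  have BL: "B \<inter> L \<in> \<I>" using B(1) basis_indep indep_hereditary by blast
  then obtain e where e: "e \<in> X - B \<inter> L" "insert e (B \<inter> L) \<in> \<I>"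
    using augment[of "B \<inter> L" X] X lt by auto
  then have eL: "e \<in> L" "e \<notin> B" using X by auto
  \<comment> \<open>B' has the size of B and lies in \<open>insert e B\<close>, so exactly one
    element leaves; as B' keeps \<open>B \<inter> L\<close>, that element is outside L.\<close>
  obtain B' where B': "B' \<in> \<I>" "insert e (B \<inter> L) \<subseteq> B'" "B' \<subseteq> insert e (B \<inter> L) \<union> B" "card B' = card B"
    using extend_indep[OF e(2) basis_indep[OF B(1)]] card_le[OF e(2)] card_basis[OF B(1)] by auto
  have finB: "finite B" using B(1) finite_basis by blast
  have sub: "B' \<subseteq> insert e B" using B' by blast
  have "card (insert e B - B') = 1"
    using card_Diff_subset[OF _ sub] finB sub B'(4) eL finite_subset[OF sub] by simp
  then obtain f where f: "insert e B - B' = {f}" using card_1_singletonE by blast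
  have fB: "f \<in> B - L" using f B' by blast
  have eq: "B' = insert e (B - {f})" using f sub B' by blast
  have "sum x B' = sum x B - x f + x e"
    unfolding eq using eL fB finB by (simp add: sum_diff1)
  moreover have "x f < x e" using up[OF eL(1)] fB basis_subset[OF B(1)] by blast
  moreover have "B' \<in> bases" using B' B(1) by (simp add: bases_def)
  ultimately show False using max_weight_ge[of B' x] B(2) by simp
qed

lemma max_basis_spans:
  assumes "B \<in> bases" "sum x B = max_weight x"
  shows "spans B {e \<in> E. t \<le> x e}" "spans B {e \<in> E. t < x e}"
  by (rule max_basis_exchange[OF assms]; fastforce)+

text \<open>Layer cake formula for reals of either sign: the window \<open>{-c..c}\<close> shifts a
  single weight by c, and hence the weight of a basis by \<open>real r * c\<close>. The shifts
  cancel in all comparisons.\<close>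

lemma has_integral_threshold:
  fixes c y :: real
  assumes "\<bar>y\<bar> \<le> c"
  shows "((\<lambda>t. if t \<le> y then 1 else 0) has_integral (y + c)) {-c..c}"
proof -
  have "((\<lambda>t. 1::real) has_integral (y + c)) {-c..y}"
    using has_integral_const_real[of "1::real" "-c" y] assms by (auto simp: abs_le_iff)
  then have "((\<lambda>t. if t \<in> {-c..y} then 1 else 0::real) has_integral (y + c)) {-c..c}"
    using assms by (subst has_integral_restrict) auto
  then show ?thesis
    by (rule has_integral_eq[rotated]) auto
qed

lemma basis_weight_integral:
  assumes B: "B \<in> bases" and c: "\<And>e. e \<in> E \<Longrightarrow> \<bar>x e\<bar> \<le> c"
  shows "((\<lambda>t. real (card (B \<inter> {e \<in> E. t \<le> x e}))) has_integral (sum x B + real r * c)) {-c..c}"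
proof -
  have "((\<lambda>t. \<Sum>e\<in>B. if t \<le> x e then 1 else 0::real) has_integral (\<Sum>e\<in>B. x e + c)) {-c..c}"
    using finite_basis[OF B] basis_subset[OF B] c
    by (intro has_integral_sum has_integral_threshold) auto
  moreover have "(\<Sum>e\<in>B. x e + c) = sum x B + real r * c"
    using card_basis[OF B] by (simp add: sum.distrib)
  moreover have "(\<Sum>e\<in>B. if t \<le> x e then 1 else 0) = real (card (B \<inter> {e \<in> E. t \<le> x e}))" for t
  proof -
    have "B \<inter> {e \<in> E. t \<le> x e} = B \<inter> {e. t \<le> x e}" using basis_subset[OF B] by auto
    then show ?thesis using finite_basis[OF B]
      by (simp add: sum.If_cases)
  qed
  ultimately show ?thesis by simp
qed

text \<open>
  Since a maximum weight basis spans every upper level set, its weight is the integral of their ranks.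
\<close>

lemma max_weight_integral:
  assumes c: "\<And>e. e \<in> E \<Longrightarrow> \<bar>x e\<bar> \<le> c"
  shows "((\<lambda>t. real_of_int (rk {e \<in> E. t \<le> x e})) has_integral (max_weight x + real r * c)) {-c..c}"
proof -
  obtain B where B: "B \<in> bases" "sum x B = max_weight x" by (rule max_weight_obtain)
  have "real_of_int (rk {e \<in> E. t \<le> x e}) = real (card (B \<inter> {e \<in> E. t \<le> x e}))" for t
    using max_basis_spans(1)[OF B, of t] unfolding spans_def by (metis of_int_of_nat_eq)
  then show ?thesis using basis_weight_integral[OF B(1), of x c] c B(2) by simp
qed

text \<open>Spanning every upper level set makes the integrand for B equal to the integrand for the
  maximum weight.\<close>

lemma max_basisI:
  assumes B: "B \<in> bases" and sp: "\<And>t. spans B {e \<in> E. t \<le> x e}"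
  shows "sum x B = max_weight x"
proof -
  define c where "c = (\<Sum>e\<in>E. \<bar>x e\<bar>)"
  have c: "\<bar>x e\<bar> \<le> c" if "e \<in> E" for e
    unfolding c_def using member_le_sum[of e E "\<lambda>e. \<bar>x e\<bar>"] that finite_ground by auto
  have "real_of_int (rk {e \<in> E. t \<le> x e}) = real (card (B \<inter> {e \<in> E. t \<le> x e}))" for t
    using sp[of t] unfolding spans_def by (metis of_int_of_nat_eq)
  then have "sum x B + real r * c = max_weight x + real r * c"
    using has_integral_unique[OF basis_weight_integral[OF B, of x c]] max_weight_integral[of x c] c by simp
  then show ?thesis by simp
qed

lemma common_bound: "\<exists>c\<ge>m. \<forall>x\<in>set xs. \<forall>e\<in>E. \<bar>x e\<bar> \<le> (c::real)"
proof -
  define c where "c = \<bar>m\<bar> + (\<Sum>x\<in>set xs. \<Sum>e\<in>E. \<bar>x e\<bar>)"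
  have "\<bar>x e\<bar> \<le> c" if "x \<in> set xs" "e \<in> E" for x e
  proof -
    have "\<bar>x e\<bar> \<le> (\<Sum>e\<in>E. \<bar>x e\<bar>)" using member_le_sum[of e E "\<lambda>e. \<bar>x e\<bar>"] that finite_ground by auto
    also have "\<dots> \<le> (\<Sum>x\<in>set xs. \<Sum>e\<in>E. \<bar>x e\<bar>)"
      using member_le_sum[of x "set xs" "\<lambda>x. \<Sum>e\<in>E. \<bar>x e\<bar>"] that by (auto simp: sum_nonneg)
    finally show ?thesis by (simp add: c_def)
  qed
  moreover have "c \<ge> m" unfolding c_def
    by (smt (verit) abs_ge_self abs_ge_zero sum_nonneg)
  ultimately show ?thesis by blast
qed

text \<open>The upper level sets of \<open>max\<close> and \<open>min\<close> are unions and
  intersections of those of x and y, so \<open>rk_submodular\<close> can be integrated over all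
  thresholds.\<close>

lemma max_weight_submodular:
  "max_weight (\<lambda>e. max (x e) (y e)) + max_weight (\<lambda>e. min (x e) (y e)) \<le> max_weight x + max_weight y"
proof -
  obtain c where c: "\<forall>z\<in>set [x, y, \<lambda>e. max (x e) (y e), \<lambda>e. min (x e) (y e)]. \<forall>e\<in>E. \<bar>z e\<bar> \<le> c"
    using common_bound by blast
  let ?R = "\<lambda>x t. real_of_int (rk {e \<in> E. t \<le> x e})"
  have "((\<lambda>t. ?R (\<lambda>e. max (x e) (y e)) t + ?R (\<lambda>e. min (x e) (y e)) t) has_integral
      ((max_weight (\<lambda>e. max (x e) (y e)) + real r * c) + (max_weight (\<lambda>e. min (x e) (y e)) + real r * c))) {-c..c}"
    using c by (intro has_integral_add max_weight_integral) auto
  moreover have "((\<lambda>t. ?R x t + ?R y t) has_integral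
      ((max_weight x + real r * c) + (max_weight y + real r * c))) {-c..c}"
    using c by (intro has_integral_add max_weight_integral) auto
  ultimately have "(max_weight (\<lambda>e. max (x e) (y e)) + real r * c) + (max_weight (\<lambda>e. min (x e) (y e)) + real r * c)
      \<le> (max_weight x + real r * c) + (max_weight y + real r * c)"
  proof (rule has_integral_le)
    fix t
    have "{e \<in> E. t \<le> max (x e) (y e)} = {e \<in> E. t \<le> x e} \<union> {e \<in> E. t \<le> y e}"
      "{e \<in> E. t \<le> min (x e) (y e)} = {e \<in> E. t \<le> x e} \<inter> {e \<in> E. t \<le> y e}" by auto
    then show "?R (\<lambda>e. max (x e) (y e)) t + ?R (\<lambda>e. min (x e) (y e)) t \<le> ?R x t + ?R y t"
      using rk_submodular[of "{e \<in> E. t \<le> x e}" "{e \<in> E. t \<le> y e}"] by auto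
  qed
  then show ?thesis by simp
qed

section \<open>The matroid of maximum weight bases, layer by layer\<close>

lemma layer_rank_submodular: "layer_rank x s (S \<union> T) + layer_rank x s (S \<inter> T) \<le> layer_rank x s S + layer_rank x s T"
proof -
  let ?F = "\<lambda>K. {e \<in> E. x e > s} \<union> {e \<in> E \<inter> K. x e = s}"
  have "?F (S \<union> T) = ?F S \<union> ?F T" "?F (S \<inter> T) = ?F S \<inter> ?F T" by auto
  then show ?thesis unfolding layer_rank_def using rk_submodular[of "?F S" "?F T"] by simp
qed

lemma layer_rank_mono: "S \<subseteq> T \<Longrightarrow> layer_rank x s S \<le> layer_rank x s T"
  unfolding layer_rank_def by (smt (verit) rk_mono Collect_mono Int_iff Un_mono order_refl subsetD)

lemma layer_rank_empty: "layer_rank x s {} = 0"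
  by (simp add: layer_rank_def)

lemma layer_rank_insert_le: "layer_rank x s (insert a S) \<le> layer_rank x s S + (if x a = s then 1 else 0)"
proof -
  have "rk ({e \<in> E. x e > s} \<union> {e \<in> E \<inter> insert a S. x e = s})
    \<le> rk (({e \<in> E. x e > s} \<union> {e \<in> E \<inter> S. x e = s}) \<union> (if x a = s then {a} else {}))"
    by (rule rk_mono) auto
  also have "\<dots> \<le> rk ({e \<in> E. x e > s} \<union> {e \<in> E \<inter> S. x e = s}) + (if x a = s then 1 else 0)"
    using rk_Un_le[of "{a}"] by auto
  finally show ?thesis unfolding layer_rank_def by simp
qed

lemma layered_rank_submodular: "layered_rank x (S \<union> T) + layered_rank x (S \<inter> T) \<le> layered_rank x S + layered_rank x T"
  unfolding layered_rank_def sum.distrib[symmetric] by (intro sum_mono layer_rank_submodular)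

lemma layered_rank_mono: "S \<subseteq> T \<Longrightarrow> layered_rank x S \<le> layered_rank x T"
  unfolding layered_rank_def by (intro sum_mono layer_rank_mono)

lemma layered_rank_empty: "layered_rank x {} = 0"
  by (simp add: layered_rank_def layer_rank_empty)

lemma layered_rank_insert_le: "layered_rank x (insert e S) \<le> layered_rank x S + 1"
proof -
  have "layered_rank x (insert e S) \<le> (\<Sum>s\<in>x ` E. layer_rank x s S + (if x e = s then 1 else 0))"
    unfolding layered_rank_def by (intro sum_mono layer_rank_insert_le)
  also have "\<dots> = layered_rank x S + (\<Sum>s\<in>x ` E. if x e = s then 1 else 0)"
    by (simp add: layered_rank_def sum.distrib)
  also have "(\<Sum>s\<in>x ` E. if x e = s then 1 else 0::int) \<le> 1"
    using finite_ground by (simp add: sum.delta')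
  finally show ?thesis by simp
qed

lemma card_layers:
  assumes "B \<subseteq> E"
  shows "int (card (B \<inter> K)) = (\<Sum>s\<in>x ` E. int (card {e \<in> B \<inter> K. x e = s}))"
proof -
  have fin: "finite (B \<inter> K)" using assms finite_ground finite_subset by blast
  have "card (B \<inter> K) = (\<Sum>s\<in>x ` E. card {e \<in> B \<inter> K. x e = s})"
    using sum.group[OF fin, of "x ` E" x "\<lambda>_. 1::nat"] assms finite_ground
    by (simp add: image_mono le_infI1)
  then show ?thesis by simp
qed

lemma max_basis_card_layer:
  assumes B: "B \<in> bases" "sum x B = max_weight x"
  shows "int (card {e \<in> B \<inter> K. x e = s}) = int (card (B \<inter> ({e \<in> E. x e > s} \<union> {e \<in> E \<inter> K. x e = s}))) - rk {e \<in> E. x e > s}"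
proof -
  have "B \<inter> ({e \<in> E. x e > s} \<union> {e \<in> E \<inter> K. x e = s}) = (B \<inter> {e \<in> E. x e > s}) \<union> {e \<in> B \<inter> K. x e = s}"
    using basis_subset[OF B(1)] by auto
  moreover have "card \<dots> = card (B \<inter> {e \<in> E. x e > s}) + card {e \<in> B \<inter> K. x e = s}"
    using finite_basis[OF B(1)] by (intro card_Un_disjoint) auto
  ultimately show ?thesis using max_basis_spans(2)[OF B, of s] unfolding spans_def by simp
qed

lemma max_basis_le_layered_rank:
  assumes B: "B \<in> bases" "sum x B = max_weight x"
  shows "int (card (B \<inter> K)) \<le> layered_rank x K"
  unfolding layered_rank_def card_layers[OF basis_subset[OF B(1)], of K x]
    max_basis_card_layer[OF B] layer_rank_def
  by (intro sum_mono) (use basis_inter_le[OF B(1)] in auto)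

lemma finite_gap: "\<exists>d>0. \<forall>e\<in>E. \<forall>f\<in>E. x e < x f \<longrightarrow> x e + d < (x f::real)"
proof -
  \<comment> \<open>The 2 keeps the set nonempty when x is constant on E. Half of the minimum is
    used below because the gap has to be strict.\<close>
  let ?D = "insert 2 ((\<lambda>(e, f). x f - x e) ` {(e, f) \<in> E \<times> E. x e < x f})"
  have fin: "finite ?D" using finite_ground by (auto intro: finite_subset[of _ "E \<times> E"])
  have pos: "Min ?D > 0" using fin by (subst Min_gr_iff) auto
  have "x e + Min ?D / 2 < x f" if "e \<in> E" "f \<in> E" "x e < x f" for e f
  proof -
    have "Min ?D \<le> x f - x e" using that by (intro Min_le fin) auto
    then show ?thesis using pos by linarith
  qed
  then show ?thesis using pos by (intro exI[of _ "Min ?D / 2"]) auto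
qed

text \<open>Raising K by less than every gap of x refines the order of the weights
  lexicographically. A maximum basis for the refined weights still spans all upper level sets of x,
  and within each layer it meets K as often as possible. Thus \<open>layered_rank x K\<close> is the
  slope of \<open>max_weight\<close> at x in the direction of K.\<close>

lemma perturb:
  assumes d: "0 < d" "\<forall>e\<in>E. \<forall>f\<in>E. x e < x f \<longrightarrow> x e + d < x f"
  shows "\<exists>B\<in>bases. sum x B = max_weight x \<and> int (card (B \<inter> K)) = layered_rank x K \<and>
    max_weight (\<lambda>e. x e + (if e \<in> K then d else 0)) = max_weight x + d * real_of_int (layered_rank x K)"
proof -
  define y where "y e = x e + (if e \<in> K then d else 0)" for e
  obtain B where B: "B \<in> bases" "sum y B = max_weight y" by (rule max_weight_obtain)
  have gap: "x e + d < x f" if "e \<in> E" "f \<in> E" "x e < x f" for e f using d that by blast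
  have sp1: "spans B {e \<in> E. t \<le> x e}" for t
  proof (rule max_basis_exchange[OF B])
    fix e f assume "e \<in> {e \<in> E. t \<le> x e}" "f \<in> E - {e \<in> E. t \<le> x e}"
    then show "y f < y e" using gap[of f e] d(1) by (auto simp: y_def)
  qed
  have sp2: "spans B ({e \<in> E. x e > s} \<union> {e \<in> E \<inter> K. x e = s})" for s
  proof (rule max_basis_exchange[OF B])
    fix e f assume "e \<in> {e \<in> E. x e > s} \<union> {e \<in> E \<inter> K. x e = s}"
      "f \<in> E - ({e \<in> E. x e > s} \<union> {e \<in> E \<inter> K. x e = s})"
    then show "y f < y e" using gap[of f e] d(1) by (auto simp: y_def)
  qed
  have Bx: "sum x B = max_weight x" by (rule max_basisI[OF B(1) sp1])
  have layered_rank: "int (card (B \<inter> K)) = layered_rank x K"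
    unfolding layered_rank_def card_layers[OF basis_subset[OF B(1)], of K x]
      max_basis_card_layer[OF B(1) Bx] layer_rank_def
    by (intro sum.cong) (use sp2 in \<open>auto simp: spans_def\<close>)
  have "sum y B = sum x B + d * real (card (B \<inter> K))"
    using finite_basis[OF B(1)] by (simp add: y_def sum.distrib sum.If_cases)
  also have "real (card (B \<inter> K)) = real_of_int (layered_rank x K)" using layered_rank by (metis of_int_of_nat_eq)
  finally have "max_weight y = max_weight x + d * real_of_int (layered_rank x K)"
    using B(2) Bx by simp
  then show ?thesis using B(1) Bx layered_rank unfolding y_def by blast
qed

lemma layered_rank_full_basis:
  assumes "Z \<subseteq> E" "card Z = r" "layered_rank x Z = int r"
  shows "Z \<in> bases" "sum x Z = max_weight x"
proof -
  obtain d where "0 < d" "\<forall>e\<in>E. \<forall>f\<in>E. x e < x f \<longrightarrow> x e + d < x f" using finite_gap by blast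
  then obtain B where B: "B \<in> bases" "sum x B = max_weight x" "int (card (B \<inter> Z)) = layered_rank x Z"
    using perturb[of d x Z] by blast
  have "card (B \<inter> Z) = r" using B assms by simp
  then have "B \<inter> Z = B" "B \<inter> Z = Z"
    using card_subset_eq[of B "B \<inter> Z"] card_subset_eq[of Z "B \<inter> Z"] finite_basis[OF B(1)]
      card_basis[OF B(1)] assms finite_subset[OF assms(1) finite_ground] by auto
  then show "Z \<in> bases" "sum x Z = max_weight x" using B by auto
qed

end

section \<open>Weighted matroid intersection\<close>

text \<open>Rank functions of matroids without a family of independent sets: the induction below can
  then contract an element by changing the function alone, and the pullback of a rank along a
  labelling is again an instance.\<close>

definition rank_function :: "('a set \<Rightarrow> int) \<Rightarrow> bool" where
  "rank_function f \<longleftrightarrow> f {} = 0 \<and> (\<forall>S T. S \<subseteq> T \<longrightarrow> f S \<le> f T) \<and>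
     (\<forall>a S. f (insert a S) \<le> f S + 1) \<and> (\<forall>S T. f (S \<union> T) + f (S \<inter> T) \<le> f S + f T)"

lemma (in ranked_matroid) rank_function_layered_rank: "rank_function (layered_rank x)"
  by (simp add: rank_function_def layered_rank_empty layered_rank_mono layered_rank_insert_le layered_rank_submodular)

lemma rank_function_contract:
  assumes "rank_function f" "f {a} = 1"
  shows "rank_function (\<lambda>S. f (insert a S) - 1)"
proof -
  have "f (insert a (S \<union> T)) + f (insert a (S \<inter> T)) \<le> f (insert a S) + f (insert a T)" for S T
  proof -
    have "insert a (S \<union> T) = insert a S \<union> insert a T" "insert a (S \<inter> T) = insert a S \<inter> insert a T"
      by auto
    then show ?thesis using assms(1) by (simp only: rank_function_def)
  qed
  moreover have "f (insert a (insert b S)) \<le> f (insert a S) + 1" for b S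
    using assms(1) unfolding rank_function_def by (metis insert_commute)
  moreover have "S \<subseteq> T \<Longrightarrow> f (insert a S) \<le> f (insert a T)" for S T
    using assms(1) unfolding rank_function_def by (meson insert_mono)
  ultimately show ?thesis using assms(2) unfolding rank_function_def by (auto simp: algebra_simps)
qed

lemma rank_function_loop:
  assumes "rank_function f" "f {a} \<noteq> 1"
  shows "f (insert a S) = f S"
proof -
  have "f {a} \<le> 1" "0 \<le> f {a}" using assms(1) unfolding rank_function_def by (metis add_0 empty_subsetI)+
  then have "f {a} = 0" using assms(2) by linarith
  moreover have "f (S \<union> {a}) + f (S \<inter> {a}) \<le> f S + f {a}"
    using assms(1) unfolding rank_function_def by blast
  moreover have "f {} \<le> f (S \<inter> {a})" "f {} = 0" "f S \<le> f (insert a S)"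
    using assms(1) unfolding rank_function_def by (meson empty_subsetI subset_insertI)+
  ultimately show ?thesis by simp
qed

text \<open>The nontrivial half of Edmonds' min-max theorem. If the bound survives the deletion of
  a, delete it. Otherwise some S violates the bound without a; then a is a loop of neither function,
  and contracting a in both keeps the bound, since a violating set T after contraction could be
  uncrossed with S.\<close>

lemma matroid_intersection:
  assumes "finite E" "rank_function f" "rank_function g"
    and "\<And>S. S \<subseteq> E \<Longrightarrow> int k \<le> f S + g (E - S)"
  shows "\<exists>I\<subseteq>E. card I = k \<and> f I = int k \<and> g I = int k"
  using assms
proof (induction E arbitrary: f g k rule: finite_induct)
  case empty
  then have "int k \<le> f {} + g {}" by force
  then have "k = 0" using empty(1,2) unfolding rank_function_def by simp
  then show ?case using empty(1,2) unfolding rank_function_def by simp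
next
  case (insert a E)
  note f = insert.prems(1) and g = insert.prems(2) and bound = insert.prems(3)
  show ?case
  proof (cases "\<forall>S\<subseteq>E. int k \<le> f S + g (E - S)")
    case True
    then obtain I where "I \<subseteq> E" "card I = k \<and> f I = int k \<and> g I = int k"
      using insert.IH[OF f g] by meson
    then show ?thesis by blast
  next
    case False
    then obtain S where S: "S \<subseteq> E" "f S + g (E - S) < int k" by (auto simp: not_le)
    have aS: "a \<notin> S" using S insert.hyps by blast
    have fa: "f {a} = 1"
    proof (rule ccontr)
      assume "f {a} \<noteq> 1"
      then have "f (insert a S) = f S" using rank_function_loop[OF f] by blast
      moreover have "insert a E - insert a S = E - S" using insert.hyps by blast
      ultimately have "int k \<le> f S + g (E - S)"
        using bound[OF insert_mono[OF S(1), of a]] by (simp only:)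
      then show False using S(2) by linarith
    qed
    have ga: "g {a} = 1"
    proof (rule ccontr)
      assume "g {a} \<noteq> 1"
      then have "g (insert a (E - S)) = g (E - S)" using rank_function_loop[OF g] by blast
      moreover have "insert a E - S = insert a (E - S)" using aS by blast
      ultimately show False using bound[OF subset_insertI2[OF S(1)]] S(2) by simp
    qed
    define f' where "f' S = f (insert a S) - 1" for S
    define g' where "g' S = g (insert a S) - 1" for S
    have k: "k > 0"
    proof -
      have "f {} \<le> f S" "g {} \<le> g (E - S)"
        using f g unfolding rank_function_def by (meson empty_subsetI)+
      moreover have "f {} = 0" "g {} = 0" using f g unfolding rank_function_def by blast+
      ultimately show ?thesis using S by linarith
    qed
    \<comment> \<open>Uncrossing: S contributes at most k - 1 and T, with a added on both sides, at
      most k. Submodularity turns the two into values at \<open>insert a (S \<union> T)\<close> and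
      \<open>S \<inter> T\<close>, each of which is at least k by the assumed bound.\<close>
    have "int (k - 1) \<le> f' T + g' (E - T)" if T: "T \<subseteq> E" for T
    proof (rule ccontr)
      assume "\<not> ?thesis"
      then have *: "f (insert a T) + g (insert a (E - T)) \<le> int k"
        unfolding f'_def g'_def using k by linarith
      have 1: "int k \<le> f (insert a (S \<union> T)) + g (E - (S \<union> T))"
      proof -
        have "insert a E - insert a (S \<union> T) = E - (S \<union> T)" using insert.hyps by blast
        then show ?thesis using bound[of "insert a (S \<union> T)"] S T by (simp add: subset_insertI2)
      qed
      have 2: "int k \<le> f (S \<inter> T) + g (insert a (E - (S \<inter> T)))"
      proof -
        have "insert a E - (S \<inter> T) = insert a (E - (S \<inter> T))" using aS by blast
        then show ?thesis using bound[of "S \<inter> T"] S T by (metis le_infI1 subset_insertI2)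
      qed
      have "f (S \<union> insert a T) + f (S \<inter> insert a T) \<le> f S + f (insert a T)"
        using f unfolding rank_function_def by blast
      moreover have "S \<union> insert a T = insert a (S \<union> T)" "S \<inter> insert a T = S \<inter> T" using aS by auto
      moreover have "g ((E - S) \<union> insert a (E - T)) + g ((E - S) \<inter> insert a (E - T))
          \<le> g (E - S) + g (insert a (E - T))"
        using g unfolding rank_function_def by blast
      moreover have "(E - S) \<union> insert a (E - T) = insert a (E - (S \<inter> T))"
        "(E - S) \<inter> insert a (E - T) = E - (S \<union> T)" using insert.hyps by auto
      ultimately show False using 1 2 * S by simp
    qed
    then obtain I where I: "I \<subseteq> E" "card I = k - 1" "f' I = int (k - 1)" "g' I = int (k - 1)"
      using insert.IH[OF rank_function_contract[OF f fa] rank_function_contract[OF g ga], of "k - 1"]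
      unfolding f'_def g'_def by blast
    have "a \<notin> I" "finite I" using I(1) insert.hyps finite_subset by auto
    then have "card (insert a I) = k" using I k by simp
    then show ?thesis using I k unfolding f'_def g'_def by (intro exI[of _ "insert a I"]) auto
  qed
qed

section \<open>Systems of linear inequalities with a parameter\<close>

lemma between_finite_sets:
  fixes L U :: "'a \<Rightarrow> real"
  assumes "finite P" "finite N" "\<And>i j. i \<in> P \<Longrightarrow> j \<in> N \<Longrightarrow> L j \<le> U i"
  shows "\<exists>y. (\<forall>j\<in>N. L j \<le> y) \<and> (\<forall>i\<in>P. y \<le> U i)"
proof (cases "N = {}")
  case True
  show ?thesis
  proof (cases "P = {}")
    case False
    then show ?thesis using True assms(1) by (intro exI[of _ "Min (U ` P)"]) auto
  qed (use True in auto)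
next
  case False
  then show ?thesis using assms by (intro exI[of _ "Max (L ` N)"]) auto
qed

text \<open>
  Eliminating the variables shows that the set of attainable right hand sides is closed. This provides a
  minimizer of the piecewise linear dual objective of weighted matroid intersection.
\<close>

lemma fourier_motzkin:
  fixes C :: "(('v \<Rightarrow> real) \<times> real \<times> real) set"
  assumes "finite A" "finite C"
  shows "\<exists>D. finite D \<and> (\<forall>s. (\<exists>p. \<forall>(a, b, c)\<in>C. (\<Sum>v\<in>A. a v * p v) + b \<le> c * s) \<longleftrightarrow>
    (\<forall>(b, c)\<in>D. b \<le> c * s))"
  using assms
proof (induction A arbitrary: C rule: finite_induct)
  case empty
  then show ?case by (intro exI[of _ "snd ` C"]) (auto simp: split_beta)
next
  case (insert x A)
  define P where "P = {(a, b, c) \<in> C. a x > 0}"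
  define N where "N = {(a, b, c) \<in> C. a x < 0}"
  define Z where "Z = {(a, b, c) \<in> C. a x = 0}"
  \<comment> \<open>Division by the coefficient of x turns a member of P into an upper bound and a
    member of N into a lower bound on the variable x; their difference eliminates it. The
    coefficient c of the parameter s is carried along, so D does not depend on s.\<close>
  define comb :: "(('v \<Rightarrow> real) \<times> real \<times> real) \<times> (('v \<Rightarrow> real) \<times> real \<times> real) \<Rightarrow> _" where
    "comb = (\<lambda>((a, b, c), (a', b', c')).
      ((\<lambda>v. a v / a x - a' v / a' x), b / a x - b' / a' x, c / a x - c' / a' x))"
  define C' where "C' = Z \<union> comb ` (P \<times> N)"
  have fin: "finite P" "finite N" "finite Z"
    using insert.prems by (auto simp: P_def N_def Z_def intro: finite_subset)
  then have finC': "finite C'" by (simp add: C'_def)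
  have "(\<exists>p. \<forall>(a, b, c)\<in>C. (\<Sum>v\<in>insert x A. a v * p v) + b \<le> c * s) \<longleftrightarrow>
      (\<exists>p. \<forall>(a, b, c)\<in>C'. (\<Sum>v\<in>A. a v * p v) + b \<le> c * s)" for s
  proof
    assume "\<exists>p. \<forall>(a, b, c)\<in>C. (\<Sum>v\<in>insert x A. a v * p v) + b \<le> c * s"
    then obtain p where p': "\<forall>(a, b, c)\<in>C. (\<Sum>v\<in>insert x A. a v * p v) + b \<le> c * s" by blast
    have p: "(\<Sum>v\<in>A. a v * p v) + a x * p x + b \<le> c * s" if "(a, b, c) \<in> C" for a b c
      using bspec[OF p' that] insert.hyps by simp
    have "(\<Sum>v\<in>A. a v * p v) + b \<le> c * s" if "(a, b, c) \<in> Z" for a b c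
      using p[of a b c] that by (simp add: Z_def)
    moreover have "(\<Sum>v\<in>A. (a v / a x - a' v / a' x) * p v) + (b / a x - b' / a' x)
        \<le> (c / a x - c' / a' x) * s"
      if "(a, b, c) \<in> P" "(a', b', c') \<in> N" for a b c a' b' c'
    proof -
      have ax: "a x > 0" "a' x < 0" and mem: "(a, b, c) \<in> C" "(a', b', c') \<in> C"
        using that by (auto simp: P_def N_def)
      have "(\<Sum>v\<in>A. a v * p v) / a x + p x + b / a x \<le> c * s / a x"
        using divide_right_mono[OF p[OF mem(1)], of "a x"] ax by (simp add: add_divide_distrib)
      moreover have "c' * s / a' x \<le> (\<Sum>v\<in>A. a' v * p v) / a' x + p x + b' / a' x"
        using divide_right_mono_neg[OF p[OF mem(2)], of "a' x"] ax by (simp add: add_divide_distrib)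
      moreover have "(\<Sum>v\<in>A. (a v / a x - a' v / a' x) * p v)
          = (\<Sum>v\<in>A. a v * p v) / a x - (\<Sum>v\<in>A. a' v * p v) / a' x"
        by (simp add: left_diff_distrib sum_subtractf sum_divide_distrib)
      ultimately show ?thesis by (simp add: left_diff_distrib)
    qed
    ultimately show "\<exists>p. \<forall>(a, b, c)\<in>C'. (\<Sum>v\<in>A. a v * p v) + b \<le> c * s"
      by (intro exI[of _ p]) (force simp: C'_def comb_def)
  next
    assume "\<exists>p. \<forall>(a, b, c)\<in>C'. (\<Sum>v\<in>A. a v * p v) + b \<le> c * s"
    then obtain p where p: "(\<Sum>v\<in>A. a v * p v) + b \<le> c * s" if "(a, b, c) \<in> C'" for a b c
      by fastforce
    define B where "B = (\<lambda>(a, b, c). (c * s - b - (\<Sum>v\<in>A. a v * p v)) / a x)"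
    have "B j \<le> B i" if "i \<in> P" "j \<in> N" for i j
    proof -
      obtain a b c a' b' c' where ij: "i = (a, b, c)" "j = (a', b', c')" by (metis prod_cases3)
      have "comb (i, j) \<in> C'" using that by (auto simp: C'_def)
      then have "(\<Sum>v\<in>A. (a v / a x - a' v / a' x) * p v) + (b / a x - b' / a' x)
        \<le> (c / a x - c' / a' x) * s"
        using p unfolding ij comb_def by auto
      moreover have "(\<Sum>v\<in>A. (a v / a x - a' v / a' x) * p v)
          = (\<Sum>v\<in>A. a v * p v) / a x - (\<Sum>v\<in>A. a' v * p v) / a' x"
        by (simp add: left_diff_distrib sum_subtractf sum_divide_distrib)
      ultimately show ?thesis unfolding B_def ij by (simp add: diff_divide_distrib left_diff_distrib)
    qed
    then obtain y where y: "\<forall>j\<in>N. B j \<le> y" "\<forall>i\<in>P. y \<le> B i"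
      using between_finite_sets[OF fin(1,2), of B B] by blast
    define q where "q = p(x := y)"
    have "(\<Sum>v\<in>insert x A. a v * q v) + b \<le> c * s" if mem: "(a, b, c) \<in> C" for a b c
    proof -
      have eq: "(\<Sum>v\<in>insert x A. a v * q v) = a x * y + (\<Sum>v\<in>A. a v * p v)"
        using insert.hyps by (auto simp: q_def intro!: sum.cong)
      consider "a x = 0" | "a x > 0" | "a x < 0" by linarith
      then show ?thesis
      proof cases
        case 1
        then have "(a, b, c) \<in> C'" using mem by (auto simp: C'_def Z_def)
        then show ?thesis using p eq 1 by auto
      next
        case 2
        then have "(a, b, c) \<in> P" using mem by (auto simp: P_def)
        then have "y \<le> (c * s - b - (\<Sum>v\<in>A. a v * p v)) / a x" using y(2) unfolding B_def by auto
        then show ?thesis using 2 eq by (simp add: pos_le_divide_eq mult.commute)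
      next
        case 3
        then have "(a, b, c) \<in> N" using mem by (auto simp: N_def)
        then have "(c * s - b - (\<Sum>v\<in>A. a v * p v)) / a x \<le> y" using y(1) unfolding B_def by auto
        then show ?thesis using 3 eq by (simp add: neg_divide_le_eq mult.commute)
      qed
    qed
    then show "\<exists>p. \<forall>(a, b, c)\<in>C. (\<Sum>v\<in>insert x A. a v * p v) + b \<le> c * s" by blast
  qed
  then show ?case using insert.IH[OF finC'] by simp
qed

text \<open>After elimination the system is solvable at s iff finitely many inequalities
  \<open>b \<le> c * s\<close> hold, and these persist in the limit as s decreases to m.\<close>

lemma linear_system_closed:
  fixes C :: "(('v \<Rightarrow> real) \<times> real) set"
  assumes "finite A" "finite C"
    and "\<And>s. s > m \<Longrightarrow> \<exists>p. \<forall>(a, b)\<in>C. (\<Sum>v\<in>A. a v * p v) + b \<le> s"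
  shows "\<exists>p. \<forall>(a, b)\<in>C. (\<Sum>v\<in>A. a v * p v) + b \<le> m"
proof -
  let ?C = "(\<lambda>(a, b). (a, b, 1::real)) ` C"
  obtain D where D: "\<And>s. (\<exists>p. \<forall>(a, b, c)\<in>?C. (\<Sum>v\<in>A. a v * p v) + b \<le> c * s) \<longleftrightarrow>
    (\<forall>(b, c)\<in>D. b \<le> c * s)"
    using fourier_motzkin[OF assms(1), of ?C] assms(2) by blast
  have eq: "(\<exists>p. \<forall>(a, b)\<in>C. (\<Sum>v\<in>A. a v * p v) + b \<le> s) \<longleftrightarrow> (\<forall>(b, c)\<in>D. b \<le> c * s)" for s
    using D[of s] by (simp add: split_beta)
  have "b \<le> c * m" if "(b, c) \<in> D" for b c
  proof -
    have *: "b \<le> c * (m + e)" if "e > 0" for e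
      using assms(3)[of "m + e"] eq[of "m + e"] \<open>(b, c) \<in> D\<close> that by auto
    show ?thesis
    proof (rule field_le_epsilon)
      fix e :: real assume e: "e > 0"
      have "b \<le> c * m + c * (e / (\<bar>c\<bar> + 1))" using *[of "e / (\<bar>c\<bar> + 1)"] e by (simp add: distrib_left)
      moreover have "c * (e / (\<bar>c\<bar> + 1)) \<le> e"
        using e mult_right_mono[of c "\<bar>c\<bar> + 1" e] by (simp add: pos_divide_le_eq mult.commute)
      ultimately show "b \<le> c * m + e" by linarith
    qed
  qed
  then show ?thesis using eq[of m] by blast
qed

text \<open>The dual objective is \<open>L.max_weight p + M.max_weight (w - p \<circ> l)\<close>. At
  a minimizer p no direction given by a set of labels decreases it. The slopes are layered ranks, so
  this is precisely the min-max condition for a common basis of the two matroids of maximum weight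
  bases. The weight of such a basis equals the dual objective, so the minimum cannot exceed
  c.\<close>

lemma weighted_matroid_intersection:
  fixes w :: "'a \<Rightarrow> real" and l :: "'a \<Rightarrow> 'b"
  assumes L: "ranked_matroid A \<L> r" and M: "ranked_matroid E \<I> r" and lab: "l ` E \<subseteq> A"
    and common: "\<And>Z. Z \<in> \<I> \<Longrightarrow> card Z = r \<Longrightarrow> inj_on l Z \<Longrightarrow> l ` Z \<in> \<L> \<Longrightarrow> sum w Z \<le> c"
  shows "\<exists>p. \<forall>Z\<in>\<I>. \<forall>Y\<in>\<L>. card Z = r \<longrightarrow> card Y = r \<longrightarrow> sum w Z - (\<Sum>e\<in>Z. p (l e)) + sum p Y \<le> c"
proof (rule ccontr)
  interpret L: ranked_matroid A \<L> r by (rule L)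
  interpret M: ranked_matroid E \<I> r by (rule M)
  define x where "x p e = w e - p (l e)" for p :: "'b \<Rightarrow> real" and e
  define \<psi> where "\<psi> p = L.max_weight p + M.max_weight (x p)" for p
  have sumx: "sum (x p) Z = sum w Z - (\<Sum>e\<in>Z. p (l e))" for p Z
    by (simp add: x_def sum_subtractf)
  have psi_ge: "sum (x p) Z + sum p Y \<le> \<psi> p" if "Z \<in> M.bases" "Y \<in> L.bases" for p Z Y
    using M.max_weight_ge[OF that(1), of "x p"] L.max_weight_ge[OF that(2), of p] by (simp add: \<psi>_def)
  have psi_le: "\<psi> p \<le> s" if "\<And>Z Y. Z \<in> M.bases \<Longrightarrow> Y \<in> L.bases \<Longrightarrow> sum (x p) Z + sum p Y \<le> s" for p s
  proof -
    obtain Z where "Z \<in> M.bases" "sum (x p) Z = M.max_weight (x p)" by (rule M.max_weight_obtain)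
    moreover obtain Y where "Y \<in> L.bases" "sum p Y = L.max_weight p" by (rule L.max_weight_obtain)
    ultimately show ?thesis using that[of Z Y] by (simp add: \<psi>_def)
  qed
  assume no: "\<not> ?thesis"
  have psi_gt: "\<psi> p > c" for p
  proof -
    have "\<not> (\<forall>Z\<in>\<I>. \<forall>Y\<in>\<L>. card Z = r \<longrightarrow> card Y = r \<longrightarrow> sum w Z - (\<Sum>e\<in>Z. p (l e)) + sum p Y \<le> c)"
      using no by (rule contrapos_nn) (rule exI)
    then obtain Z Y where "Z \<in> M.bases" "Y \<in> L.bases" "sum w Z - (\<Sum>e\<in>Z. p (l e)) + sum p Y > c"
      by (auto simp: M.bases_def L.bases_def not_le)
    then show ?thesis using psi_ge[of Z Y p] by (simp add: sumx)
  qed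
  have bdd: "bdd_below (range \<psi>)" using psi_gt by (intro bdd_belowI[of _ c]) (auto intro: less_imp_le)
  define m where "m = Inf (range \<psi>)"
  \<comment> \<open>The affine pieces of \<psi>, one for every pair of bases: the vector of
    coefficients of the label potentials, and the constant term.\<close>
  define C where "C = (\<lambda>(Z, Y). ((\<lambda>v. of_bool (v \<in> Y) - real (card {e \<in> Z. l e = v})), sum w Z))
    ` (M.bases \<times> L.bases)"
  have finC: "finite C" by (simp add: C_def M.finite_bases L.finite_bases)
  have lin: "(\<Sum>v\<in>A. (of_bool (v \<in> Y) - real (card {e \<in> Z. l e = v})) * p v) + sum w Z = sum (x p) Z + sum p Y"
    if Z: "Z \<in> M.bases" and Y: "Y \<in> L.bases" for Z Y p
  proof -
    have "(\<Sum>v\<in>A. of_bool (v \<in> Y) * p v) = sum p (A \<inter> Y)"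
      using L.finite_ground by (simp add: sum.inter_restrict of_bool_def if_distrib if_distribR cong: if_cong)
    moreover have "A \<inter> Y = Y" using L.basis_subset[OF Y] by blast
    moreover have "(\<Sum>v\<in>A. real (card {e \<in> Z. l e = v}) * p v) = (\<Sum>v\<in>A. \<Sum>e\<in>{e \<in> Z. l e = v}. p (l e))"
      by simp
    moreover have "\<dots> = (\<Sum>e\<in>Z. p (l e))"
      using M.finite_basis[OF Z] L.finite_ground M.basis_subset[OF Z] lab by (intro sum.group) auto
    ultimately show ?thesis by (simp add: left_diff_distrib sum_subtractf sumx)
  qed
  have C_iff: "(\<forall>(a, b)\<in>C. (\<Sum>v\<in>A. a v * p v) + b \<le> s) \<longleftrightarrow> \<psi> p \<le> s" for p s
  proof -
    have "(\<forall>(a, b)\<in>C. (\<Sum>v\<in>A. a v * p v) + b \<le> s) \<longleftrightarrow>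
        (\<forall>Z\<in>M.bases. \<forall>Y\<in>L.bases. sum (x p) Z + sum p Y \<le> s)"
      using lin by (auto simp: C_def)
    also have "\<dots> \<longleftrightarrow> \<psi> p \<le> s" using psi_le[of p s] by (blast intro: order_trans[OF psi_ge])
    finally show ?thesis .
  qed
  have "\<exists>p. \<forall>(a, b)\<in>C. (\<Sum>v\<in>A. a v * p v) + b \<le> m"
  proof (rule linear_system_closed[OF L.finite_ground finC])
    fix s assume "s > m"
    then obtain p where "\<psi> p < s" unfolding m_def using cInf_lessD[of "range \<psi>" s] by auto
    then show "\<exists>p. \<forall>(a, b)\<in>C. (\<Sum>v\<in>A. a v * p v) + b \<le> s" unfolding C_iff by (meson less_imp_le)
  qed
  then obtain p where "\<psi> p \<le> m" unfolding C_iff by blast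
  then have min: "\<psi> p \<le> \<psi> q" for q
    using cInf_lower[OF _ bdd, of "\<psi> q"] by (simp add: m_def)
  obtain dL where dL: "dL > 0" "\<forall>e\<in>A. \<forall>f\<in>A. p e < p f \<longrightarrow> p e + dL < p f" using L.finite_gap by blast
  obtain dM where dM: "dM > 0" "\<forall>e\<in>E. \<forall>f\<in>E. x p e < x p f \<longrightarrow> x p e + dM < x p f" using M.finite_gap by blast
  define d where "d = min dL dM"
  have d: "d > 0" "\<forall>e\<in>A. \<forall>f\<in>A. p e < p f \<longrightarrow> p e + d < p f"
    "\<forall>e\<in>E. \<forall>f\<in>E. x p e < x p f \<longrightarrow> x p e + d < x p f"
    using dL dM unfolding d_def by (auto simp: min_def) force+
  \<comment> \<open>Raising p by d on the labels T lowers the reduced weights by d outside K. Up to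
    the constant \<open>real r * d\<close> this is a raise by d on K, so \<open>perturb\<close>
    gives both slopes.\<close>
  have cond: "int r \<le> L.layered_rank p (l ` S) + M.layered_rank (x p) (E - S)" if S: "S \<subseteq> E" for S
  proof -
    define T where "T = l ` S"
    define K where "K = {e \<in> E. l e \<notin> T}"
    define q where "q v = p v + (if v \<in> T then d else 0)" for v
    have 1: "L.max_weight q = L.max_weight p + d * real_of_int (L.layered_rank p T)"
      using L.perturb[OF d(1,2), of T] unfolding q_def by blast
    have 2: "M.max_weight (\<lambda>e. x p e + (if e \<in> K then d else 0)) = M.max_weight (x p) + d * real_of_int (M.layered_rank (x p) K)"
      using M.perturb[OF d(1,3), of K] by blast
    have "M.max_weight (x q) + real r * d \<le> M.max_weight (\<lambda>e. x p e + (if e \<in> K then d else 0))"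
    proof -
      obtain B where B: "B \<in> M.bases" "sum (x q) B = M.max_weight (x q)" by (rule M.max_weight_obtain)
      have "sum (x q) B + real r * d = (\<Sum>e\<in>B. x q e + d)"
        using M.card_basis[OF B(1)] by (simp add: sum.distrib)
      also have "\<dots> = (\<Sum>e\<in>B. x p e + (if e \<in> K then d else 0))"
        using M.basis_subset[OF B(1)] by (intro sum.cong) (auto simp: x_def q_def K_def)
      also have "\<dots> \<le> M.max_weight (\<lambda>e. x p e + (if e \<in> K then d else 0))" by (rule M.max_weight_ge[OF B(1)])
      finally show ?thesis using B by simp
    qed
    moreover have "L.max_weight p + M.max_weight (x p) \<le> L.max_weight q + M.max_weight (x q)" using min[of q] by (simp add: \<psi>_def)
    ultimately have "d * real r \<le> d * (real_of_int (L.layered_rank p T) + real_of_int (M.layered_rank (x p) K))"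
      using 1 2 by (simp add: distrib_left mult.commute)
    then have "real r \<le> real_of_int (L.layered_rank p T) + real_of_int (M.layered_rank (x p) K)" using d(1) by simp
    then have "int r \<le> L.layered_rank p T + M.layered_rank (x p) K" by linarith
    moreover have "M.layered_rank (x p) K \<le> M.layered_rank (x p) (E - S)"
      by (rule M.layered_rank_mono) (auto simp: K_def T_def)
    ultimately show ?thesis by (simp add: T_def)
  qed
  have rfL: "rank_function (\<lambda>S. L.layered_rank p (l ` S))"
  proof -
    have sub: "L.layered_rank p (l ` (S \<union> T)) + L.layered_rank p (l ` (S \<inter> T)) \<le> L.layered_rank p (l ` S) + L.layered_rank p (l ` T)" for S T
      using L.layered_rank_submodular[of p "l ` S" "l ` T"] L.layered_rank_mono[OF image_Int_subset, of p l S T]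
      by (simp add: image_Un)
    then show ?thesis unfolding rank_function_def
      by (simp add: L.layered_rank_empty L.layered_rank_insert_le L.layered_rank_mono image_mono)
  qed
  obtain Z where Z: "Z \<subseteq> E" "card Z = r" "L.layered_rank p (l ` Z) = int r" "M.layered_rank (x p) Z = int r"
    using matroid_intersection[OF M.finite_ground rfL M.rank_function_layered_rank[of "x p"] cond] by blast
  have finZ: "finite Z" using Z(1) M.finite_ground finite_subset by blast
  obtain B where "B \<in> L.bases" "int (card (B \<inter> l ` Z)) = L.layered_rank p (l ` Z)"
    using L.perturb[OF d(1,2), of "l ` Z"] by blast
  then have "r \<le> card (l ` Z)"
    using Z(3) card_mono[of "l ` Z" "B \<inter> l ` Z"] finZ by simp
  then have cl: "card (l ` Z) = r" using card_image_le[OF finZ, of l] Z(2) by simp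
  then have inj: "inj_on l Z" using Z(2) finZ by (simp add: eq_card_imp_inj_on)
  have Y: "l ` Z \<in> L.bases" "sum p (l ` Z) = L.max_weight p"
    using L.layered_rank_full_basis[OF _ cl Z(3)] Z(1) lab by auto
  have Zb: "Z \<in> M.bases" "sum (x p) Z = M.max_weight (x p)"
    using M.layered_rank_full_basis[OF Z(1,2,4)] by auto
  have "sum w Z \<le> c" using common[of Z] Y Zb inj by (simp add: L.bases_def M.bases_def)
  moreover have "sum w Z = \<psi> p"
    using Y Zb sum.reindex[OF inj, of p] by (simp add: \<psi>_def sumx)
  ultimately show False using psi_gt[of p] by simp
qed

text \<open>The defect measures how far two sets are from a modular pair. The hypotheses make the
  intersections equal, and with a fixed intersection each set can be shrunk separately, here by way
  of the pair X and T.\<close>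

lemma submodular_defect_mono:
  fixes f :: "'a set \<Rightarrow> int"
  assumes sub: "\<And>S T. f (S \<union> T) + f (S \<inter> T) \<le> f S + f T"
    and "X \<subseteq> S" "Y \<subseteq> T" "S \<inter> T \<subseteq> X \<inter> Y"
  shows "f X + f Y - f (S \<inter> T) - f (X \<union> Y) \<le> f S + f T - f (S \<inter> T) - f (S \<union> T)"
proof -
  have "S \<union> (X \<union> T) = S \<union> T" "S \<inter> (X \<union> T) = X" "T \<union> (X \<union> Y) = X \<union> T" "T \<inter> (X \<union> Y) = Y"
    using assms by auto
  then show ?thesis using sub[of S "X \<union> T"] sub[of T "X \<union> Y"] by simp
qed

context ranked_matroid
begin

text \<open>Modularity of \<open>S \<inter> T\<close> and L makes the increase in rank from adding
  \<open>S \<inter> T\<close> at least the same constant for \<open>S \<inter> L\<close> and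
  \<open>T \<inter> L\<close>, and at most that constant for their union. The enlarged sets again
  meet in \<open>S \<inter> T\<close>, so \<open>submodular_defect_mono\<close> compares their
  defect with that of S and T.\<close>

lemma restrict_defect_le:
  assumes mod: "rk (S \<inter> T \<union> L) + rk (S \<inter> T \<inter> L) = rk (S \<inter> T) + rk L"
  shows "rk (S \<inter> L) + rk (T \<inter> L) - rk (S \<inter> T \<inter> L) - rk ((S \<union> T) \<inter> L)
    \<le> rk S + rk T - rk (S \<inter> T) - rk (S \<union> T)"
proof -
  let ?K = "S \<inter> T"
  have low: "rk (X \<inter> L) + rk ?K - rk (?K \<inter> L) \<le> rk (X \<inter> L \<union> ?K)" if "?K \<subseteq> X" for X
  proof -
    have "(X \<inter> L \<union> ?K) \<union> L = ?K \<union> L" "(X \<inter> L \<union> ?K) \<inter> L = X \<inter> L" using that by auto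
    then show ?thesis using rk_submodular[of "X \<inter> L \<union> ?K" L] mod by simp
  qed
  have up: "rk ((S \<union> T) \<inter> L \<union> ?K) \<le> rk ((S \<union> T) \<inter> L) + rk ?K - rk (?K \<inter> L)"
  proof -
    have "((S \<union> T) \<inter> L) \<inter> ?K = ?K \<inter> L" by auto
    then show ?thesis using rk_submodular[of "(S \<union> T) \<inter> L" ?K] by simp
  qed
  have "rk (S \<inter> L \<union> ?K) + rk (T \<inter> L \<union> ?K) - rk ?K - rk ((S \<inter> L \<union> ?K) \<union> (T \<inter> L \<union> ?K))
      \<le> rk S + rk T - rk ?K - rk (S \<union> T)"
    by (rule submodular_defect_mono[of rk, OF rk_submodular]) auto
  moreover have "(S \<inter> L \<union> ?K) \<union> (T \<inter> L \<union> ?K) = (S \<union> T) \<inter> L \<union> ?K" by auto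
  ultimately show ?thesis using low[of S] low[of T] up by simp
qed

text \<open>Dual to \<open>restrict_defect_le\<close>, with the union taking the role of the
  intersection. The part ?D of C inside \<open>S \<union> T\<close> is absorbed by two submodular
  inequalities. The rest of C adds at most \<open>rk C - rk ?D\<close> to S and T, and at least that
  much to the intersection and the union by modularity.\<close>

lemma contract_defect_le:
  assumes mod: "rk (S \<union> T \<union> C) + rk ((S \<union> T) \<inter> C) = rk (S \<union> T) + rk C"
  shows "rk (S \<union> C) + rk (T \<union> C) - rk (S \<union> T \<union> C) - rk (S \<inter> T \<union> C)
    \<le> rk S + rk T - rk (S \<union> T) - rk (S \<inter> T)"
proof -
  let ?D = "(S \<union> T) \<inter> C" and ?K = "S \<inter> T"
  have 1: "rk (S \<union> ?D) + rk (?K \<union> (S \<inter> C)) \<le> rk S + rk (?K \<union> ?D)"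
  proof -
    have "S \<union> (?K \<union> ?D) = S \<union> ?D" "S \<inter> (?K \<union> ?D) = ?K \<union> (S \<inter> C)" by auto
    then show ?thesis using rk_submodular[of S "?K \<union> ?D"] by simp
  qed
  have 2: "rk (T \<union> ?D) + rk ?K \<le> rk T + rk (?K \<union> (S \<inter> C))"
  proof -
    have "T \<union> (?K \<union> (S \<inter> C)) = T \<union> ?D" "T \<inter> (?K \<union> (S \<inter> C)) = ?K" by auto
    then show ?thesis using rk_submodular[of T "?K \<union> (S \<inter> C)"] by simp
  qed
  have up: "rk (X \<union> C) \<le> rk (X \<union> ?D) + rk C - rk ?D" if "X \<subseteq> S \<union> T" for X
  proof -
    have "(X \<union> ?D) \<union> C = X \<union> C" "(X \<union> ?D) \<inter> C = ?D" using that by auto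
    then show ?thesis using rk_submodular[of "X \<union> ?D" C] by simp
  qed
  have low: "rk (?K \<union> ?D) + rk C - rk ?D \<le> rk (?K \<union> C)"
  proof -
    have "(S \<union> T) \<union> (?K \<union> C) = S \<union> T \<union> C" "(S \<union> T) \<inter> (?K \<union> C) = ?K \<union> ?D" by auto
    then show ?thesis using rk_submodular[of "S \<union> T" "?K \<union> C"] mod by simp
  qed
  show ?thesis using 1 2 up[of S] up[of T] low mod by simp
qed

end

section \<open>Configurations of pairs\<close>

text \<open>The direct sum of a uniform matroid on V and the free matroid on W. Its bases are the
  sets \<open>Y \<union> W\<close> with \<open>card Y = d\<close>, which for d = 4 are the label
  sets of interest.\<close>

lemma uniform_free_sum:
  assumes "finite V" "finite W" "V \<inter> W = {}" "d \<le> card V"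
  shows "ranked_matroid (V \<union> W) {I. I \<subseteq> V \<union> W \<and> card (I \<inter> V) \<le> d} (d + card W)"
proof
  have fin: "finite I" if "I \<subseteq> V \<union> W" for I using that assms finite_subset by blast
  have split: "card I = card (I \<inter> V) + card (I \<inter> W)" if "I \<subseteq> V \<union> W" for I
  proof -
    have "I = (I \<inter> V) \<union> (I \<inter> W)" using that by auto
    then show ?thesis using card_Un_disjoint[of "I \<inter> V" "I \<inter> W"] assms(3) fin[OF that] by auto
  qed
  show "matroid (V \<union> W) {I. I \<subseteq> V \<union> W \<and> card (I \<inter> V) \<le> d}"
    unfolding matroid_def
  proof (intro conjI ballI allI impI)
    fix I J assume *: "I \<in> {I. I \<subseteq> V \<union> W \<and> card (I \<inter> V) \<le> d}" "J \<in> {I. I \<subseteq> V \<union> W \<and> card (I \<inter> V) \<le> d}"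
      "card I < card J"
    show "\<exists>j\<in>J - I. insert j I \<in> {I. I \<subseteq> V \<union> W \<and> card (I \<inter> V) \<le> d}"
    proof (cases "J \<inter> W \<subseteq> I")
      case True
      then have "card (J \<inter> W) \<le> card (I \<inter> W)" using fin * by (intro card_mono) auto
      then have lt: "card (I \<inter> V) < card (J \<inter> V)" using * split[of I] split[of J] by simp
      have "\<not> J \<inter> V \<subseteq> I \<inter> V"
      proof
        assume "J \<inter> V \<subseteq> I \<inter> V"
        then have "card (J \<inter> V) \<le> card (I \<inter> V)" using fin[of I] * by (intro card_mono) auto
        then show False using lt by simp
      qed
      then obtain j where j: "j \<in> J \<inter> V" "j \<notin> I" by blast
      have "insert j I \<inter> V = insert j (I \<inter> V)" using j by auto
      then have "card (insert j I \<inter> V) \<le> d" using lt * j fin[of I] by simp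
      then show ?thesis using j * by (intro bexI[of _ j]) auto
    next
      case False
      then obtain j where "j \<in> J" "j \<in> W" "j \<notin> I" by blast
      moreover from this have "insert j I \<inter> V = I \<inter> V" using assms(3) by auto
      ultimately show ?thesis using * by (intro bexI[of _ j]) auto
    qed
  next
    fix I J assume *: "I \<in> {I. I \<subseteq> V \<union> W \<and> card (I \<inter> V) \<le> d}" "J \<subseteq> I"
    then have "card (J \<inter> V) \<le> card (I \<inter> V)" using fin[of I] by (intro card_mono) auto
    then show "J \<in> {I. I \<subseteq> V \<union> W \<and> card (I \<inter> V) \<le> d}" using * by auto
  qed (use assms in auto)
  show "card I \<le> d + card W" if "I \<in> {I. I \<subseteq> V \<union> W \<and> card (I \<inter> V) \<le> d}" for I
    using split[of I] that card_mono[of W "I \<inter> W"] assms(2) by auto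
  obtain Y where Y: "Y \<subseteq> V" "card Y = d" using obtain_subset_with_card_n[OF assms(4)] by blast
  have "(Y \<union> W) \<inter> V = Y" "(Y \<union> W) \<inter> W = W" using Y assms(3) by auto
  then show "\<exists>X\<in>{I. I \<subseteq> V \<union> W \<and> card (I \<inter> V) \<le> d}. card X = d + card W"
    using Y split[of "Y \<union> W"] by (intro bexI[of _ "Y \<union> W"]) auto
qed

text \<open>W consists of the auxiliary labels that every representing set has to use in addition to
  X.\<close>

locale pairs =
  fixes P :: "nat \<Rightarrow> 'b set" and W :: "'b set" and V :: "'b set"
  assumes finW: "finite W" and card_pair: "i < 7 \<Longrightarrow> card (P i) = 2"
    and disj_pairs: "i < 7 \<Longrightarrow> j < 7 \<Longrightarrow> i \<noteq> j \<Longrightarrow> P i \<inter> P j = {}"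
    and VW: "V \<inter> W = {}" and V_eq: "V = (\<Union>i<7. P i)"
begin

text \<open>
  The union of the pairs 2 and 3 must not be special: if all unions of two pairs were, the function below
  would be represented by a matroid of rank 4 on seven lines that are pairwise coplanar, except for the first
  two, with the elements of maximum weight on a common plane.
\<close>

definition special :: "'b set \<Rightarrow> bool" where
  "special Y \<longleftrightarrow> (\<exists>i<7. \<exists>j<7. i \<noteq> j \<and> {i, j} \<noteq> {2, 3} \<and> Y = P i \<union> P j)"

definition U :: "nat set \<Rightarrow> 'b set" where
  "U I = (\<Union>i\<in>I. P i)"

lemma fin_pair: "i < 7 \<Longrightarrow> finite (P i)"
  using card_pair by (metis card.infinite zero_neq_numeral)

lemma finV: "finite V"
  using fin_pair V_eq by auto

lemma pair_sub: "i < 7 \<Longrightarrow> P i \<subseteq> V"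
  using V_eq by auto

lemma U_sub: "I \<subseteq> {..<7} \<Longrightarrow> U I \<subseteq> V"
  using V_eq by (auto simp: U_def)

lemma U_Un: "U (I \<union> J) = U I \<union> U J"
  by (auto simp: U_def)

lemma U_Int: "I \<subseteq> {..<7} \<Longrightarrow> J \<subseteq> {..<7} \<Longrightarrow> U (I \<inter> J) = U I \<inter> U J"
  unfolding U_def using disj_pairs by (fastforce simp: subset_iff)

lemma pair_unique: "x \<in> P i \<Longrightarrow> x \<in> P j \<Longrightarrow> i < 7 \<Longrightarrow> j < 7 \<Longrightarrow> i = j"
  using disj_pairs by blast

lemma three_pairs_not_special:
  assumes "x \<in> Y" "y \<in> Y" "z \<in> Y" "x \<in> P i" "y \<in> P j" "z \<in> P k" "i < 7" "j < 7" "k < 7"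
    "i \<noteq> j" "i \<noteq> k" "j \<noteq> k"
  shows "\<not> special Y"
proof
  assume "special Y"
  then obtain m n where mn: "m < 7" "n < 7" "Y = P m \<union> P n" unfolding special_def by blast
  have "i \<in> {m, n}" "j \<in> {m, n}" "k \<in> {m, n}" using assms mn pair_unique by blast+
  then show False using assms by auto
qed

lemma pair_elems: "i < 7 \<Longrightarrow> \<exists>x y. P i = {x, y} \<and> x \<noteq> y"
  using card_pair[of i] by (meson card_2_iff)

lemma card_two_pairs: "i < 7 \<Longrightarrow> j < 7 \<Longrightarrow> i \<noteq> j \<Longrightarrow> card (P i \<union> P j) = 4"
  using card_Un_disjoint[OF fin_pair fin_pair disj_pairs, of i j] card_pair by simp

lemma pair_plus_two:
  assumes "i < 7" "j < 7" "k < 7" "i \<noteq> j" "i \<noteq> k" "j \<noteq> k"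
  obtains y z where "y \<in> P j" "z \<in> P k" "card (P i \<union> {y, z}) = 4" "\<not> special (P i \<union> {y, z})"
    "P i \<union> {y, z} \<subseteq> V" "card (P i \<union> {y}) = 3"
proof -
  obtain x x' y y' z z' where e: "P i = {x, x'}" "x \<noteq> x'" "P j = {y, y'}" "P k = {z, z'}"
    using pair_elems[OF assms(1)] pair_elems[OF assms(2)] pair_elems[OF assms(3)] by blast
  have ne: "y \<notin> P i" "z \<notin> P i" "y \<noteq> z" using e disj_pairs[of i j] disj_pairs[of i k] disj_pairs[of j k] assms by auto
  have "\<not> special (P i \<union> {y, z})"
    by (rule three_pairs_not_special[of x _ y z i j k]) (use e assms in auto)
  moreover have "P i \<union> {y, z} \<subseteq> V" using e assms pair_sub[of i] pair_sub[of j] pair_sub[of k] by auto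
  ultimately show ?thesis using that[of y z] e ne by auto
qed

lemma non_edge_not_special: "\<not> special (P 2 \<union> P 3)"
proof
  assume "special (P 2 \<union> P 3)"
  then obtain m n where mn: "m < 7" "n < 7" "m \<noteq> n" "{m, n} \<noteq> {2, 3}" "P 2 \<union> P 3 = P m \<union> P n"
    unfolding special_def by blast
  obtain x y where "x \<in> P m" "y \<in> P n" using pair_elems[OF mn(1)] pair_elems[OF mn(2)] by auto
  moreover from this have "x \<in> P 2 \<or> x \<in> P 3" "y \<in> P 2 \<or> y \<in> P 3" using mn(5) by auto
  ultimately have "m \<in> {2, 3}" "n \<in> {2, 3}" using mn pair_unique[of x m 2] pair_unique[of x m 3]
      pair_unique[of y n 2] pair_unique[of y n 3] by auto
  then show False using mn by auto
qed

text \<open>For \<open>I \<subseteq> {..<7}\<close> this is the largest number of elements that a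
  non-special 4-set has in \<open>U I\<close>: the rank of \<open>U I\<close> in the sparse paving
  matroid whose circuit-hyperplanes are the special sets.\<close>

definition pair_rank :: "nat set \<Rightarrow> int" where
  "pair_rank I = (if I = {} then 0 else if card I = 1 then 2 else if card I = 2 \<and> I \<noteq> {2, 3} then 3 else 4)"

lemma exchange_not_special:
  assumes ij: "i < 7" "j < 7" "i \<noteq> j" and x: "x \<in> P i \<union> P j" and y: "y \<in> V - (P i \<union> P j)"
  shows "\<not> special (insert y (P i \<union> P j - {x}))" "card (insert y (P i \<union> P j - {x})) = 4"
proof -
  obtain k where k: "k < 7" "y \<in> P k" using y V_eq by auto
  obtain a a' where a: "P i = {a, a'}" "a \<noteq> a'" using pair_elems[OF ij(1)] by blast
  obtain b b' where b: "P j = {b, b'}" "b \<noteq> b'" using pair_elems[OF ij(2)] by blast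
  have "\<exists>a''. a'' \<in> P i - {x}" "\<exists>b''. b'' \<in> P j - {x}" using a b by auto
  then obtain a'' b'' where "a'' \<in> P i - {x}" "b'' \<in> P j - {x}" by blast
  then show "\<not> special (insert y (P i \<union> P j - {x}))"
    by (intro three_pairs_not_special[of a'' _ b'' y i j k]) (use k ij y in auto)
  show "card (insert y (P i \<union> P j - {x})) = 4"
    using card_two_pairs[OF ij] x y fin_pair ij by simp
qed

lemma transversal_ex:
  assumes I: "I \<subseteq> {..<7}"
  shows "\<exists>Y\<subseteq>V. card Y = 4 \<and> \<not> special Y \<and> pair_rank I \<le> int (card (Y \<inter> U I))"
proof (cases "I = {2, 3}")
  case True
  have "(P 2 \<union> P 3) \<inter> U I = P 2 \<union> P 3" using True by (auto simp: U_def)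
  then show ?thesis
    using True non_edge_not_special card_two_pairs[of 2 3] pair_sub[of 2] pair_sub[of 3]
    by (intro exI[of _ "P 2 \<union> P 3"]) (auto simp: pair_rank_def)
next
  case False
  have finI: "finite I" using I finite_subset by blast
  have ex: "\<exists>k<7. k \<noteq> i \<and> k \<noteq> j" for i j :: nat by presburger
  consider "card I = 0" | "card I = 1" | "card I = 2" | "card I \<ge> 3" by linarith
  then show ?thesis
  proof cases
    case 1
    then have "I = {}" using finI by simp
    moreover obtain y z where "card (P 0 \<union> {y, z}) = 4" "\<not> special (P 0 \<union> {y, z})" "P 0 \<union> {y, z} \<subseteq> V"
      by (rule pair_plus_two[of 0 1 2]) auto
    ultimately show ?thesis by (intro exI[of _ "P 0 \<union> {y, z}"]) (simp add: pair_rank_def)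
  next
    case 2
    then obtain i where i: "I = {i}" by (meson card_1_singletonE)
    obtain j where j: "j < 7" "j \<noteq> i" using ex[of i i] by blast
    obtain k where k: "k < 7" "k \<noteq> i" "k \<noteq> j" using ex[of i j] by blast
    obtain y z where Y: "y \<in> P j" "z \<in> P k" "card (P i \<union> {y, z}) = 4" "\<not> special (P i \<union> {y, z})"
      "P i \<union> {y, z} \<subseteq> V"
      by (rule pair_plus_two[of i j k]) (use i j k I in auto)
    have "(P i \<union> {y, z}) \<inter> U I = P i"
      using i Y j k I disj_pairs[of i j] disj_pairs[of i k] by (auto simp: U_def)
    then show ?thesis using Y i I card_pair[of i] by (intro exI[of _ "P i \<union> {y, z}"]) (simp add: pair_rank_def)
  next
    case 3
    then obtain i j where ij: "I = {i, j}" "i \<noteq> j" by (meson card_2_iff)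
    obtain k where k: "k < 7" "k \<noteq> i" "k \<noteq> j" using ex[of i j] by blast
    obtain y z where Y: "y \<in> P j" "z \<in> P k" "card (P i \<union> {y, z}) = 4" "\<not> special (P i \<union> {y, z})"
      "P i \<union> {y, z} \<subseteq> V" "card (P i \<union> {y}) = 3"
      by (rule pair_plus_two[of i j k]) (use ij k I in auto)
    have "(P i \<union> {y, z}) \<inter> U I = P i \<union> {y}"
      using ij Y k I disj_pairs[of i j] disj_pairs[of i k] disj_pairs[of j k] by (auto simp: U_def)
    then show ?thesis using Y ij False by (intro exI[of _ "P i \<union> {y, z}"]) (simp add: pair_rank_def)
  next
    case 4
    then obtain J where J: "J \<subseteq> I" "card J = 3" using obtain_subset_with_card_n[OF 4] by blast
    then obtain i j k where ijk: "J = {i, j, k}" "i \<noteq> j" "i \<noteq> k" "j \<noteq> k" by (metis card_3_iff)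
    obtain y z where Y: "y \<in> P j" "z \<in> P k" "card (P i \<union> {y, z}) = 4" "\<not> special (P i \<union> {y, z})"
      "P i \<union> {y, z} \<subseteq> V"
      by (rule pair_plus_two[of i j k]) (use ijk J I in auto)
    have "(P i \<union> {y, z}) \<inter> U I = P i \<union> {y, z}"
      using ijk J Y by (auto simp: U_def)
    then show ?thesis using Y by (intro exI[of _ "P i \<union> {y, z}"]) (simp add: pair_rank_def)
  qed
qed

lemma pair_rank_simps:
  "pair_rank {} = 0" "pair_rank {i} = 2"
  "i \<noteq> j \<Longrightarrow> {i, j} \<noteq> {2, 3} \<Longrightarrow> pair_rank {i, j} = 3" "pair_rank {2, 3} = 4"
  "i \<noteq> j \<Longrightarrow> i \<noteq> k \<Longrightarrow> j \<noteq> k \<Longrightarrow> pair_rank {i, j, k} = 4"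
  "pair_rank {..<7} = 4"
  by (auto simp: pair_rank_def) (metis lessThan_iff empty_iff zero_less_numeral)

lemma card_special: "special Y \<Longrightarrow> card Y = 4"
  using card_two_pairs by (auto simp: special_def)

lemma special_sparse:
  assumes "special A" "special B" "A \<noteq> B"
  shows "card (A \<inter> B) \<le> 2"
proof -
  obtain i j where A: "i < 7" "j < 7" "i \<noteq> j" "A = P i \<union> P j" using assms(1) by (auto simp: special_def)
  obtain k m where B: "k < 7" "m < 7" "k \<noteq> m" "B = P k \<union> P m" using assms(2) by (auto simp: special_def)
  have sub: "{i, j} \<subseteq> {..<7}" "{k, m} \<subseteq> {..<7}" using A B by auto
  have AU: "A = U {i, j}" "B = U {k, m}" using A B by (auto simp: U_def)
  then have ne: "{i, j} \<noteq> {k, m}" using assms(3) by auto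
  have "\<exists>n\<in>{i, j}. {i, j} \<inter> {k, m} \<subseteq> {n}"
  proof (rule ccontr)
    assume "\<not> ?thesis"
    then have "i \<in> {k, m}" "j \<in> {k, m}" by auto
    then show False using ne A(3) B(3) by auto
  qed
  then obtain n where n: "n < 7" "{i, j} \<inter> {k, m} \<subseteq> {n}" using A by auto
  have "A \<inter> B \<subseteq> P n" unfolding AU U_Int[OF sub, symmetric] using n(2) by (auto simp: U_def)
  then show ?thesis using card_mono[OF fin_pair[OF n(1)]] card_pair[OF n(1)] by metis
qed

end

section \<open>Tight potentials\<close>

locale labelled_matroid = pairs P W V + ranked_matroid E \<I> r
  for P :: "nat \<Rightarrow> 'b set" and W V :: "'b set" and E :: "'a set" and \<I> :: "'a set set" and r :: nat +
  fixes l :: "'a \<Rightarrow> 'b"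
  assumes lab: "l ` E \<subseteq> V \<union> W" and rank_eq: "r = 4 + card W"
begin

lemma card_VW:
  assumes "Y \<subseteq> V" "finite Y"
  shows "card (Y \<union> W) = card Y + card W"
  using card_Un_disjoint[OF assms(2) finW] assms(1) VW by blast

lemma sum_labels:
  fixes p :: "'b \<Rightarrow> real"
  assumes "inj_on l Z" "l ` Z = Y \<union> W" "Y \<subseteq> V"
  shows "(\<Sum>e\<in>Z. p (l e)) = sum p Y + sum p W"
proof -
  have "(\<Sum>e\<in>Z. p (l e)) = sum p (Y \<union> W)"
    using sum.reindex[OF assms(1), of p] assms(2) by simp
  also have "\<dots> = sum p Y + sum p W"
    using finW finite_subset[OF assms(3) finV] assms(3) VW by (intro sum.union_disjoint) auto
  finally show ?thesis .
qed

text \<open>Weighted intersection with \<open>uniform_free_sum\<close> for d = 4, whose common bases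
  are exactly the feasible Z. The terms \<open>sum p Y + sum p W\<close> are the weight of an
  arbitrary basis \<open>Y \<union> W\<close> of that second matroid.\<close>

lemma dual:
  fixes u :: "'a \<Rightarrow> real"
  assumes feas: "\<And>Z Y. Z \<in> bases \<Longrightarrow> inj_on l Z \<Longrightarrow> l ` Z = Y \<union> W \<Longrightarrow> Y \<subseteq> V \<Longrightarrow> card Y = 4 \<Longrightarrow> sum u Z \<le> c"
  shows "\<exists>p. \<forall>Z\<in>bases. \<forall>Y\<subseteq>V. card Y = 4 \<longrightarrow> sum u Z - (\<Sum>e\<in>Z. p (l e)) + sum p Y + sum p W \<le> c"
proof -
  have "card (P 0 \<union> P 1) \<le> card V"
    using pair_sub[of 0] pair_sub[of 1] finV by (intro card_mono) auto
  then have V4: "4 \<le> card V" using card_two_pairs[of 0 1] by simp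
  let ?L = "{I. I \<subseteq> V \<union> W \<and> card (I \<inter> V) \<le> 4}"
  have L: "ranked_matroid (V \<union> W) ?L r"
    using uniform_free_sum[OF finV finW VW V4] rank_eq by simp
  have "\<exists>p. \<forall>Z\<in>\<I>. \<forall>Y\<in>?L. card Z = r \<longrightarrow> card Y = r \<longrightarrow> sum u Z - (\<Sum>e\<in>Z. p (l e)) + sum p Y \<le> c"
  proof (rule weighted_matroid_intersection[OF L ranked_matroid_axioms lab])
    fix Z assume Z: "Z \<in> \<I>" "card Z = r" "inj_on l Z" "l ` Z \<in> ?L"
    let ?Y = "l ` Z \<inter> V"
    have fin: "finite (l ` Z)" using Z(1) finite_indep by simp
    have "l ` Z = ?Y \<union> (l ` Z \<inter> W)" using Z(4) by auto
    then have "card (l ` Z) = card ?Y + card (l ` Z \<inter> W)"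
      using card_Un_disjoint[of ?Y "l ` Z \<inter> W"] fin VW by auto
    moreover have "card (l ` Z) = 4 + card W" using card_image[OF Z(3)] Z(2) rank_eq by simp
    moreover have "card (l ` Z \<inter> W) \<le> card W" using finW by (intro card_mono) auto
    ultimately have "card ?Y = 4" "card (l ` Z \<inter> W) = card W" using Z(4) by auto
    moreover from this(2) have "l ` Z \<inter> W = W" using finW by (intro card_subset_eq) auto
    ultimately show "sum u Z \<le> c"
      using feas[of Z ?Y] Z \<open>l ` Z = ?Y \<union> (l ` Z \<inter> W)\<close> by (auto simp: bases_def)
  qed
  then obtain p where p: "\<forall>Z\<in>\<I>. \<forall>Y\<in>?L. card Z = r \<longrightarrow> card Y = r \<longrightarrow> sum u Z - (\<Sum>e\<in>Z. p (l e)) + sum p Y \<le> c"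
    by blast
  show ?thesis
  proof (intro exI[of _ p] ballI allI impI)
    fix Z Y assume Z: "Z \<in> bases" and Y: "Y \<subseteq> V" "card Y = 4"
    have fin: "finite Y" using Y(1) finV finite_subset by blast
    have "(Y \<union> W) \<inter> V = Y" "Y \<union> W \<subseteq> V \<union> W" using Y VW by auto
    then have "Y \<union> W \<in> ?L" "card (Y \<union> W) = r" using Y card_VW[OF Y(1) fin] rank_eq by auto
    then have "sum u Z - (\<Sum>e\<in>Z. p (l e)) + sum p (Y \<union> W) \<le> c"
      using p Z by (simp add: bases_def)
    moreover have "sum p (Y \<union> W) = sum p Y + sum p W"
      using fin finW VW Y(1) by (intro sum.union_disjoint) auto
    ultimately show "sum u Z - (\<Sum>e\<in>Z. p (l e)) + sum p Y + sum p W \<le> c" by simp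
  qed
qed

end

text \<open>Normalization means that the common value of the non-special sets is the maximum over
  all bases, whatever their labels. For the pairs 0 and 1 only a strict loss is assumed; the goal is
  to improve it to \<gamma>.\<close>

locale normalized_rep = labelled_matroid P W V E \<I> r l
  for P :: "nat \<Rightarrow> 'b set" and W V :: "'b set" and E :: "'a set" and \<I> :: "'a set set" and r :: nat
    and l :: "'a \<Rightarrow> 'b" +
  fixes w :: "'a \<Rightarrow> real" and opt \<gamma> :: real
  assumes gam: "0 < \<gamma>"
    and zero: "Y \<subseteq> V \<Longrightarrow> card Y = 4 \<Longrightarrow> \<not> special Y \<Longrightarrow> \<exists>Z\<in>\<I>. inj_on l Z \<and> l ` Z = Y \<union> W \<and> sum w Z = opt"
    and bound: "Z \<in> bases \<Longrightarrow> sum w Z \<le> opt"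
    and loss: "i < 7 \<Longrightarrow> j < 7 \<Longrightarrow> i \<noteq> j \<Longrightarrow> {i, j} \<noteq> {2, 3} \<Longrightarrow> {i, j} \<noteq> {0, 1} \<Longrightarrow> Z \<in> \<I> \<Longrightarrow> inj_on l Z \<Longrightarrow>
      l ` Z = P i \<union> P j \<union> W \<Longrightarrow> sum w Z \<le> opt - \<gamma>"
    and dist: "Z \<in> \<I> \<Longrightarrow> inj_on l Z \<Longrightarrow> l ` Z = P 0 \<union> P 1 \<union> W \<Longrightarrow> sum w Z < opt"
begin

definition reduced :: "('b \<Rightarrow> real) \<Rightarrow> 'a \<Rightarrow> real" where
  "reduced p e = w e - p (l e)"

lemma zero_basis:
  assumes "Y \<subseteq> V" "card Y = 4" "\<not> special Y"
  obtains Z where "Z \<in> bases" "inj_on l Z" "l ` Z = Y \<union> W" "sum w Z = opt" "sum w Z = max_weight w"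
proof -
  obtain Z where Z: "Z \<in> \<I>" "inj_on l Z" "l ` Z = Y \<union> W" "sum w Z = opt" using zero[OF assms] by blast
  have "finite Y" using assms(1) finV finite_subset by blast
  then have "card Z = r" using card_image[OF Z(2)] Z(3) card_VW[OF assms(1)] assms(2) rank_eq by simp
  then have B: "Z \<in> bases" using Z(1) by (simp add: bases_def)
  obtain B' where "B' \<in> bases" "sum w B' = max_weight w" by (rule max_weight_obtain)
  then have "max_weight w \<le> opt" using bound by force
  then have "sum w Z = max_weight w" using max_weight_ge[OF B, of w] Z(4) by simp
  then show ?thesis using that B Z by blast
qed

lemma sum_reduced:
  assumes "inj_on l Z" "l ` Z = Y \<union> W" "Y \<subseteq> V"
  shows "sum (reduced p) Z = sum w Z - sum p Y - sum p W"
  using sum_labels[OF assms, of p] by (simp add: reduced_def sum_subtractf)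

definition on_pairs :: "nat set \<Rightarrow> ('b \<Rightarrow> real) \<Rightarrow> bool" where
  "on_pairs I p \<longleftrightarrow> (\<forall>v\<in>V. p v = (if v \<in> U I then 0 else \<gamma>))"

text \<open>
  A tight potential for \<open>I\<close> is a dual certificate that a 4-set meets \<open>U I\<close> in at most \<open>pair_rank I\<close>
  elements, up to a loss of \<open>\<gamma>\<close> per additional element. The bound in its definition is always attained,
  so submodularity of \<open>max_weight\<close> makes these potentials closed under \<open>inf\<close> and \<open>sup\<close> wherever
  \<open>pair_rank\<close> is modular.
\<close>

definition tight :: "nat set \<Rightarrow> ('b \<Rightarrow> real) \<Rightarrow> bool" where
  "tight I p \<longleftrightarrow> on_pairs I p \<and> max_weight (reduced p) + sum p W \<le> opt - \<gamma> * (4 - pair_rank I)"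

lemma on_pairs_sum:
  assumes "on_pairs I p" "Y \<subseteq> V"
  shows "sum p Y = \<gamma> * (real (card Y) - real (card (Y \<inter> U I)))"
proof -
  have fin: "finite Y" using assms finV finite_subset by blast
  have "sum p Y = (\<Sum>v\<in>Y. if v \<in> U I then 0 else \<gamma>)"
    using assms by (intro sum.cong) (auto simp: on_pairs_def)
  also have "\<dots> = real (card (Y - U I)) * \<gamma>"
    using fin by (simp add: sum.If_cases Diff_eq)
  also have "real (card (Y - U I)) = real (card Y) - real (card (Y \<inter> U I))"
    using card_Int_Diff[OF fin, of "U I"] by simp
  finally show ?thesis by (simp add: mult.commute)
qed

lemma tight_lower:
  assumes "I \<subseteq> {..<7}" "on_pairs I p"
  shows "opt - \<gamma> * (4 - pair_rank I) \<le> max_weight (reduced p) + sum p W"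
proof -
  obtain Y where Y: "Y \<subseteq> V" "card Y = 4" "\<not> special Y" "pair_rank I \<le> int (card (Y \<inter> U I))"
    using transversal_ex[OF assms(1)] by blast
  obtain Z where Z: "Z \<in> bases" "inj_on l Z" "l ` Z = Y \<union> W" "sum w Z = opt"
    by (rule zero_basis[OF Y(1-3)])
  have "opt - sum p Y \<le> max_weight (reduced p) + sum p W"
    using max_weight_ge[OF Z(1), of "reduced p"] sum_reduced[OF Z(2,3) Y(1), of p] Z(4) by simp
  moreover have "sum p Y = \<gamma> * (4 - real (card (Y \<inter> U I)))"
    using on_pairs_sum[OF assms(2) Y(1)] Y(2) by simp
  moreover have "\<gamma> * (4 - real (card (Y \<inter> U I))) \<le> \<gamma> * (4 - pair_rank I)"
    using Y(4) gam by (intro mult_left_mono) auto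
  ultimately show ?thesis by linarith
qed

text \<open>Equality in \<open>tight_lower\<close> makes the basis behind a non-special 4-set
  optimal for w and for \<open>reduced p\<close> at once. Such a common basis spans the upper level
  sets of both weights, so layers of w can be combined with thresholds of
  \<open>reduced p\<close>.\<close>

lemma tight_basis:
  assumes "I \<subseteq> {..<7}" "tight I p"
  obtains Z Y where "Z \<in> bases" "sum w Z = max_weight w" "sum (reduced p) Z = max_weight (reduced p)"
    "Y \<subseteq> V" "card Y = 4" "inj_on l Z" "l ` Z = Y \<union> W" "int (card (Y \<inter> U I)) = pair_rank I"
proof -
  obtain Y where Y: "Y \<subseteq> V" "card Y = 4" "\<not> special Y" "pair_rank I \<le> int (card (Y \<inter> U I))"
    using transversal_ex[OF assms(1)] by blast
  obtain Z where Z: "Z \<in> bases" "inj_on l Z" "l ` Z = Y \<union> W" "sum w Z = opt" "sum w Z = max_weight w"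
    by (rule zero_basis[OF Y(1-3)])
  have p: "on_pairs I p" "max_weight (reduced p) + sum p W \<le> opt - \<gamma> * (4 - pair_rank I)"
    using assms(2) by (auto simp: tight_def)
  have eq: "sum (reduced p) Z = opt - \<gamma> * (4 - real (card (Y \<inter> U I))) - sum p W"
    using sum_reduced[OF Z(2,3) Y(1), of p] on_pairs_sum[OF p(1) Y(1)] Y(2) Z(4) by simp
  have ge: "sum (reduced p) Z \<le> max_weight (reduced p)" by (rule max_weight_ge[OF Z(1)])
  have "\<gamma> * (4 - pair_rank I) \<le> \<gamma> * (4 - real (card (Y \<inter> U I)))" using eq ge p(2) by linarith
  then have "real_of_int (pair_rank I) \<ge> real (card (Y \<inter> U I))" using gam by simp
  then have c: "int (card (Y \<inter> U I)) = pair_rank I" using Y(4) by linarith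
  then have "real (card (Y \<inter> U I)) = real_of_int (pair_rank I)" by (metis of_int_of_nat_eq)
  then have "sum (reduced p) Z = max_weight (reduced p)" using eq ge p(2) by simp
  then show ?thesis using that Z Y c by blast
qed

lemma on_pairs_inf_sup:
  assumes "I \<subseteq> {..<7}" "J \<subseteq> {..<7}" "on_pairs I p" "on_pairs J q"
  shows "on_pairs (I \<union> J) (inf p q)" "on_pairs (I \<inter> J) (sup p q)"
  using assms gam unfolding on_pairs_def U_Un U_Int[OF assms(1,2)] by (auto simp: inf_min sup_max)

lemma tight_inf_sup:
  assumes IJ: "I \<subseteq> {..<7}" "J \<subseteq> {..<7}" and p: "tight I p" and q: "tight J q"
    and K: "K = I \<union> J" and H: "H = I \<inter> J" and mod: "pair_rank I + pair_rank J = pair_rank K + pair_rank H"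
  shows "tight K (inf p q)" "tight H (sup p q)"
proof -
  have op: "on_pairs K (inf p q)" "on_pairs H (sup p q)"
    using on_pairs_inf_sup[OF IJ] p q K H by (auto simp: tight_def)
  \<comment> \<open>Potentials are subtracted, so \<open>inf\<close> of potentials is
    \<open>max\<close> of reduced weights; accordingly \<open>inf\<close> goes with the union of
    index sets.\<close>
  have x: "(\<lambda>e. max (reduced p e) (reduced q e)) = reduced (inf p q)" "(\<lambda>e. min (reduced p e) (reduced q e)) = reduced (sup p q)"
    by (auto simp: reduced_def inf_min sup_max fun_eq_iff)
  have "max_weight (reduced (inf p q)) + max_weight (reduced (sup p q)) \<le> max_weight (reduced p) + max_weight (reduced q)"
    using max_weight_submodular[of "reduced p" "reduced q"] unfolding x .
  moreover have "sum (inf p q) W + sum (sup p q) W = sum p W + sum q W"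
    unfolding sum.distrib[symmetric] by (intro sum.cong) (auto simp: inf_min sup_max)
  moreover have "max_weight (reduced p) + sum p W \<le> opt - \<gamma> * (4 - pair_rank I)" "max_weight (reduced q) + sum q W \<le> opt - \<gamma> * (4 - pair_rank J)"
    using p q by (auto simp: tight_def)
  moreover have "opt - \<gamma> * (4 - pair_rank K) \<le> max_weight (reduced (inf p q)) + sum (inf p q) W"
    "opt - \<gamma> * (4 - pair_rank H) \<le> max_weight (reduced (sup p q)) + sum (sup p q) W"
    using tight_lower op IJ K H by (blast intro: le_infI1)+
  moreover have "\<gamma> * (4 - pair_rank I) + \<gamma> * (4 - pair_rank J) = \<gamma> * (4 - pair_rank K) + \<gamma> * (4 - pair_rank H)"
  proof -
    have "real_of_int (pair_rank I) + real_of_int (pair_rank J) = real_of_int (pair_rank K) + real_of_int (pair_rank H)"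
      using mod by (metis of_int_add)
    from arg_cong[OF this, of "(*) \<gamma>"] show ?thesis by (simp add: distrib_left right_diff_distrib)
  qed
  ultimately show "tight K (inf p q)" "tight H (sup p q)" using op unfolding tight_def by linarith+
qed

lemmas tight_inf = tight_inf_sup(1) and tight_sup = tight_inf_sup(2)

text \<open>The weight u charges \<gamma> for every label of V outside X. No feasible basis exceeds
  \<open>opt - \<gamma>\<close>: the set X loses \<gamma> by \<open>loss\<close>, and every other
  4-set pays at least one charge. A dual potential for u turns out to be constant on V, so after a
  shift only the charge itself remains there, which is the shape demanded by
  \<open>on_pairs\<close>.\<close>

lemma edge_cert:
  assumes ij: "i < 7" "j < 7" "i \<noteq> j" "{i, j} \<noteq> {2, 3}" "{i, j} \<noteq> {0, 1}"
  shows "\<exists>p. tight {i, j} p"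
proof -
  define X where "X = P i \<union> P j"
  define u where "u e = w e - (if l e \<in> V - X then \<gamma> else 0)" for e
  have X: "X \<subseteq> V" "card X = 4" "finite X" "U {i, j} = X"
    using pair_sub[OF ij(1)] pair_sub[OF ij(2)] card_two_pairs[OF ij(1-3)] fin_pair ij
    by (auto simp: X_def U_def)
  have sum_u: "sum u Z = sum w Z - \<gamma> * real (card (Y - X))"
    if "inj_on l Z" "l ` Z = Y \<union> W" "Y \<subseteq> V" "Z \<in> bases" for Z Y
  proof -
    have "sum u Z = sum w Z - (\<Sum>e\<in>Z. if l e \<in> V - X then \<gamma> else 0)"
      by (simp add: u_def sum_subtractf)
    also have "(\<Sum>e\<in>Z. if l e \<in> V - X then \<gamma> else 0) = (\<Sum>v\<in>Y \<union> W. if v \<in> V - X then \<gamma> else 0)"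
      using sum.reindex[OF that(1), of "\<lambda>v. if v \<in> V - X then \<gamma> else 0"] that(2) by simp
    also have "\<dots> = \<gamma> * real (card ((Y \<union> W) \<inter> (V - X)))"
      using finW finite_subset[OF that(3) finV]
        sum.inter_restrict[of "Y \<union> W" "\<lambda>_. \<gamma>" "V - X"] by (simp add: mult.commute)
    also have "(Y \<union> W) \<inter> (V - X) = Y - X" using that(3) VW by auto
    finally show ?thesis .
  qed
  have "\<exists>p. \<forall>Z\<in>bases. \<forall>Y\<subseteq>V. card Y = 4 \<longrightarrow> sum u Z - (\<Sum>e\<in>Z. p (l e)) + sum p Y + sum p W \<le> opt - \<gamma>"
  proof (rule dual)
    fix Z Y assume Z: "Z \<in> bases" "inj_on l Z" "l ` Z = Y \<union> W" and Y: "Y \<subseteq> V" "card Y = 4"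
    show "sum u Z \<le> opt - \<gamma>"
    proof (cases "Y = X")
      case True
      then show ?thesis
        using loss[OF ij, of Z] Z sum_u[OF Z(2,3) Y(1) Z(1)] by (simp add: X_def bases_def)
    next
      case False
      then have "\<not> Y \<subseteq> X" using card_subset_eq[OF X(3), of Y] X(2) Y(2) by auto
      moreover have "finite Y" using Y(1) finV finite_subset by blast
      ultimately have "card (Y - X) \<ge> 1" by (simp add: Suc_le_eq card_gt_0_iff)
      then have "\<gamma> * 1 \<le> \<gamma> * real (card (Y - X))" using gam by (intro mult_left_mono) auto
      then show ?thesis using sum_u[OF Z(2,3) Y(1) Z(1)] bound[OF Z(1)] by simp
    qed
  qed
  then obtain p where p: "\<And>Z Y. Z \<in> bases \<Longrightarrow> Y \<subseteq> V \<Longrightarrow> card Y = 4 \<Longrightarrow>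
      sum u Z - (\<Sum>e\<in>Z. p (l e)) + sum p Y + sum p W \<le> opt - \<gamma>" by blast
  note sump = sum_labels[of _ _ p]
  \<comment> \<open>A single exchange makes X non-special at the price of one charge, so the dual
    bound holds with equality there and the new set maximizes \<open>sum p\<close> among the
    4-sets.\<close>
  have swap: "sum p Y \<le> sum p X - p x + p y" if x: "x \<in> X" and y: "y \<in> V - X" and Y: "Y \<subseteq> V" "card Y = 4" for x y Y
  proof -
    let ?Y = "insert y (X - {x})"
    have ns: "\<not> special ?Y" "card ?Y = 4"
      using exchange_not_special[OF ij(1-3), of x y] x y by (auto simp: X_def)
    have sub: "?Y \<subseteq> V" using x y X by auto
    obtain Z where Z: "Z \<in> bases" "inj_on l Z" "l ` Z = ?Y \<union> W" "sum w Z = opt"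
      by (rule zero_basis[OF sub ns(2,1)])
    have "?Y - X = {y}" using y by auto
    then have "sum u Z = opt - \<gamma>" using sum_u[OF Z(2,3) sub Z(1)] Z(4) by simp
    then have "sum p Y \<le> sum p ?Y" using p[OF Z(1) Y] sump[OF Z(2,3) sub] by simp
    also have "sum p ?Y = sum p X - p x + p y" using X(3) x y by (simp add: sum_diff1)
    finally show ?thesis .
  qed
  obtain k where k: "k < 7" "k \<noteq> i" "k \<noteq> j"
  proof -
    have "\<exists>k<7. k \<noteq> i \<and> k \<noteq> j" by presburger
    then show ?thesis using that by blast
  qed
  obtain y0 y1 where y: "P k = {y0, y1}" "y0 \<noteq> y1" using pair_elems[OF k(1)] by blast
  then have y01: "y0 \<in> V - X" "y1 \<in> V - X" "y0 \<noteq> y1"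
    using pair_sub[OF k(1)] disj_pairs[of k i] disj_pairs[of k j] k ij
    unfolding X_def by auto
  have le1: "p x \<le> p y" if "x \<in> X" "y \<in> V - X" for x y
    using swap[OF that X(1,2)] by simp
  have eqx: "p x \<le> p x'" if "x \<in> X" "x' \<in> X" for x x'
  proof -
    let ?Y = "insert y0 (X - {x'})"
    have "?Y \<subseteq> V" "card ?Y = 4" "sum p ?Y = sum p X - p x' + p y0"
      using that y01 X by (auto simp: sum_diff1)
    then show ?thesis using swap[OF that(1) y01(1), of ?Y] by simp
  qed
  have eqy: "p y \<le> p y'" if "y \<in> V - X" "y' \<in> V - X" for y y'
  proof -
    obtain x where x: "x \<in> X" using X by fastforce
    let ?Y = "insert y (X - {x})"
    have "?Y \<subseteq> V" "card ?Y = 4" "sum p ?Y = sum p X - p x + p y"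
      using that x X by (auto simp: sum_diff1)
    then show ?thesis using swap[OF x that(2), of ?Y] by simp
  qed
  obtain x0 x1 where "P i = {x0, x1}" "x0 \<noteq> x1" using pair_elems[OF ij(1)] by blast
  then have x01: "x0 \<in> X" "x1 \<in> X" "x0 \<noteq> x1" by (auto simp: X_def)
  \<comment> \<open>Comparing the single exchange with a double exchange gives the inequality
    opposite to \<open>le1\<close>.\<close>
  have "p y1 \<le> p x1"
  proof -
    let ?Y = "insert y1 (insert y0 (X - {x0} - {x1}))"
    have "?Y \<subseteq> V" "card ?Y = 4" "sum p ?Y = sum p X - p x0 - p x1 + p y0 + p y1"
      using x01 y01 X by (auto simp: sum_diff1 card_Diff_singleton)
    then show ?thesis using swap[OF x01(1) y01(1), of ?Y] by simp
  qed
  then have const: "p v = p x1" if "v \<in> V" for v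
    using that eqx[of v x1] eqx[of x1 v] eqy[of v y1] eqy[of y1 v] le1[of x1 y1] x01 y01
    by (cases "v \<in> X") auto
  define \<kappa> where "\<kappa> = p x1"
  \<comment> \<open>The charge that u had taken out of w becomes part of the potential.\<close>
  define q where "q v = p v - \<kappa> + (if v \<in> V - X then \<gamma> else 0)" for v
  have op: "on_pairs {i, j} q" using const X by (auto simp: on_pairs_def q_def \<kappa>_def)
  have "max_weight (reduced q) + sum q W \<le> opt - \<gamma>"
  proof -
    obtain Z where Z: "Z \<in> bases" "sum (reduced q) Z = max_weight (reduced q)" by (rule max_weight_obtain)
    have "reduced q e = u e - p (l e) + \<kappa>" for e by (simp add: reduced_def q_def u_def)
    then have "sum (reduced q) Z = sum u Z - (\<Sum>e\<in>Z. p (l e)) + real r * \<kappa>"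
      using card_basis[OF Z(1)] by (simp add: sum.distrib sum_subtractf)
    moreover have "sum q W = (\<Sum>v\<in>W. p v - \<kappa>)"
      using VW by (intro sum.cong) (auto simp: q_def)
    then have "sum q W = sum p W - real (card W) * \<kappa>" by (simp add: sum_subtractf)
    moreover have "sum p X = (\<Sum>v\<in>X. \<kappa>)"
      unfolding \<kappa>_def by (intro sum.cong refl const) (use X(1) in auto)
    then have "sum p X = 4 * \<kappa>" using X(2) by simp
    moreover have "sum u Z - (\<Sum>e\<in>Z. p (l e)) + sum p X + sum p W \<le> opt - \<gamma>"
      using p[OF Z(1) X(1,2)] .
    moreover have "real r * \<kappa> = 4 * \<kappa> + real (card W) * \<kappa>" using rank_eq by (simp add: distrib_right)
    ultimately show ?thesis using Z(2) by linarith
  qed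
  then have "tight {i, j} q" using op pair_rank_simps(3)[OF ij(3,4)] by (simp add: tight_def)
  then show ?thesis by blast
qed

section \<open>Level sets of tight potentials\<close>

definition lev :: "('b \<Rightarrow> real) \<Rightarrow> real \<Rightarrow> 'b set" where
  "lev p a = {v \<in> V \<union> W. p v \<le> a}"

definition elts :: "'b set \<Rightarrow> 'a set" where
  "elts S = {e \<in> E. l e \<in> S}"

text \<open>The unweighted analogue of \<open>tight\<close>, for the matroid of maximum weight bases of \<open>w\<close>.\<close>

definition set_tight :: "nat set \<Rightarrow> 'b set \<Rightarrow> bool" where
  "set_tight I S \<longleftrightarrow> I \<subseteq> {..<7} \<and> S \<subseteq> V \<union> W \<and> S \<inter> V = U I \<and> layered_rank w (elts S) = int (card (S \<inter> W)) + pair_rank I"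

lemma elts_Un: "elts (S \<union> T) = elts S \<union> elts T" and elts_Int: "elts (S \<inter> T) = elts S \<inter> elts T"
  by (auto simp: elts_def)

lemma card_basis_elts:
  assumes "Z \<in> bases" "inj_on l Z" "l ` Z = Y \<union> W" "Y \<subseteq> V" "S \<subseteq> V \<union> W"
  shows "card (Z \<inter> elts S) = card (Y \<inter> (S \<inter> V)) + card (S \<inter> W)"
proof -
  have "Z \<inter> elts S = Z \<inter> l -` S" using basis_subset[OF assms(1)] by (auto simp: elts_def)
  then have "card (Z \<inter> elts S) = card (l ` (Z \<inter> l -` S))"
    using card_image[of l "Z \<inter> l -` S"] assms(2) by (simp add: inj_on_Int)
  also have "l ` (Z \<inter> l -` S) = l ` Z \<inter> S" by auto
  also have "\<dots> = (Y \<inter> (S \<inter> V)) \<union> (S \<inter> W)" using assms(3,4) by auto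
  also have "card \<dots> = card (Y \<inter> (S \<inter> V)) + card (S \<inter> W)"
    using finV finW VW by (intro card_Un_disjoint) auto
  finally show ?thesis .
qed

lemma set_tight_lower:
  assumes "I \<subseteq> {..<7}" "S \<subseteq> V \<union> W" "S \<inter> V = U I"
  shows "int (card (S \<inter> W)) + pair_rank I \<le> layered_rank w (elts S)"
proof -
  obtain Y where Y: "Y \<subseteq> V" "card Y = 4" "\<not> special Y" "pair_rank I \<le> int (card (Y \<inter> U I))"
    using transversal_ex[OF assms(1)] by blast
  obtain Z where Z: "Z \<in> bases" "inj_on l Z" "l ` Z = Y \<union> W" "sum w Z = max_weight w"
    by (rule zero_basis[OF Y(1-3)])
  show ?thesis
    using max_basis_le_layered_rank[OF Z(1,4), of "elts S"] card_basis_elts[OF Z(1-3) Y(1) assms(2)] Y(4) assms(3) by simp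
qed

text \<open>Submodularity and \<open>set_tight_lower\<close> squeeze the layered ranks of union and
  intersection. Their sum is then additive, and since each layer is submodular, equality of the sums
  forces equality in every layer.\<close>

lemma set_tight_lattice:
  assumes S: "set_tight I S" and T: "set_tight J T" and K: "K = I \<union> J" and H: "H = I \<inter> J"
    and mod: "pair_rank I + pair_rank J = pair_rank K + pair_rank H"
  shows "set_tight K (S \<union> T)" "set_tight H (S \<inter> T)"
    "layer_rank w s (elts (S \<union> T)) + layer_rank w s (elts (S \<inter> T)) = layer_rank w s (elts S) + layer_rank w s (elts T)"
proof -
  have I: "I \<subseteq> {..<7}" "S \<subseteq> V \<union> W" "S \<inter> V = U I" "layered_rank w (elts S) = int (card (S \<inter> W)) + pair_rank I"
    and J: "J \<subseteq> {..<7}" "T \<subseteq> V \<union> W" "T \<inter> V = U J" "layered_rank w (elts T) = int (card (T \<inter> W)) + pair_rank J"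
    using S T by (auto simp: set_tight_def)
  have un: "K \<subseteq> {..<7}" "S \<union> T \<subseteq> V \<union> W" "(S \<union> T) \<inter> V = U K"
    using I J K by (auto simp: U_Un)
  have int: "H \<subseteq> {..<7}" "S \<inter> T \<subseteq> V \<union> W" "(S \<inter> T) \<inter> V = U H"
    using I J H U_Int[OF I(1) J(1)] by auto
  have "card (S \<inter> W) + card (T \<inter> W) = card ((S \<union> T) \<inter> W) + card ((S \<inter> T) \<inter> W)"
  proof -
    have "(S \<union> T) \<inter> W = (S \<inter> W) \<union> (T \<inter> W)" "(S \<inter> T) \<inter> W = (S \<inter> W) \<inter> (T \<inter> W)" by auto
    then show ?thesis using card_Un_Int[of "S \<inter> W" "T \<inter> W"] finW by simp
  qed
  then have eq: "layered_rank w (elts S) + layered_rank w (elts T) = (int (card ((S \<union> T) \<inter> W)) + pair_rank K) + (int (card ((S \<inter> T) \<inter> W)) + pair_rank H)"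
    using I(4) J(4) mod by simp
  have sub: "layered_rank w (elts (S \<union> T)) + layered_rank w (elts (S \<inter> T)) \<le> layered_rank w (elts S) + layered_rank w (elts T)"
    unfolding elts_Un elts_Int by (rule layered_rank_submodular)
  show "set_tight K (S \<union> T)" "set_tight H (S \<inter> T)"
    using set_tight_lower[OF un] set_tight_lower[OF int] eq sub un int unfolding set_tight_def by linarith+
  then have tot: "layered_rank w (elts (S \<union> T)) + layered_rank w (elts (S \<inter> T)) = layered_rank w (elts S) + layered_rank w (elts T)"
    using eq by (simp add: set_tight_def)
  show "layer_rank w s (elts (S \<union> T)) + layer_rank w s (elts (S \<inter> T)) = layer_rank w s (elts S) + layer_rank w s (elts T)"
  proof (cases "s \<in> w ` E")
    case True
    have "(\<Sum>s\<in>w ` E. layer_rank w s (elts (S \<union> T)) + layer_rank w s (elts (S \<inter> T))) = (\<Sum>s\<in>w ` E. layer_rank w s (elts S) + layer_rank w s (elts T))"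
      using tot by (simp add: layered_rank_def sum.distrib)
    then show ?thesis
    proof (rule sum_mono_inv)
      show "layer_rank w s (elts (S \<union> T)) + layer_rank w s (elts (S \<inter> T)) \<le> layer_rank w s (elts S) + layer_rank w s (elts T)" for s
        unfolding elts_Un elts_Int by (rule layer_rank_submodular)
    qed (use True finite_ground in auto)
  next
    case False
    then have "layer_rank w s X = 0" for X by (auto simp: layer_rank_def intro!: arg_cong[where f = rk])
    then show ?thesis by simp
  qed
qed

text \<open>On the layer w = s the threshold condition \<open>s - a \<le> reduced p e\<close> reads
  \<open>p (l e) \<le> a\<close>. Thresholds of the reduced weight thus cut level sets of the
  potential out of the layers.\<close>

lemma tight_spans:
  assumes "Z \<in> bases" "sum w Z = max_weight w" "sum (reduced p) Z = max_weight (reduced p)"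
  shows "spans Z {e \<in> E. t \<le> reduced p e \<and> s \<le> w e}"
    "spans Z ({e \<in> E. s < w e} \<union> {e \<in> E \<inter> elts (lev p a). w e = s})"
proof -
  show 1: "spans Z {e \<in> E. t \<le> reduced p e \<and> s \<le> w e}" for t s
  proof -
    have "spans Z ({e \<in> E. t \<le> reduced p e} \<inter> {e \<in> E. s \<le> w e})"
      using spans_Un_Int(2)[OF assms(1)] max_basis_spans(1)[OF assms(1)] assms by blast
    moreover have "{e \<in> E. t \<le> reduced p e} \<inter> {e \<in> E. s \<le> w e} = {e \<in> E. t \<le> reduced p e \<and> s \<le> w e}" by auto
    ultimately show ?thesis by simp
  qed
  have "spans Z ({e \<in> E. s - a \<le> reduced p e \<and> s \<le> w e} \<union> {e \<in> E. s < w e})"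
    using spans_Un_Int(1)[OF assms(1) 1] max_basis_spans(2)[OF assms(1,2)] by blast
  moreover have "{e \<in> E. s - a \<le> reduced p e \<and> s \<le> w e} \<union> {e \<in> E. s < w e}
      = {e \<in> E. s < w e} \<union> {e \<in> E \<inter> elts (lev p a). w e = s}"
    using lab by (auto simp: reduced_def elts_def lev_def)
  ultimately show "spans Z ({e \<in> E. s < w e} \<union> {e \<in> E \<inter> elts (lev p a). w e = s})" by simp
qed

lemma tight_layer_rank:
  assumes "Z \<in> bases" "sum w Z = max_weight w" "sum (reduced p) Z = max_weight (reduced p)"
  shows "layer_rank w s (elts (lev p a)) = int (card {e \<in> Z \<inter> elts (lev p a). w e = s})"
  using tight_spans(2)[OF assms, of s a] max_basis_card_layer[OF assms(1,2), of "elts (lev p a)" s]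
  unfolding spans_def layer_rank_def by simp

lemma lev_pairs:
  assumes "on_pairs I p" "I \<subseteq> {..<7}" "0 \<le> a"
  shows "lev p a \<inter> V = U (if a < \<gamma> then I else {..<7})"
proof -
  have "U {..<7} = V" by (auto simp: U_def V_eq)
  moreover have "p v \<le> a \<longleftrightarrow> v \<in> U I \<or> \<gamma> \<le> a" if "v \<in> V" for v
    using assms(1,3) that by (auto simp: on_pairs_def)
  ultimately show ?thesis using U_sub[OF assms(2)] by (auto simp: lev_def)
qed

text \<open>The common optimal basis attains the rank of the level set in every layer, so the
  layered rank is found by counting its labels. From level \<gamma> on, all of V is
  included.\<close>

lemma level_set_tight:
  assumes "I \<subseteq> {..<7}" "tight I p" "0 \<le> a"
  shows "set_tight (if a < \<gamma> then I else {..<7}) (lev p a)"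
proof -
  obtain Z Y where Z: "Z \<in> bases" "sum w Z = max_weight w" "sum (reduced p) Z = max_weight (reduced p)"
    and Y: "Y \<subseteq> V" "card Y = 4" "inj_on l Z" "l ` Z = Y \<union> W" "int (card (Y \<inter> U I)) = pair_rank I"
    by (rule tight_basis[OF assms(1,2)])
  have sub: "lev p a \<subseteq> V \<union> W" by (auto simp: lev_def)
  have V: "lev p a \<inter> V = U (if a < \<gamma> then I else {..<7})"
    using lev_pairs assms by (simp add: tight_def)
  have "layered_rank w (elts (lev p a)) = int (card (Z \<inter> elts (lev p a)))"
    unfolding layered_rank_def card_layers[OF basis_subset[OF Z(1)], of "elts (lev p a)" w]
    by (intro sum.cong) (use tight_layer_rank[OF Z] in auto)
  also have "\<dots> = int (card (lev p a \<inter> W)) + pair_rank (if a < \<gamma> then I else {..<7})"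
  proof -
    have "U {..<7} = V" by (auto simp: U_def V_eq)
    then have "int (card (Y \<inter> U (if a < \<gamma> then I else {..<7}))) = pair_rank (if a < \<gamma> then I else {..<7})"
      using Y pair_rank_simps(6) by (auto simp: Int_absorb2)
    then show ?thesis using card_basis_elts[OF Z(1) Y(3,4,1) sub] V by simp
  qed
  finally show ?thesis using sub V assms(1) by (auto simp: set_tight_def)
qed

lemma lev_inf: "lev (inf p q) a = lev p a \<union> lev q a" and lev_sup: "lev (sup p q) a = lev p a \<inter> lev q a"
  by (auto simp: lev_def inf_min sup_max)

lemma level_modular:
  assumes "I \<subseteq> {..<7}" "J \<subseteq> {..<7}" "tight I p" "tight J q"
    and mod: "pair_rank I + pair_rank J = pair_rank (I \<union> J) + pair_rank (I \<inter> J)" and a: "0 \<le> a"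
  shows "layer_rank w s (elts (lev (inf p q) a)) + layer_rank w s (elts (lev (sup p q) a)) = layer_rank w s (elts (lev p a)) + layer_rank w s (elts (lev q a))"
proof -
  show ?thesis unfolding lev_inf lev_sup
    by (rule set_tight_lattice(3)[OF level_set_tight[OF assms(1,3) a] level_set_tight[OF assms(2,4) a] refl refl])
      (use mod in auto)
qed

text \<open>The common optimal basis spans the threshold set, and within layer s the threshold t
  corresponds to the level s - t of the potential.\<close>

lemma threshold_rank:
  assumes "I \<subseteq> {..<7}" "tight I p"
  shows "rk {e \<in> E. t \<le> reduced p e \<and> s0 \<le> w e} = (\<Sum>s\<in>{s\<in>w ` E. s0 \<le> s}. layer_rank w s (elts (lev p (s - t))))"
proof -
  obtain Z Y where Z: "Z \<in> bases" "sum w Z = max_weight w" "sum (reduced p) Z = max_weight (reduced p)"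
    by (rule tight_basis[OF assms])
  let ?F = "{e \<in> E. t \<le> reduced p e \<and> s0 \<le> w e}"
  have "rk ?F = int (card (Z \<inter> ?F))"
    using tight_spans(1)[OF Z] by (simp add: spans_def)
  also have "\<dots> = (\<Sum>s\<in>w ` E. int (card {e \<in> Z \<inter> ?F. w e = s}))"
    by (rule card_layers[OF basis_subset[OF Z(1)]])
  also have "\<dots> = (\<Sum>s\<in>{s\<in>w ` E. s0 \<le> s}. int (card {e \<in> Z \<inter> ?F. w e = s}))"
  proof (intro sum.mono_neutral_right ballI)
    fix s assume "s \<in> w ` E - {s \<in> w ` E. s0 \<le> s}"
    then have "{e \<in> Z \<inter> ?F. w e = s} = {}" by auto
    then show "int (card {e \<in> Z \<inter> ?F. w e = s}) = 0" by (simp only: card.empty of_nat_0)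
  qed (use finite_ground in auto)
  also have "\<dots> = (\<Sum>s\<in>{s\<in>w ` E. s0 \<le> s}. layer_rank w s (elts (lev p (s - t))))"
  proof (intro sum.cong refl)
    fix s assume s: "s \<in> {s\<in>w ` E. s0 \<le> s}"
    have "{e \<in> Z \<inter> ?F. w e = s} = {e \<in> Z \<inter> elts (lev p (s - t)). w e = s}"
      using s lab basis_subset[OF Z(1)] by (auto simp: reduced_def elts_def lev_def)
    then show "int (card {e \<in> Z \<inter> ?F. w e = s}) = layer_rank w s (elts (lev p (s - t)))"
      using tight_layer_rank[OF Z] by simp
  qed
  finally show ?thesis .
qed

end

section \<open>Lattice identities for potentials\<close>

definition median :: "'c::lattice \<Rightarrow> 'c \<Rightarrow> 'c \<Rightarrow> 'c" where
  "median a b c = inf (inf (sup a b) (sup a c)) (sup b c)"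

text \<open>Pointwise, a median is at least m iff at least two of its three arguments are. Two such
  majorities have an index in common.\<close>

lemma inf_median_le:
  fixes a b c d e f :: "'b \<Rightarrow> real"
  shows "inf (median a b c) (median d e f) \<le> sup (sup (inf a d) (inf b e)) (inf c f)"
proof (rule le_funI)
  fix v
  have *: "m \<le> max (max (min x1 y1) (min x2 y2)) (min x3 y3)"
    if "m \<le> min (min (max x1 x2) (max x1 x3)) (max x2 x3)" "m \<le> min (min (max y1 y2) (max y1 y3)) (max y2 y3)"
    for m x1 x2 x3 y1 y2 y3 :: real
    using that unfolding le_max_iff_disj min.bounded_iff by argo
  have "min (min (min (max x1 x2) (max x1 x3)) (max x2 x3)) (min (min (max y1 y2) (max y1 y3)) (max y2 y3))
      \<le> max (max (min x1 y1) (min x2 y2)) (min x3 y3)" for x1 x2 x3 y1 y2 y3 :: real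
    by (rule *; rule min.cobounded1 min.cobounded2)
  then show "inf (median a b c) (median d e f) v \<le> sup (sup (inf a d) (inf b e)) (inf c f) v"
    by (simp add: median_def inf_min sup_max)
qed

text \<open>
  After subtracting \<open>\<Phi> (inf p0 p1)\<close> from both sides, the left side is a defect with a tight supremum, which
  bounds the defect of restrictions, and the right side is a defect with a tight infimum, which bounds the
  defect of contractions.
\<close>

lemma modular_identity:
  fixes \<Phi> :: "('b \<Rightarrow> real) \<Rightarrow> int"
  assumes T: "sup p0 p1 = T" "sup p2 p3 = T"
    and mod: "\<And>p q. (p, q) \<in> {(inf p0 p2, inf p0 p3), (inf p1 p2, inf p1 p3), (inf p0 p2, inf p1 p2),
        (inf p0 p3, inf p1 p3), (p2, p3), (inf p0 (inf p2 p3), inf p1 (inf p2 p3))} \<Longrightarrow>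
      \<Phi> (inf p q) + \<Phi> (sup p q) = \<Phi> p + \<Phi> q"
  shows "\<Phi> p0 + \<Phi> p1 - \<Phi> T =
    \<Phi> (inf (inf p0 p1) p2) + \<Phi> (inf (inf p0 p1) p3) - \<Phi> (inf (inf p0 p1) (inf p2 p3))"
proof -
  have le: "inf p0 T = p0" "inf p1 T = p1" "inf p2 T = p2" "inf p3 T = p3"
    using sup_ge1 sup_ge2 T by (metis inf_absorb1)+
  have "inf (inf p0 p2) (inf p0 p3) = inf p0 (inf p2 p3)" "sup (inf p0 p2) (inf p0 p3) = p0"
    using le T by (auto simp: inf_aci simp flip: inf_sup_distrib1)
  moreover have "inf (inf p1 p2) (inf p1 p3) = inf p1 (inf p2 p3)" "sup (inf p1 p2) (inf p1 p3) = p1"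
    using le T by (auto simp: inf_aci simp flip: inf_sup_distrib1)
  moreover have "inf (inf p0 p2) (inf p1 p2) = inf (inf p0 p1) p2" "sup (inf p0 p2) (inf p1 p2) = p2"
    using le T by (auto simp: inf_aci simp flip: inf_sup_distrib2)
  moreover have "inf (inf p0 p3) (inf p1 p3) = inf (inf p0 p1) p3" "sup (inf p0 p3) (inf p1 p3) = p3"
    using le T by (auto simp: inf_aci simp flip: inf_sup_distrib2)
  moreover have "inf (inf p0 (inf p2 p3)) (inf p1 (inf p2 p3)) = inf (inf p0 p1) (inf p2 p3)"
    by (auto simp: inf_aci)
  moreover have "sup (inf p0 (inf p2 p3)) (inf p1 (inf p2 p3)) = inf p2 p3"
  proof -
    have "sup (inf p0 (inf p2 p3)) (inf p1 (inf p2 p3)) = inf T (inf p2 p3)"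
      using T by (simp flip: inf_sup_distrib2)
    also have "\<dots> = inf p2 p3" using le by (metis inf_assoc inf_commute)
    finally show ?thesis .
  qed
  ultimately show ?thesis
    using mod[of "inf p0 p2" "inf p0 p3"] mod[of "inf p1 p2" "inf p1 p3"] mod[of "inf p0 p2" "inf p1 p2"]
      mod[of "inf p0 p3" "inf p1 p3"] mod[of p2 p3] mod[of "inf p0 (inf p2 p3)" "inf p1 (inf p2 p3)"] T
    by simp
qed

section \<open>Potentials of the pairs 0 to 3 and the loss of the pairs 0 and 1\<close>

context normalized_rep
begin

lemma potentials_ex:
  "\<exists>p0 p1 p2 p3 T. sup p0 p1 = T \<and> sup p2 p3 = T \<and> tight {} T \<and>
    tight {0} p0 \<and> tight {1} p1 \<and> tight {2} p2 \<and> tight {3} p3 \<and>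
    tight {0, 2} (inf p0 p2) \<and> tight {0, 3} (inf p0 p3) \<and>
    tight {1, 2} (inf p1 p2) \<and> tight {1, 3} (inf p1 p3) \<and> tight {2, 3} (inf p2 p3)"
proof -
  define c where "c i j = (SOME p. tight {i, j} p)" for i j
  have c: "tight {i, j} (c i j)" if "i < 7" "j < 7" "i \<noteq> j" "{i, j} \<noteq> {2, 3}" "{i, j} \<noteq> {0, 1}" for i j
    using edge_cert[OF that] unfolding c_def by (rule someI_ex)
  have hub: "tight {i, k} (c i k)" "pair_rank {i, k} = 3" "i \<noteq> k" "k < 7" if "i < 4" "k \<in> {4, 5, 6}" for i k
  proof -
    have k: "4 \<le> k" "k < 7" using that(2) by auto
    then have "k \<notin> {2, 3}" "k \<notin> {0, 1}" by simp_all
    then have ne: "{i, k} \<noteq> {2, 3}" "{i, k} \<noteq> {0, 1}" by blast+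
    have i: "i < 7" and ik: "i \<noteq> k" using that(1) k by simp_all
    show "i \<noteq> k" "k < 7" by (fact ik, fact k(2))
    show "tight {i, k} (c i k)" by (rule c[OF i k(2) ik ne])
    show "pair_rank {i, k} = 3" by (rule pair_rank_simps(3)[OF ik ne(1)])
  qed
  \<comment> \<open>Two hubs would suffice for tightness on {i}, because 3 + 3 = 4 + 2. The third
    hub is there for the majority argument on pairs of medians.\<close>
  define p where "p i = median (c i 4) (c i 5) (c i 6)" for i
  have p: "tight {i} (p i)" if i: "i < 4" for i
  proof -
    have s: "tight {i} (sup (c i j) (c i k))" if "j \<in> {4, 5, 6}" "k \<in> {4, 5, 6}" "j \<noteq> k" for j k
    proof (rule tight_sup[of "{i, j}" "{i, k}" _ _ "{i, j, k}"])
      show "tight {i, j} (c i j)" "tight {i, k} (c i k)" using hub i that by blast+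
      have "pair_rank {i, j, k} = 4" using hub(3) i that by (intro pair_rank_simps(5)) blast+
      then show "pair_rank {i, j} + pair_rank {i, k} = pair_rank {i, j, k} + pair_rank {i}"
        using hub(2) i that by (simp add: pair_rank_simps(2))
      show "{i, j} \<subseteq> {..<7}" "{i, k} \<subseteq> {..<7}" using hub(4) i that by auto
      show "{i} = {i, j} \<inter> {i, k}" using that(3) by auto
    qed auto
    have i7: "{i} \<subseteq> {..<7}" using i by auto
    note inf_same = tight_inf[OF i7 i7, of _ _ "{i}" "{i}"]
    show ?thesis unfolding p_def median_def
      by (intro inf_same s) auto
  qed
  have q: "tight {i, j} (inf (p i) (p j))"
    if ij: "i < 4" "j < 4" "i \<noteq> j" "{i, j} \<noteq> {2, 3}" "{i, j} \<noteq> {0, 1}" for i j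
  proof -
    have sub: "{i, j} \<subseteq> {..<7}" "{i} \<subseteq> {..<7}" "{j} \<subseteq> {..<7}" using ij by auto
    have Q: "tight {i, j, k} (inf (c i k) (c j k))" if k: "k \<in> {4, 5, 6}" for k
    proof (rule tight_inf[of "{i, k}" "{j, k}" _ _ _ "{k}"])
      show "tight {i, k} (c i k)" "tight {j, k} (c j k)" using hub ij k by blast+
      have "pair_rank {i, j, k} = 4" using hub(3) ij(1-3) k by (intro pair_rank_simps(5)) blast+
      then show "pair_rank {i, k} + pair_rank {j, k} = pair_rank {i, j, k} + pair_rank {k}"
        using hub(2) ij(1,2) k by (simp add: pair_rank_simps(2))
      show "{i, k} \<subseteq> {..<7}" "{j, k} \<subseteq> {..<7}" using hub(4) ij(1,2) k by auto
      show "{k} = {i, k} \<inter> {j, k}" using ij(3) by auto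
    qed auto
    \<comment> \<open>Nested index sets are always modular, so a potential tight for {i, j} can be
      raised by one tight for {i, j, k}.\<close>
    have shrink: "tight {i, j} (sup s (inf (c i k) (c j k)))" if s: "tight {i, j} s" and k: "k \<in> {4, 5, 6}" for s k
    proof (rule tight_sup[OF _ _ s Q[OF k], of "{i, j, k}"])
      have "pair_rank {i, j, k} = 4" using hub(3) ij(1-3) k by (intro pair_rank_simps(5)) blast+
      then show "pair_rank {i, j} + pair_rank {i, j, k} = pair_rank {i, j, k} + pair_rank {i, j}" by simp
    qed (use ij(1,2) hub(4) k in auto)
    define s where "s = sup (sup (sup (c i j) (inf (c i 4) (c j 4))) (inf (c i 5) (c j 5))) (inf (c i 6) (c j 6))"
    have s: "tight {i, j} s" unfolding s_def by (intro shrink c) (use ij in auto)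
    have "tight {i, j} (inf s (p i))"
      by (rule tight_inf[OF sub(1,2) s p[OF ij(1)], of _ "{i}"]) auto
    then have "tight {i, j} (inf (inf s (p i)) (p j))"
      by (rule tight_inf[OF sub(1,3) _ p[OF ij(2)], of _ _ "{j}"]) auto
    \<comment> \<open>The index sets {i} and {j} are not modular, but each is nested in {i, j}, so s
      may be cut by p i and by p j. By the majority argument nothing of s is left in the
      result.\<close>
    moreover have "inf (p i) (p j) \<le> s"
      using inf_median_le[of "c i 4" "c i 5" "c i 6" "c j 4" "c j 5" "c j 6"] unfolding p_def s_def
      by (simp add: sup_assoc le_supI2)
    then have "inf (inf s (p i)) (p j) = inf (p i) (p j)"
      by (simp add: inf_assoc inf_absorb2)
    ultimately show ?thesis by simp
  qed
  have q': "tight {0, 2} (inf (p 0) (p 2))" "tight {0, 3} (inf (p 0) (p 3))"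
    "tight {1, 2} (inf (p 1) (p 2))" "tight {1, 3} (inf (p 1) (p 3))"
    using q[of 0 2] q[of 0 3] q[of 1 2] q[of 1 3] by (auto simp: doubleton_eq_iff)
  have rk3: "pair_rank {0, 2} = 3" "pair_rank {0, 3} = 3" "pair_rank {1, 2} = 3" "pair_rank {1, 3} = 3"
    "pair_rank {0, 1, 2} = 4" "pair_rank {0, 1, 3} = 4"
    by (simp_all add: pair_rank_def doubleton_eq_iff)
  \<comment> \<open>Modularity does not yield tightness of \<open>sup (p 0) (p 1)\<close> for {},
    since 2 + 2 > 3 + 0. Hence p 2 and p 3 are capped by it, which preserves their tightness, and
    their \<open>sup\<close> is tight because 2 + 2 = 4 + 0.\<close>
  define T where "T = inf (sup (p 2) (p 3)) (sup (p 0) (p 1))"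
  have A2: "tight {2} (inf (p 2) (sup (p 0) (p 1)))"
  proof -
    have "tight {2} (sup (inf (p 0) (p 2)) (inf (p 1) (p 2)))"
      by (rule tight_sup[OF _ _ q'(1,3), of "{0, 1, 2}"]) (use rk3 pair_rank_simps in auto)
    then show ?thesis by (simp add: inf_sup_distrib1 inf_commute)
  qed
  have A3: "tight {3} (inf (p 3) (sup (p 0) (p 1)))"
  proof -
    have "tight {3} (sup (inf (p 0) (p 3)) (inf (p 1) (p 3)))"
      by (rule tight_sup[OF _ _ q'(2,4), of "{0, 1, 3}"]) (use rk3 pair_rank_simps in auto)
    then show ?thesis by (simp add: inf_sup_distrib1 inf_commute)
  qed
  have T: "tight {} T"
  proof -
    have "tight {} (sup (inf (p 2) (sup (p 0) (p 1))) (inf (p 3) (sup (p 0) (p 1))))"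
      by (rule tight_sup[OF _ _ A2 A3, of "{2, 3}"]) (use pair_rank_simps in auto)
    then show ?thesis unfolding T_def by (simp only: inf_sup_distrib2)
  qed
  \<comment> \<open>Cutting with T does not change index sets, and T lies below both
    \<open>sup\<close>s, so by distributivity both become equal to T.\<close>
  have cut: "tight I (inf s T)" if "tight I s" "I \<subseteq> {..<7}" for I s
    by (rule tight_inf[OF that(2) _ that(1) T, of _ "{}"]) auto
  have inf_cut: "inf (inf x T) (inf y T) = inf (inf x y) T" for x y
    by (simp add: inf_aci)
  have "sup (inf (p 0) T) (inf (p 1) T) = T"
    unfolding inf_sup_distrib2[symmetric] by (simp add: T_def inf_absorb2)
  moreover have "sup (inf (p 2) T) (inf (p 3) T) = T"
    unfolding inf_sup_distrib2[symmetric] by (simp add: T_def inf_absorb2)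
  moreover have "tight {0} (inf (p 0) T)" "tight {1} (inf (p 1) T)" and t23: "tight {2} (inf (p 2) T)" "tight {3} (inf (p 3) T)"
    by (intro cut p; simp)+
  moreover have "tight {2, 3} (inf (inf (p 2) T) (inf (p 3) T))"
    by (rule tight_inf[OF _ _ t23, of _ "{}"]) (use pair_rank_simps in auto)
  moreover have "tight {0, 2} (inf (inf (p 0) T) (inf (p 2) T))" "tight {0, 3} (inf (inf (p 0) T) (inf (p 3) T))"
    "tight {1, 2} (inf (inf (p 1) T) (inf (p 2) T))" "tight {1, 3} (inf (inf (p 1) T) (inf (p 3) T))"
    unfolding inf_cut by (intro cut q'; simp)+
  ultimately show ?thesis using T by blast
qed

text \<open>No maximum weight basis carries the labels \<open>P 0 \<union> P 1 \<union> W\<close>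
  exactly once, so Rado's condition fails for some S among them; it comes from
  \<open>matroid_intersection\<close> with the function that counts distinct labels. If S missed an
  element of the two pairs, the basis of a non-special exchange set would meet \<open>elts S\<close>
  in \<open>card S\<close> elements. So S contains both pairs, and \<open>set_tight_lower\<close>
  allows a deficiency of only one.\<close>

lemma violating_set:
  obtains S where "set_tight {0, 1} S"
proof -
  let ?X = "P 0 \<union> P 1 \<union> W"
  have finX: "finite ?X" using finW fin_pair by simp
  have X: "P 0 \<union> P 1 \<subseteq> V" using pair_sub[of 0] pair_sub[of 1] by simp
  have cX: "card ?X = r" using card_VW[OF X] card_two_pairs[of 0 1] fin_pair rank_eq by simp
  let ?f = "\<lambda>S. int (card (l ` S \<inter> ?X))"
  have rf: "rank_function ?f"
    unfolding rank_function_def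
  proof (intro conjI allI impI)
    fix S T :: "'a set" assume "S \<subseteq> T"
    then show "?f S \<le> ?f T" using finX by (auto intro!: card_mono)
  next
    fix a and S :: "'a set"
    have "card (l ` insert a S \<inter> ?X) \<le> card (insert (l a) (l ` S \<inter> ?X))"
      using finX by (intro card_mono) auto
    also have "\<dots> \<le> card (l ` S \<inter> ?X) + 1" using finX by (simp add: card_insert_if)
    finally show "?f (insert a S) \<le> ?f S + 1" by linarith
  next
    fix S T :: "'a set"
    have "card (l ` (S \<inter> T) \<inter> ?X) \<le> card ((l ` S \<inter> ?X) \<inter> (l ` T \<inter> ?X))"
      using finX by (intro card_mono) auto
    moreover have "l ` (S \<union> T) \<inter> ?X = (l ` S \<inter> ?X) \<union> (l ` T \<inter> ?X)" by auto
    ultimately show "?f (S \<union> T) + ?f (S \<inter> T) \<le> ?f S + ?f T"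
      using card_Un_Int[of "l ` S \<inter> ?X" "l ` T \<inter> ?X"] finX by simp
  qed simp
  have "\<exists>S\<subseteq>E. \<not> int r \<le> ?f S + layered_rank w (E - S)"
  proof (rule ccontr)
    assume "\<not> ?thesis"
    then obtain Z where Z: "Z \<subseteq> E" "card Z = r" "?f Z = int r" "layered_rank w Z = int r"
      using matroid_intersection[OF finite_ground rf rank_function_layered_rank[of w], of r] by blast
    have finZ: "finite Z" using Z(1) finite_ground finite_subset by blast
    have cap: "card (l ` Z \<inter> ?X) = r" using Z(3) by simp
    then have "l ` Z \<inter> ?X = ?X" using cX finX by (intro card_subset_eq) auto
    moreover have "card (l ` Z) \<le> r" using card_image_le[OF finZ, of l] Z(2) by simp
    ultimately have lZ: "l ` Z = ?X" using cX finX finZ card_subset_eq[of "l ` Z" ?X]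
      by (metis card_mono finite_imageI inf.absorb_iff2 le_antisym)
    then have inj: "inj_on l Z" using finZ cX Z(2) by (simp add: eq_card_imp_inj_on)
    have "Z \<in> bases" "sum w Z = max_weight w" using layered_rank_full_basis[OF Z(1,2,4)] by auto
    moreover have "max_weight w \<ge> opt"
    proof -
      obtain Y where Y: "Y \<subseteq> V" "card Y = 4" "\<not> special Y" using transversal_ex[of "{}"] by blast
      obtain Z' where "Z' \<in> bases" "inj_on l Z'" "l ` Z' = Y \<union> W" "sum w Z' = opt" "sum w Z' = max_weight w"
        by (rule zero_basis[OF Y])
      then show ?thesis by simp
    qed
    ultimately show False using dist[OF _ inj lZ] by (simp add: bases_def)
  qed
  then obtain S0 where S0: "S0 \<subseteq> E" "?f S0 + layered_rank w (E - S0) < int r" by (auto simp: not_le)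
  \<comment> \<open>The labels that S0 fails to cover are all carried by elements outside S0, whose
    layered rank is too small.\<close>
  define S where "S = ?X - l ` S0"
  have sub: "S \<subseteq> V \<union> W" using X by (auto simp: S_def)
  have finS: "finite S" using finX by (simp add: S_def)
  have "layered_rank w (elts S) \<le> layered_rank w (E - S0)" by (rule layered_rank_mono) (auto simp: elts_def S_def)
  moreover have "card S + card (l ` S0 \<inter> ?X) = r"
  proof -
    have "S \<union> (l ` S0 \<inter> ?X) = ?X" "S \<inter> (l ` S0 \<inter> ?X) = {}" by (auto simp: S_def)
    then show ?thesis using card_Un_disjoint[of S "l ` S0 \<inter> ?X"] finX finS cX by simp
  qed
  ultimately have lt: "layered_rank w (elts S) < int (card S)" using S0(2) by linarith
  have SV: "S \<inter> V \<subseteq> P 0 \<union> P 1" using VW by (auto simp: S_def)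
  have cS: "card S = card (S \<inter> V) + card (S \<inter> W)"
  proof -
    have "S = (S \<inter> V) \<union> (S \<inter> W)" using sub by auto
    then show ?thesis using card_Un_disjoint[of "S \<inter> V" "S \<inter> W"] finS VW by auto
  qed
  have full: "S \<inter> V = P 0 \<union> P 1"
  proof (rule ccontr)
    assume "S \<inter> V \<noteq> P 0 \<union> P 1"
    then obtain x where x: "x \<in> P 0 \<union> P 1" "x \<notin> S \<inter> V" using SV by blast
    obtain y where y: "y \<in> P 2" using pair_elems[of 2] by auto
    have yV: "y \<in> V - (P 0 \<union> P 1)"
      using y pair_sub[of 2] disj_pairs[of 2 0] disj_pairs[of 2 1] by auto
    let ?Y = "insert y (P 0 \<union> P 1 - {x})"
    have ns: "\<not> special ?Y" "card ?Y = 4" using exchange_not_special[of 0 1 x y] x yV by auto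
    have YV: "?Y \<subseteq> V" using X yV by auto
    obtain Z where Z: "Z \<in> bases" "inj_on l Z" "l ` Z = ?Y \<union> W" "sum w Z = max_weight w"
      by (rule zero_basis[OF YV ns(2,1)])
    have "?Y \<inter> (S \<inter> V) = S \<inter> V" using SV x by auto
    then have "card (Z \<inter> elts S) = card S" using card_basis_elts[OF Z(1-3) YV sub] cS by simp
    then show False using max_basis_le_layered_rank[OF Z(1,4), of "elts S"] lt by simp
  qed
  have U: "S \<inter> V = U {0, 1}" using full by (auto simp: U_def)
  have "layered_rank w (elts S) = int (card (S \<inter> W)) + pair_rank {0, 1}"
    using set_tight_lower[of "{0, 1}" S] sub U lt cS full card_two_pairs[of 0 1]
    by (simp add: pair_rank_def doubleton_eq_iff)
  then show ?thesis using that sub U by (simp add: set_tight_def)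
qed

lemma union_thresholds:
  "{e \<in> E. t \<le> reduced p e} \<union> {e \<in> E. t \<le> reduced q e} = {e \<in> E. t \<le> reduced (inf p q) e}"
  "{e \<in> E. t \<le> reduced p e} \<inter> {e \<in> E. t \<le> reduced q e} = {e \<in> E. t \<le> reduced (sup p q) e}"
  by (auto simp: reduced_def inf_min sup_max)

text \<open>The maximum weights for p0 and p1 exceed those for \<open>sup p0 p1\<close> and
  \<open>inf p0 p1\<close> by at least \<gamma>: over an interval of thresholds of length \<gamma>
  the submodular inequality for ranks has a gap of at least one.\<close>

lemma distinguished_loss:
  assumes Z: "Z \<in> \<I>" "inj_on l Z" "l ` Z = P 0 \<union> P 1 \<union> W"
  shows "sum w Z \<le> opt - \<gamma>"
proof -
  obtain p0 p1 p2 p3 T where T: "sup p0 p1 = T" "sup p2 p3 = T" and tT: "tight {} T"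
    and t: "tight {0} p0" "tight {1} p1" "tight {2} p2" "tight {3} p3"
    and t2: "tight {0, 2} (inf p0 p2)" "tight {0, 3} (inf p0 p3)"
      "tight {1, 2} (inf p1 p2)" "tight {1, 3} (inf p1 p3)" "tight {2, 3} (inf p2 p3)"
    using potentials_ex by metis
  define q where "q = inf p0 p1"
  have rk2: "pair_rank {0, 2} = 3" "pair_rank {0, 3} = 3" "pair_rank {1, 2} = 3" "pair_rank {1, 3} = 3" "pair_rank {0, 1} = 3"
    "pair_rank {2, 3} = 4" "pair_rank {0, 1, 2} = 4" "pair_rank {0, 1, 3} = 4" "pair_rank {0, 2, 3} = 4" "pair_rank {1, 2, 3} = 4"
    "pair_rank {0, 1, 2, 3} = 4"
    by (simp_all add: pair_rank_def doubleton_eq_iff)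
  note rks = rk2 pair_rank_simps(1,2)
  have set_eqs: "{0, 2} \<union> {0, 3} = {0, 2, 3::nat}" "{0, 2} \<inter> {0, 3} = {0::nat}"
    "{1, 2} \<union> {1, 3} = {1, 2, 3::nat}" "{1, 2} \<inter> {1, 3} = {1::nat}"
    "{0, 2} \<union> {1, 2} = {0, 1, 2::nat}" "{0, 2} \<inter> {1, 2} = {2::nat}"
    "{0, 3} \<union> {1, 3} = {0, 1, 3::nat}" "{0, 3} \<inter> {1, 3} = {3::nat}"
    "{2} \<union> {3} = {2, 3::nat}" "{2} \<inter> {3::nat} = {}"
    "{0, 2, 3} \<union> {1, 2, 3} = {0, 1, 2, 3::nat}" "{0, 2, 3} \<inter> {1, 2, 3} = {2, 3::nat}"
    by auto
  have t012: "tight {0, 1, 2} (inf q p2)"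
  proof -
    have "tight {0, 1, 2} (inf (inf p0 p2) (inf p1 p2))"
      by (rule tight_inf[OF _ _ t2(1,3), of _ "{2}"]) (use rks in auto)
    then show ?thesis by (simp add: q_def inf_aci)
  qed
  have t013: "tight {0, 1, 3} (inf q p3)"
  proof -
    have "tight {0, 1, 3} (inf (inf p0 p3) (inf p1 p3))"
      by (rule tight_inf[OF _ _ t2(2,4), of _ "{3}"]) (use rks in auto)
    then show ?thesis by (simp add: q_def inf_aci)
  qed
  have t023: "tight {0, 2, 3} (inf p0 (inf p2 p3))"
  proof -
    have "tight {0, 2, 3} (inf (inf p0 p2) (inf p0 p3))"
      by (rule tight_inf[OF _ _ t2(1,2), of _ "{0}"]) (use rks in auto)
    then show ?thesis by (simp add: inf_aci)
  qed
  have t123: "tight {1, 2, 3} (inf p1 (inf p2 p3))"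
  proof -
    have "tight {1, 2, 3} (inf (inf p1 p2) (inf p1 p3))"
      by (rule tight_inf[OF _ _ t2(3,4), of _ "{1}"]) (use rks in auto)
    then show ?thesis by (simp add: inf_aci)
  qed
  have t0123: "tight {0, 1, 2, 3} (inf q (inf p2 p3))"
  proof -
    have "tight {0, 1, 2, 3} (inf (inf p0 (inf p2 p3)) (inf p1 (inf p2 p3)))"
      by (rule tight_inf[OF _ _ t023 t123, of _ "{2, 3}"]) (use rks in auto)
    then show ?thesis by (simp add: q_def inf_aci)
  qed
  have qT: "q \<le> T" unfolding q_def T(1)[symmetric] by (meson inf_le1 le_supI1)
  have q23: "sup (inf q p2) (inf q p3) = q"
    using qT T(2) by (simp add: inf_absorb1 flip: inf_sup_distrib1)
  have q_inf: "inf (inf q p2) (inf q p3) = inf q (inf p2 p3)" by (simp add: inf_aci)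

  define \<Phi> where "\<Phi> s a p = layer_rank w s (elts (lev p a))" for s a p
  have star: "\<Phi> s a p0 + \<Phi> s a p1 - \<Phi> s a T
      = \<Phi> s a (inf q p2) + \<Phi> s a (inf q p3) - \<Phi> s a (inf q (inf p2 p3))" if a: "0 \<le> a" for s a
    unfolding q_def
  proof (rule modular_identity[OF T])
    note lm = level_modular[OF _ _ _ _ _ a, where s = s, folded \<Phi>_def]
    note lm[OF _ _ t2(1,2)] lm[OF _ _ t2(3,4)] lm[OF _ _ t2(1,3)] lm[OF _ _ t2(2,4)]
      lm[OF _ _ t(3,4)] lm[OF _ _ t023 t123]
    then show "\<Phi> s a (inf x y) + \<Phi> s a (sup x y) = \<Phi> s a x + \<Phi> s a y"
      if "(x, y) \<in> {(inf p0 p2, inf p0 p3), (inf p1 p2, inf p1 p3), (inf p0 p2, inf p1 p2),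
        (inf p0 p3, inf p1 p3), (p2, p3), (inf p0 (inf p2 p3), inf p1 (inf p2 p3))}" for x y
      using that unfolding set_eqs rks by force
  qed

  define A0 A1 where "A0 = lev p0 0" and "A1 = lev p1 0"
  have st: "set_tight {0} A0" "set_tight {1} A1"
    using level_set_tight[OF _ t(1), of 0] level_set_tight[OF _ t(2), of 0] gam by (auto simp: A0_def A1_def)
  have A01: "A0 \<inter> A1 = lev T 0" unfolding A0_def A1_def T(1)[symmetric] lev_sup ..
  have A01u: "A0 \<union> A1 = lev q 0" unfolding A0_def A1_def q_def lev_inf ..
  have stT: "set_tight {} (lev T a)" if "0 \<le> a" "a < \<gamma>" for a
    using level_set_tight[OF _ tT that(1)] that(2) by auto
  \<comment> \<open>The violating set S is tight for the right indices but need not be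
    \<open>A0 \<union> A1\<close>. Intersecting it with two tight level sets, whose intersection is
    \<open>A0 \<union> A1\<close>, puts it inside that set, and adding A0 and A1 fills it up. Every
    step is modular.\<close>
  have st01: "set_tight {0, 1} (A0 \<union> A1)"
  proof -
    obtain S where S: "set_tight {0, 1} S" by (rule violating_set)
    have Q: "set_tight {0, 1, 2} (lev (inf q p2) 0)" "set_tight {0, 1, 3} (lev (inf q p3) 0)"
      using level_set_tight[OF _ t012, of 0] level_set_tight[OF _ t013, of 0] gam by auto
    have "set_tight {0, 1} (S \<inter> lev (inf q p2) 0)"
      by (rule set_tight_lattice(2)[OF S Q(1), of "{0, 1, 2}"]) (use rks in auto)
    then have "set_tight {0, 1} (S \<inter> lev (inf q p2) 0 \<inter> lev (inf q p3) 0)"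
      by (rule set_tight_lattice(2)[OF _ Q(2), of _ _ "{0, 1, 3}"]) (use rks in auto)
    then have "set_tight {0, 1} ((S \<inter> lev (inf q p2) 0 \<inter> lev (inf q p3) 0) \<union> A0)"
      by (rule set_tight_lattice(1)[OF _ st(1), of _ _ _ "{0}"]) (use rks in auto)
    then have "set_tight {0, 1} ((S \<inter> lev (inf q p2) 0 \<inter> lev (inf q p3) 0) \<union> A0 \<union> A1)"
      by (rule set_tight_lattice(1)[OF _ st(2), of _ _ _ "{1}"]) (use rks in auto)
    moreover have "lev (inf q p2) 0 \<inter> lev (inf q p3) 0 = A0 \<union> A1"
      unfolding A01u lev_sup[symmetric] q23 ..
    then have "(S \<inter> lev (inf q p2) 0 \<inter> lev (inf q p3) 0) \<union> A0 \<union> A1 = A0 \<union> A1" by blast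
    ultimately show ?thesis by simp
  qed
  define D where "D s a = \<Phi> s a p0 + \<Phi> s a p1 - \<Phi> s a T - \<Phi> s a q" for s a
  have D0: "D s 0 = layer_rank w s (elts A0) + layer_rank w s (elts A1) - layer_rank w s (elts (A0 \<inter> A1)) - layer_rank w s (elts (A0 \<union> A1))" for s
    unfolding D_def \<Phi>_def A01 A01u by (simp add: A0_def A1_def)
  have "(\<Sum>s\<in>w ` E. D s 0) = layered_rank w (elts A0) + layered_rank w (elts A1) - layered_rank w (elts (A0 \<inter> A1)) - layered_rank w (elts (A0 \<union> A1))"
    unfolding D0 by (simp add: layered_rank_def sum.distrib sum_subtractf)
  \<comment> \<open>The contributions of W cancel, which leaves 2 + 2 - 0 - 3.\<close>
  also have "\<dots> = 1"
  proof -
    have "card (A0 \<inter> W) + card (A1 \<inter> W) = card ((A0 \<union> A1) \<inter> W) + card ((A0 \<inter> A1) \<inter> W)"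
    proof -
      have "(A0 \<union> A1) \<inter> W = (A0 \<inter> W) \<union> (A1 \<inter> W)" "(A0 \<inter> A1) \<inter> W = (A0 \<inter> W) \<inter> (A1 \<inter> W)" by auto
      then show ?thesis using card_Un_Int[of "A0 \<inter> W" "A1 \<inter> W"] finW by simp
    qed
    moreover have "set_tight {} (A0 \<inter> A1)" using stT[of 0] gam by (simp add: A01)
    ultimately show ?thesis using st st01 rks by (simp add: set_tight_def)
  qed
  finally have "\<exists>s\<in>w ` E. 0 < D s 0"
    using sum_nonpos[of "w ` E" "\<lambda>s. D s 0"] by (metis not_less zero_less_one)
  then obtain s0 where "0 < D s0 0" by blast
  then have s0: "1 \<le> D s0 0" by linarith

  \<comment> \<open>Adding \<open>lev T a\<close> to A0 and A1 leaves their defect unchanged,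
    because every pair involved is modular. The enlarged sets lie in the level sets at a and have
    the same intersection, so the defect can only grow.\<close>
  have Da: "1 \<le> D s0 a" if a: "0 \<le> a" "a < \<gamma>" for a
  proof -
    let ?f = "\<lambda>S. layer_rank w s0 (elts S)"
    let ?T = "lev T a"
    have sub: "A0 \<subseteq> lev p0 a" "A1 \<subseteq> lev p1 a" "A0 \<inter> A1 \<subseteq> ?T"
      unfolding A01 using a by (auto simp: A0_def A1_def lev_def)
    have int: "lev p0 a \<inter> lev p1 a = ?T" unfolding T(1)[symmetric] lev_sup ..
    have "?f (A0 \<union> ?T) + ?f (A1 \<union> ?T) - ?f (lev p0 a \<inter> lev p1 a) - ?f ((A0 \<union> ?T) \<union> (A1 \<union> ?T))
      \<le> ?f (lev p0 a) + ?f (lev p1 a) - ?f (lev p0 a \<inter> lev p1 a) - ?f (lev p0 a \<union> lev p1 a)"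
    proof (rule submodular_defect_mono)
      show "?f (S \<union> T) + ?f (S \<inter> T) \<le> ?f S + ?f T" for S T
        unfolding elts_Un elts_Int by (rule layer_rank_submodular)
    qed (use sub int in auto)
    also have "\<dots> = D s0 a" unfolding D_def \<Phi>_def q_def lev_inf int by simp
    finally have le: "?f (A0 \<union> ?T) + ?f (A1 \<union> ?T) - ?f ?T - ?f ((A0 \<union> ?T) \<union> (A1 \<union> ?T)) \<le> D s0 a"
      unfolding int .
    have 0: "set_tight {} (A0 \<inter> ?T)" "?f (A0 \<union> ?T) + ?f (A0 \<inter> ?T) = ?f A0 + ?f ?T"
      using set_tight_lattice(2,3)[OF st(1) stT[OF a], of "{0}" "{}"] by auto
    have 1: "set_tight {} (A1 \<inter> ?T)" "?f (A1 \<union> ?T) + ?f (A1 \<inter> ?T) = ?f A1 + ?f ?T"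
      using set_tight_lattice(2,3)[OF st(2) stT[OF a], of "{1}" "{}"] by auto
    have 2: "?f ((A0 \<union> A1) \<union> ?T) + ?f ((A0 \<union> A1) \<inter> ?T) = ?f (A0 \<union> A1) + ?f ?T"
      using set_tight_lattice(3)[OF st01 stT[OF a], of "{0, 1}" "{}"] by auto
    have 3: "?f ((A0 \<inter> ?T) \<union> (A1 \<inter> ?T)) + ?f ((A0 \<inter> ?T) \<inter> (A1 \<inter> ?T)) = ?f (A0 \<inter> ?T) + ?f (A1 \<inter> ?T)"
      using set_tight_lattice(3)[OF 0(1) 1(1), of "{}" "{}"] by auto
    have "(A0 \<inter> ?T) \<union> (A1 \<inter> ?T) = (A0 \<union> A1) \<inter> ?T" "(A0 \<inter> ?T) \<inter> (A1 \<inter> ?T) = A0 \<inter> A1"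
      "(A0 \<union> ?T) \<union> (A1 \<union> ?T) = (A0 \<union> A1) \<union> ?T" using sub by auto
    then have "D s0 0 \<le> D s0 a" using le 0(2) 1(2) 2 3 unfolding D0 by simp
    then show ?thesis using s0 by linarith
  qed

  define K where "K p t = {e \<in> E. t \<le> reduced p e}" for p t
  have K_defect: "rk (K T t) + rk (K q t) \<le> rk (K p0 t) + rk (K p1 t)" for t
    using rk_submodular[of "K p0 t" "K p1 t"] union_thresholds[of t p0 p1]
    unfolding K_def q_def T(1) by simp
  \<comment> \<open>Restriction to weights at least s0 leaves only levels s - t that are
    nonnegative, where \<open>star\<close> is available. Contraction of the weights above s0 then
    isolates the layer s0, whose defect is known to be positive.\<close>
  have K_gap: "rk (K T t) + rk (K q t) + 1 \<le> rk (K p0 t) + rk (K p1 t)" if tr: "s0 - \<gamma> < t" "t \<le> s0" for t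
  proof -
    let ?L = "{e \<in> E. s0 \<le> w e}" and ?C = "{e \<in> E. s0 < w e}"
    define F where "F p = {e \<in> E. t \<le> reduced p e \<and> s0 \<le> w e}" for p
    have KL: "K p t \<inter> ?L = F p" for p by (auto simp: K_def F_def)
    have Kint: "K p0 t \<inter> K p1 t = K T t" and Kun: "K p0 t \<union> K p1 t = K q t"
      using union_thresholds[of t p0 p1] unfolding K_def q_def T(1) by simp_all
    obtain B Y where B: "B \<in> bases" "sum w B = max_weight w" "sum (reduced T) B = max_weight (reduced T)"
      by (rule tight_basis[OF _ tT]) auto
    \<comment> \<open>A basis that is optimal for w and for \<open>reduced T\<close> spans both
      sets, so they form a modular pair.\<close>
    have "rk (K T t \<union> ?L) + rk (K T t \<inter> ?L) = rk (K T t) + rk ?L"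
      unfolding K_def by (intro spans_modular[OF B(1)] max_basis_spans(1)[OF B(1)] B)
    then have 1: "rk (F p0) + rk (F p1) - rk (F T) - rk (F q) \<le> rk (K p0 t) + rk (K p1 t) - rk (K T t) - rk (K q t)"
      using restrict_defect_le[of "K p0 t" "K p1 t" ?L] unfolding Kint Kun KL by simp
    have rkF: "rk (F p) = (\<Sum>s\<in>{s\<in>w ` E. s0 \<le> s}. \<Phi> s (s - t) p)" if "I \<subseteq> {..<7}" "tight I p" for I p
      unfolding F_def \<Phi>_def by (rule threshold_rank[OF that])
    have 2: "rk (F p0) + rk (F p1) - rk (F T) = rk (F (inf q p2)) + rk (F (inf q p3)) - rk (F (inf q (inf p2 p3)))"
    proof -
      have "(\<Sum>s\<in>{s\<in>w ` E. s0 \<le> s}. \<Phi> s (s - t) p0 + \<Phi> s (s - t) p1 - \<Phi> s (s - t) T)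
          = (\<Sum>s\<in>{s\<in>w ` E. s0 \<le> s}. \<Phi> s (s - t) (inf q p2) + \<Phi> s (s - t) (inf q p3) - \<Phi> s (s - t) (inf q (inf p2 p3)))"
        using tr by (intro sum.cong refl star) auto
      then show ?thesis
        using rkF[OF _ t(1)] rkF[OF _ t(2)] rkF[OF _ tT] rkF[OF _ t012] rkF[OF _ t013] rkF[OF _ t0123]
        by (simp add: sum.distrib sum_subtractf)
    qed
    obtain B' Y' where B': "B' \<in> bases" "sum w B' = max_weight w" "sum (reduced (inf q (inf p2 p3))) B' = max_weight (reduced (inf q (inf p2 p3)))"
      by (rule tight_basis[OF _ t0123]) auto
    have Fun: "F (inf q p2) \<union> F (inf q p3) = F (inf q (inf p2 p3))"
      and Fint: "F (inf q p2) \<inter> F (inf q p3) = F q"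
      using union_thresholds[of t "inf q p2" "inf q p3"] unfolding q_inf q23 F_def by blast+
    have "rk (F (inf q (inf p2 p3)) \<union> ?C) + rk (F (inf q (inf p2 p3)) \<inter> ?C) = rk (F (inf q (inf p2 p3))) + rk ?C"
      unfolding F_def by (intro spans_modular[OF B'(1)] tight_spans(1)[OF B'] max_basis_spans(2)[OF B'(1,2)])
    then have 3: "rk (F (inf q p2) \<union> ?C) + rk (F (inf q p3) \<union> ?C) - rk (F (inf q (inf p2 p3)) \<union> ?C) - rk (F q \<union> ?C)
        \<le> rk (F (inf q p2)) + rk (F (inf q p3)) - rk (F (inf q (inf p2 p3))) - rk (F q)"
      using contract_defect_le[of "F (inf q p2)" "F (inf q p3)" ?C] unfolding Fun Fint by simp
    have FC: "rk (F p \<union> ?C) = \<Phi> s0 (s0 - t) p + rk ?C" for p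
    proof -
      have "F p \<union> ?C = ?C \<union> {e \<in> E \<inter> elts (lev p (s0 - t)). w e = s0}"
        using lab by (auto simp: F_def reduced_def elts_def lev_def)
      then show ?thesis by (simp add: \<Phi>_def layer_rank_def)
    qed
    have "1 \<le> D s0 (s0 - t)" using Da[of "s0 - t"] tr by simp
    then have "1 \<le> \<Phi> s0 (s0 - t) (inf q p2) + \<Phi> s0 (s0 - t) (inf q p3) - \<Phi> s0 (s0 - t) (inf q (inf p2 p3)) - \<Phi> s0 (s0 - t) q"
      using star[of "s0 - t" s0] tr unfolding D_def by simp
    then show ?thesis using 1 2 3 unfolding FC by linarith
  qed

  obtain c where c: "c \<ge> \<bar>s0\<bar> + \<gamma>" "\<forall>x\<in>set [reduced p0, reduced p1, reduced T, reduced q]. \<forall>e\<in>E. \<bar>x e\<bar> \<le> c"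
    using common_bound[of "\<bar>s0\<bar> + \<gamma>" "[reduced p0, reduced p1, reduced T, reduced q]"] by blast
  let ?R = "\<lambda>p t. real_of_int (rk (K p t))"
  have mi: "(?R p has_integral (max_weight (reduced p) + real r * c)) {-c..c}" if "reduced p \<in> set [reduced p0, reduced p1, reduced T, reduced q]" for p
    unfolding K_def using c(2) that by (intro max_weight_integral) blast
  have thr: "((\<lambda>t. (if t \<le> s0 then 1 else 0) - (if t \<le> s0 - \<gamma> then 1 else 0)) has_integral ((s0 + c) - (s0 - \<gamma> + c))) {-c..c}"
    by (intro has_integral_diff has_integral_threshold) (use c gam in auto)
  have "((\<lambda>t. (?R T t + ?R q t) + ((if t \<le> s0 then 1 else 0) - (if t \<le> s0 - \<gamma> then 1 else 0))) has_integral
      ((max_weight (reduced T) + real r * c) + (max_weight (reduced q) + real r * c) + ((s0 + c) - (s0 - \<gamma> + c)))) {-c..c}"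
    by (intro has_integral_add mi thr) auto
  moreover have "((\<lambda>t. ?R p0 t + ?R p1 t) has_integral
      ((max_weight (reduced p0) + real r * c) + (max_weight (reduced p1) + real r * c))) {-c..c}"
    by (intro has_integral_add mi) auto
  ultimately have "(max_weight (reduced T) + real r * c) + (max_weight (reduced q) + real r * c) + ((s0 + c) - (s0 - \<gamma> + c))
      \<le> (max_weight (reduced p0) + real r * c) + (max_weight (reduced p1) + real r * c)"
  proof (rule has_integral_le)
    fix t
    show "(?R T t + ?R q t) + ((if t \<le> s0 then 1 else 0) - (if t \<le> s0 - \<gamma> then 1 else 0)) \<le> ?R p0 t + ?R p1 t"
      using K_gap[of t] K_defect[of t] gam by auto
  qed
  then have max_weight: "max_weight (reduced T) + max_weight (reduced q) + \<gamma> \<le> max_weight (reduced p0) + max_weight (reduced p1)" by simp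
  have "sum p0 W + sum p1 W = sum q W + sum T W"
    unfolding q_def T(1)[symmetric] sum.distrib[symmetric] by (intro sum.cong) (auto simp: inf_min sup_max)
  moreover have "max_weight (reduced p0) + sum p0 W \<le> opt - \<gamma> * 2" "max_weight (reduced p1) + sum p1 W \<le> opt - \<gamma> * 2"
    using t(1,2) rks by (auto simp: tight_def)
  moreover have "opt - \<gamma> * 4 \<le> max_weight (reduced T) + sum T W"
    using tight_lower[of "{}" T] tT rks by (simp add: tight_def)
  \<comment> \<open>2 * (opt - 2 * \<gamma>) - (opt - 4 * \<gamma>) - \<gamma> = opt -
    \<gamma>.\<close>
  ultimately have fin: "max_weight (reduced q) + sum q W \<le> opt - \<gamma>" using max_weight by linarith
  have X: "P 0 \<union> P 1 \<subseteq> V" using pair_sub[of 0] pair_sub[of 1] by simp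
  have "card Z = r"
    using card_image[OF Z(2)] Z(3) card_VW[OF X] card_two_pairs[of 0 1] fin_pair rank_eq by simp
  then have "Z \<in> bases" using Z(1) by (simp add: bases_def)
  then have "sum (reduced q) Z \<le> max_weight (reduced q)" by (rule max_weight_ge)
  moreover have "sum (reduced q) Z = sum w Z - sum q (P 0 \<union> P 1) - sum q W"
    by (rule sum_reduced[OF Z(2,3) X])
  moreover have "sum q (P 0 \<union> P 1) \<le> 0"
  proof (rule sum_nonpos)
    fix v assume v: "v \<in> P 0 \<union> P 1"
    then have "v \<in> V" using X by blast
    then show "q v \<le> 0"
      using t(1,2) v unfolding tight_def on_pairs_def q_def U_def by (auto simp: inf_min min_le_iff_disj)
  qed
  ultimately show ?thesis using fin by linarith
qed

end

text \<open>Non-special sets attain the bound opt of a dual potential, so each of them maximizes the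
  potential among 4-sets. This forces it to be constant on V, and subtracting it from w gives a
  normalized representation.\<close>

lemma (in pairs) distinguished_value_bound:
  fixes l :: "'a \<Rightarrow> 'b" and w :: "'a \<Rightarrow> real" and F :: "'b set \<Rightarrow> real"
    and opt \<gamma> :: real
  assumes mat: "matroid E \<I>" and lab: "l ` E \<subseteq> V \<union> W" and gam: "0 < \<gamma>"
    and attained: "\<And>Y. Y \<subseteq> V \<Longrightarrow> card Y = 4 \<Longrightarrow> \<exists>Z\<in>\<I>. inj_on l Z \<and> l ` Z = Y \<union> W \<and> sum w Z = F Y"
    and upper: "\<And>Y Z. Y \<subseteq> V \<Longrightarrow> card Y = 4 \<Longrightarrow> Z \<in> \<I> \<Longrightarrow> inj_on l Z \<Longrightarrow> l ` Z = Y \<union> W \<Longrightarrow> sum w Z \<le> F Y"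
    and opt: "\<And>Y. Y \<subseteq> V \<Longrightarrow> card Y = 4 \<Longrightarrow> \<not> special Y \<Longrightarrow> F Y = opt"
    and low: "\<And>i j. i < 7 \<Longrightarrow> j < 7 \<Longrightarrow> i \<noteq> j \<Longrightarrow> {i, j} \<noteq> {2, 3} \<Longrightarrow> {i, j} \<noteq> {0, 1} \<Longrightarrow> F (P i \<union> P j) \<le> opt - \<gamma>"
    and dist: "F (P 0 \<union> P 1) < opt"
  shows "F (P 0 \<union> P 1) \<le> opt - \<gamma>"
proof -
  define r where "r = 4 + card W"
  define \<J> where "\<J> = {X \<in> \<I>. card X \<le> r}"
  have card_r: "card Z = r" if "Y \<subseteq> V" "card Y = 4" "inj_on l Z" "l ` Z = Y \<union> W" for Y Z
  proof -
    have "finite Y" using that(1) finV finite_subset by blast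
    then have "card (Y \<union> W) = r" using that(1,2) finW VW card_Un_disjoint[of Y W] by (auto simp: r_def)
    then show ?thesis using card_image[OF that(3)] that(4) by simp
  qed
  have P01: "P 0 \<union> P 1 \<subseteq> V" "card (P 0 \<union> P 1) = 4"
    using pair_sub[of 0] pair_sub[of 1] card_two_pairs[of 0 1] by auto
  interpret labelled_matroid P W V E \<J> r l
  proof
    show "matroid E \<J>" unfolding \<J>_def by (rule matroid_truncation[OF mat])
    obtain Z where Z: "Z \<in> \<I>" "inj_on l Z" "l ` Z = (P 0 \<union> P 1) \<union> W" using attained[OF P01] by blast
    then show "\<exists>X\<in>\<J>. card X = r" using card_r[OF P01 Z(2,3)] by (auto simp: \<J>_def)
  qed (use lab in \<open>auto simp: \<J>_def r_def\<close>)
  have bases_iff: "Z \<in> bases \<longleftrightarrow> Z \<in> \<I> \<and> card Z = r" for Z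
    unfolding bases_def by (auto simp: \<J>_def)
  have basesI: "Z \<in> bases" if "Y \<subseteq> V" "card Y = 4" "inj_on l Z" "l ` Z = Y \<union> W" "Z \<in> \<I>" for Y Z
    using card_r[OF that(1-4)] that(5) by (simp add: bases_iff)
  have F_le: "F Y \<le> opt" if "Y \<subseteq> V" "card Y = 4" for Y
  proof (cases "special Y")
    case True
    then obtain i j where ij: "i < 7" "j < 7" "i \<noteq> j" "{i, j} \<noteq> {2, 3}" "Y = P i \<union> P j"
      unfolding special_def by blast
    show ?thesis
    proof (cases "{i, j} = {0, 1}")
      case True
      then have "Y = P 0 \<union> P 1" using ij(5) by (auto simp: doubleton_eq_iff)
      then show ?thesis using dist by simp
    next
      case False
      then show ?thesis using low[OF ij(1-4)] ij(5) gam by simp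
    qed
  qed (use opt that in simp)
  have "\<exists>p. \<forall>Z\<in>bases. \<forall>Y\<subseteq>V. card Y = 4 \<longrightarrow> sum w Z - (\<Sum>e\<in>Z. p (l e)) + sum p Y + sum p W \<le> opt"
  proof (rule dual)
    fix Z Y assume "Z \<in> bases" "inj_on l Z" "l ` Z = Y \<union> W" "Y \<subseteq> V" "card Y = 4"
    then show "sum w Z \<le> opt" using upper[of Y Z] F_le[of Y] by (force simp: bases_iff)
  qed
  then obtain p where p: "\<And>Z Y. Z \<in> bases \<Longrightarrow> Y \<subseteq> V \<Longrightarrow> card Y = 4 \<Longrightarrow>
      sum w Z - (\<Sum>e\<in>Z. p (l e)) + sum p Y + sum p W \<le> opt" by blast
  note sump = sum_labels[of _ _ p]
  have max: "sum p Y' \<le> sum p Y" if Y: "Y \<subseteq> V" "card Y = 4" "\<not> special Y" and Y': "Y' \<subseteq> V" "card Y' = 4" for Y Y'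
  proof -
    obtain Z where Z: "Z \<in> \<I>" "inj_on l Z" "l ` Z = Y \<union> W" "sum w Z = F Y" using attained[OF Y(1,2)] by blast
    have "sum w Z = opt" using Z(4) opt[OF Y] by simp
    then show ?thesis using p[OF basesI[OF Y(1,2) Z(2,3,1)] Y'] sump[OF Z(2,3) Y(1)] by simp
  qed
  have le: "p x \<le> p y" if x: "x \<in> V" and y: "y \<in> V" for x y
  proof -
    obtain i j where i: "i < 7" "x \<in> P i" and j: "j < 7" "y \<in> P j" using x y V_eq by auto
    \<comment> \<open>With one element from each of three pairs containing neither x nor y, adding x
      or y gives two non-special 4-sets that differ only in x and y. The seven pairs leave enough
      room.\<close>
    have fresh: "\<exists>k<7. k \<notin> set ks" if "length ks \<le> 4" for ks :: "nat list"
    proof (rule ccontr)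
      assume "\<not> ?thesis"
      then have "{..<7} \<subseteq> set ks" by auto
      then have "7 \<le> card (set ks)" using card_mono[of "set ks" "{..<7}"] by simp
      then show False using card_length[of ks] that by simp
    qed
    obtain k where k: "k < 7" "k \<noteq> i" "k \<noteq> j" using fresh[of "[i, j]"] by auto
    obtain m where m: "m < 7" "m \<noteq> i" "m \<noteq> j" "m \<noteq> k" using fresh[of "[i, j, k]"] by auto
    obtain n where n: "n < 7" "n \<noteq> i" "n \<noteq> j" "n \<noteq> k" "n \<noteq> m" using fresh[of "[i, j, k, m]"] by auto
    obtain a b c where abc: "a \<in> P k" "b \<in> P m" "c \<in> P n"
      using pair_elems[OF k(1)] pair_elems[OF m(1)] pair_elems[OF n(1)] by blast
    have ne: "a \<noteq> b" "a \<noteq> c" "b \<noteq> c" "x \<notin> {a, b, c}" "y \<notin> {a, b, c}"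
      using abc i j k m n disj_pairs[of k m] disj_pairs[of k n] disj_pairs[of m n]
        disj_pairs[of i k] disj_pairs[of i m] disj_pairs[of i n]
        disj_pairs[of j k] disj_pairs[of j m] disj_pairs[of j n]
      by (simp_all add: disjoint_iff) metis+
    have ns: "\<not> special {z, a, b, c}" for z
      by (rule three_pairs_not_special[of a _ b c k m n]) (use abc k m n in auto)
    have sub: "{a, b, c} \<subseteq> V"
      using abc k m n pair_sub[of k] pair_sub[of m] pair_sub[of n] by auto
    have "sum p {x, a, b, c} \<le> sum p {y, a, b, c}"
      by (rule max) (use ns sub x y ne in auto)
    then show ?thesis using ne by simp
  qed
  define \<kappa> where "\<kappa> = p (SOME x. x \<in> V)"
  have const: "p x = \<kappa>" if "x \<in> V" for x
    using le that someI[of "\<lambda>x. x \<in> V" x] unfolding \<kappa>_def by (meson order_antisym)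
  have sum4: "sum p Y = 4 * \<kappa>" if "Y \<subseteq> V" "card Y = 4" for Y
  proof -
    have "sum p Y = (\<Sum>v\<in>Y. \<kappa>)" by (intro sum.cong refl const) (use that in auto)
    then show ?thesis using that by simp
  qed
  define w0 where "w0 e = w e - p (l e)" for e
  define opt0 where "opt0 = opt - 4 * \<kappa> - sum p W"
  have sumw0: "sum w0 Z = sum w Z - 4 * \<kappa> - sum p W"
    if "inj_on l Z" "l ` Z = Y \<union> W" "Y \<subseteq> V" "card Y = 4" for Z Y
    using sump[OF that(1-3)] sum4[OF that(3,4)] by (simp add: w0_def sum_subtractf)
  interpret normalized_rep P W V E \<J> r l w0 opt0 \<gamma>
  proof
    fix Y assume Y: "Y \<subseteq> V" "card Y = 4" "\<not> special Y"
    obtain Z where Z: "Z \<in> \<I>" "inj_on l Z" "l ` Z = Y \<union> W" "sum w Z = F Y" using attained[OF Y(1,2)] by blast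
    then have "Z \<in> \<J>" using card_r[OF Y(1,2) Z(2,3)] by (simp add: \<J>_def)
    then show "\<exists>Z\<in>\<J>. inj_on l Z \<and> l ` Z = Y \<union> W \<and> sum w0 Z = opt0"
      using Z sumw0[OF Z(2,3) Y(1,2)] opt[OF Y] by (intro bexI[of _ Z]) (auto simp: opt0_def)
  next
    fix Z assume "Z \<in> bases"
    then show "sum w0 Z \<le> opt0" using p[of Z, OF _ P01] sum4[OF P01] by (simp add: w0_def sum_subtractf opt0_def)
  next
    fix i j Z assume *: "i < 7" "j < 7" "i \<noteq> j" "{i, j} \<noteq> {2, 3}" "{i, j} \<noteq> {0, 1}" "Z \<in> \<J>" "inj_on l Z"
      "l ` Z = P i \<union> P j \<union> W"
    have Pij: "P i \<union> P j \<subseteq> V" "card (P i \<union> P j) = 4"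
      using pair_sub card_two_pairs * by auto
    then show "sum w0 Z \<le> opt0 - \<gamma>"
      using sumw0[OF *(7,8) Pij] upper[OF Pij _ *(7,8)] low[OF *(1-5)] *(6) by (simp add: \<J>_def opt0_def)
  next
    fix Z assume *: "Z \<in> \<J>" "inj_on l Z" "l ` Z = P 0 \<union> P 1 \<union> W"
    then show "sum w0 Z < opt0"
      using sumw0[OF *(2,3) P01] upper[OF P01 _ *(2,3)] dist by (simp add: \<J>_def opt0_def)
  qed (rule gam)
  obtain Z where Z: "Z \<in> \<I>" "inj_on l Z" "l ` Z = P 0 \<union> P 1 \<union> W" "sum w Z = F (P 0 \<union> P 1)"
    using attained[OF P01] by blast
  then have "Z \<in> \<J>" using card_r[OF P01 Z(2,3)] by (simp add: \<J>_def)
  then have "sum w0 Z \<le> opt0 - \<gamma>" using distinguished_loss Z by blast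
  then show ?thesis using sumw0[OF Z(2,3) P01] Z(4) by (simp add: opt0_def)
qed

section \<open>Sparse paving valuations\<close>

text \<open>The concave term is never decreased by the exchanges. Penalized d-sets differ pairwise
  in at least two elements, so on each side at most one exchange element leads to a penalized set.
  The bound \<open>2 * m \<le> K\<close> covers the case of sizes d - 1 and d + 1.\<close>

lemma sparse_paving_valuated_gmatroid:
  fixes pen :: "'a set \<Rightarrow> real"
  assumes fin: "finite V" and d: "0 < d"
    and card_H: "\<And>A. A \<in> H \<Longrightarrow> card A = d"
    and sparse: "\<And>A B. A \<in> H \<Longrightarrow> B \<in> H \<Longrightarrow> A \<noteq> B \<Longrightarrow> card (A \<inter> B) + 1 < d"
    and pen: "\<And>A. 0 \<le> pen A" "\<And>A. pen A \<le> m" "\<And>A. A \<notin> H \<Longrightarrow> pen A = 0"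
    and K: "2 * m \<le> K"
  defines "f \<equiv> \<lambda>X. ereal (K * real (min (card X) d) - pen X)"
  shows "valuated_gmatroid V f"
proof -
  have m0: "0 \<le> m" using pen(1)[of "{}"] pen(2)[of "{}"] by linarith
  then have K0: "0 \<le> K" using K by simp
  define g where "g X = K * real (min (card X) d) - pen X" for X :: "'a set"
  have f: "f X = ereal (g X)" for X by (simp add: f_def g_def)
  have pen_card: "pen A = 0" if "card A \<noteq> d" for A using that card_H pen(3) by blast
  have add_unique: "x = y" if "insert x S \<in> H" "insert y S \<in> H" "x \<notin> S" "y \<notin> S" "finite S" for x y S
  proof (rule ccontr)
    assume "x \<noteq> y"
    then have "insert x S \<inter> insert y S = S" "insert x S \<noteq> insert y S" using that by auto
    then show False using sparse[OF that(1,2)] card_H[OF that(1)] that by simp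
  qed
  have del_unique: "x = y" if "S - {x} \<in> H" "S - {y} \<in> H" "x \<in> S" "y \<in> S" "finite S" for x y S
  proof (rule ccontr)
    assume ne: "x \<noteq> y"
    have eq: "insert y (S - {x} - {y}) = S - {x}" "insert x (S - {x} - {y}) = S - {y}" using that ne by auto
    have "y = x" by (rule add_unique[of y "S - {x} - {y}" x]) (simp_all only: eq that finite_Diff, simp_all)
    then show False using ne by simp
  qed
  have one: "\<exists>j\<in>Y - X. g X + g Y \<le> g (insert j X) + g (Y - {j})"
    if XY: "X \<subseteq> V" "Y \<subseteq> V" "card X < card Y" for X Y
  proof -
    have finX: "finite X" "finite Y" using XY fin finite_subset by blast+
    have "\<not> Y \<subseteq> X" using card_mono[OF finX(1), of Y] XY(3) by auto
    then obtain i where i: "i \<in> Y" "i \<notin> X" by blast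
    have cards: "card (insert j X) = Suc (card X)" "card (Y - {j}) = card Y - 1" if "j \<in> Y - X" for j
      using that finX by auto
    have gain: "K * real (min (card X) d) + K * real (min (card Y) d)
        \<le> K * real (min (card (insert j X)) d) + K * real (min (card (Y - {j})) d)" if "j \<in> Y - X" for j
    proof -
      have "min (card X) d + min (card Y) d \<le> min (Suc (card X)) d + min (card Y - 1) d"
        using XY(3) by (auto simp: min_def)
      then have "K * real (min (card X) d + min (card Y) d) \<le> K * real (min (Suc (card X)) d + min (card Y - 1) d)"
        using K0 by (intro mult_left_mono) simp_all
      then show ?thesis using cards[OF that] by (simp add: distrib_left)
    qed
    have good: ?thesis if "j \<in> Y - X" "pen (insert j X) + pen (Y - {j}) \<le> pen X + pen Y" for j
      using that gain[OF that(1)] by (intro bexI[of _ j]) (auto simp: g_def)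
    have whole: ?thesis if only: "Y - X = {i}"
    proof -
      have "card Y \<le> card (insert i (Y \<inter> X))" using only finX by (intro card_mono) auto
      also have "\<dots> \<le> Suc (card (Y \<inter> X))" using finX by (simp add: card_insert_if)
      finally have "card X \<le> card (Y \<inter> X)" using XY(3) by linarith
      then have "Y \<inter> X = X" using finX card_mono[of X "Y \<inter> X"] by (intro card_subset_eq) auto
      then have "insert i X = Y" "Y - {i} = X" using only i by auto
      then show ?thesis using i by (intro bexI[of _ i]) auto
    qed
    consider "Y - X = {i}" | j where "j \<in> Y - X" "j \<noteq> i" using i by blast
    then show ?thesis
    proof cases
      case 1
      then show ?thesis by (rule whole)
    next
      case (2 j)
      show ?thesis
      proof (cases "Suc (card X) = d")
        case eX: True
        show ?thesis
        \<comment> \<open>In this case both new sets have size d and both may be penalized, but the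
          concave term gains K.\<close>
        proof (cases "card Y = Suc d")
          case True
          have "min (card X) d = d - 1" "min (card Y) d = d" "min (card (insert i X)) d = d" "min (card (Y - {i})) d = d"
            using eX True cards[of i] i by auto
          moreover have "real (d - 1) = real d - 1" using d by (simp add: of_nat_diff)
          ultimately have "g (insert i X) + g (Y - {i}) - (g X + g Y)
              = K - pen (insert i X) - pen (Y - {i}) + pen X + pen Y"
            by (simp add: g_def algebra_simps)
          moreover have "pen (insert i X) \<le> m" "pen (Y - {i}) \<le> m" "0 \<le> pen X" "0 \<le> pen Y" using pen by blast+
          ultimately show ?thesis using K i by (intro bexI[of _ i]) auto
        next
          case False
          \<comment> \<open>Now a deletion from Y never has size d, so only the insertions into X
            can be penalized, and at most one of the two is.\<close>
          have "insert i X \<notin> H \<or> insert j X \<notin> H" using add_unique[of i X j] 2 i finX by blast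
          moreover have "pen (Y - {k}) = 0" if "k \<in> Y - X" for k
            using pen_card[of "Y - {k}"] cards(2)[OF that] False XY(3) by simp
          ultimately show ?thesis using good[of i] good[of j] pen(1)[of X] pen(1)[of Y] pen(3) 2 i
            by (metis DiffI add.right_neutral add_nonneg_nonneg)
        qed
      next
        case nX: False
        then have p1: "pen (insert k X) = 0" if "k \<in> Y - X" for k
          using pen_card[of "insert k X"] cards(1)[OF that] by simp
        have "Y - {i} \<notin> H \<or> Y - {j} \<notin> H" using del_unique[of Y i j] 2 i finX by blast
        then show ?thesis using good[of i] good[of j] p1[of i] p1[of j] pen(1)[of X] pen(1)[of Y] pen(3) 2 i
          by (metis DiffI add.right_neutral add_nonneg_nonneg)
      qed
    qed
  qed
  have two: "\<exists>j\<in>Y - X. g X + g Y \<le> g (insert j (X - {i})) + g (insert i Y - {j})"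
    if XY: "X \<subseteq> V" "Y \<subseteq> V" "card X = card Y" and i: "i \<in> X - Y" for X Y i
  proof -
    have finX: "finite X" "finite Y" using XY fin finite_subset by blast+
    have cards: "card (insert j (X - {i})) = card X" "card (insert i Y - {j}) = card Y" if "j \<in> Y - X" for j
      using that i finX card_gt_0_iff[of X] by auto
    have geq: "g (insert j (X - {i})) + g (insert i Y - {j})
        = g X + g Y + (pen X + pen Y) - (pen (insert j (X - {i})) + pen (insert i Y - {j}))" if "j \<in> Y - X" for j
      using cards[OF that] by (simp add: g_def)
    have good: ?thesis if "j \<in> Y - X" "pen (insert j (X - {i})) + pen (insert i Y - {j}) \<le> pen X + pen Y" for j
      using that geq[OF that(1)] by (intro bexI[of _ j]) auto
    have free: ?thesis if "j \<in> Y - X" "insert j (X - {i}) \<notin> H" "insert i Y - {j} \<notin> H" for j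
      using good[OF that(1)] pen(3)[OF that(2)] pen(3)[OF that(3)] pen(1)[of X] pen(1)[of Y] by simp
    have "\<not> Y \<subseteq> X" using card_subset_eq[OF finX(1), of Y] XY(3) i by auto
    then obtain j where j: "j \<in> Y - X" by blast
    show ?thesis
    proof (cases "Y - X = {j}")
      case True
      have "card (X - Y) = card (Y - X)"
        using XY(3) card_Diff_subset_Int[of X Y] card_Diff_subset_Int[of Y X] finX by (simp add: Int_commute)
      then have "card (X - Y) = 1" using True by simp
      then have "X - Y = {i}" using i by (metis card_1_singletonE singletonD)
      then have "insert j (X - {i}) = Y" "insert i Y - {j} = X" using True i j by auto
      then show ?thesis using j by (intro bexI[of _ j]) auto
    next
      case False
      then obtain j' where j': "j' \<in> Y - X" "j' \<noteq> j" using j by blast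
      have u1: "x = y" if "x \<in> Y - X" "y \<in> Y - X" "insert x (X - {i}) \<in> H" "insert y (X - {i}) \<in> H" for x y
        using add_unique[OF that(3,4)] that(1,2) finX by simp
      have u2: "x = y" if "x \<in> Y - X" "y \<in> Y - X" "insert i Y - {x} \<in> H" "insert i Y - {y} \<in> H" for x y
        using del_unique[OF that(3,4)] that(1,2) finX by simp
      show ?thesis
      proof (rule ccontr)
        assume no: "\<not> ?thesis"
        have bad: "insert x (X - {i}) \<in> H \<or> insert i Y - {x} \<in> H" if "x \<in> Y - X" for x
          using free[OF that] no by blast
        \<comment> \<open>If a is blocked on one side and b on the other, uniqueness leaves no third
          element in \<open>Y - X\<close>. The two penalized sets then share \<open>Y - {b}\<close>,
          which is one element too many for sparseness.\<close>
        have main: False if ab: "a \<in> Y - X" "b \<in> Y - X" "a \<noteq> b" and A: "insert a (X - {i}) \<in> H" and B: "insert i Y - {b} \<in> H" for a b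
        proof -
          have "Y - X \<subseteq> {a, b}"
          proof
            fix x assume x: "x \<in> Y - X"
            then show "x \<in> {a, b}" using bad[OF x] u1[OF x ab(1) _ A] u2[OF x ab(2) _ B] by blast
          qed
          then have sub: "Y - {b} \<subseteq> insert a (X - {i}) \<inter> (insert i Y - {b})" using ab i by auto
          have "card Y = d" using card_H[OF B] cards(2)[OF ab(2)] by simp
          then have "card (Y - {b}) = d - 1" using ab finX by simp
          then have "d - 1 \<le> card (insert a (X - {i}) \<inter> (insert i Y - {b}))"
            using card_mono[OF _ sub] finX by simp
          moreover have "i \<notin> insert a (X - {i})" "i \<in> insert i Y - {b}" using i ab by auto
          then have "insert a (X - {i}) \<noteq> insert i Y - {b}" by metis
          ultimately show False using sparse[OF A B] by simp
        qed
        have ne: "j \<noteq> j'" using j'(2) by simp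
        show False
        proof (cases "insert j (X - {i}) \<in> H")
          case True
          then have "insert i Y - {j'} \<in> H" using bad[OF j'(1)] u1[OF j j'(1) True] ne by blast
          then show False by (rule main[OF j j'(1) ne True])
        next
          case False
          then have del: "insert i Y - {j} \<in> H" using bad[OF j] by blast
          then have "insert j' (X - {i}) \<in> H" using bad[OF j'(1)] u2[OF j j'(1) del] ne by blast
          then show False using main[OF j'(1) j j'(2)] del by blast
        qed
      qed
    qed
  qed
  show ?thesis
    unfolding valuated_gmatroid_def
  proof (intro conjI allI impI ballI)
    fix X Y assume "X \<subseteq> V" "Y \<subseteq> V" "card X < card Y"
    then obtain j where "j \<in> Y - X" "g X + g Y \<le> g (insert j X) + g (Y - {j})" using one by blast
    then show "f X + f Y \<le> (SUP j\<in>Y - X. f (insert j X) + f (Y - {j}))"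
      by (intro SUP_upper2[of j]) (auto simp: f)
  next
    fix X Y i assume "X \<subseteq> V" "Y \<subseteq> V" "card X = card Y" "i \<in> X - Y"
    then obtain j where "j \<in> Y - X" "g X + g Y \<le> g (insert j (X - {i})) + g (insert i Y - {j})" using two by blast
    then show "f X + f Y \<le> (SUP j\<in>Y - X. f (insert j (X - {i})) + f (insert i Y - {j}))"
      by (intro SUP_upper2[of j]) (auto simp: f)
  qed (auto simp: fin f)
qed

lemma sparse_paving_monotone:
  fixes pen :: "'a set \<Rightarrow> real"
  assumes fin: "finite V"
    and pen: "\<And>A. 0 \<le> pen A" "\<And>A. pen A \<le> m" "\<And>A. card A \<noteq> d \<Longrightarrow> pen A = 0"
    and K: "m \<le> K"
  shows "monotone_setfun V (\<lambda>X. ereal (K * real (min (card X) d) - pen X))"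
  unfolding monotone_setfun_def
proof (intro allI impI)
  fix X Y assume *: "X \<subseteq> Y \<and> Y \<subseteq> V"
  have finY: "finite Y" using * fin finite_subset by blast
  have K0: "0 \<le> K" using pen(1)[of "{}"] pen(2)[of "{}"] K by linarith
  have le: "K * real (min (card X) d) \<le> K * real (min (card Y) d)"
    using card_mono[OF finY, of X] * K0 by (intro mult_left_mono) auto
  have "K * real (min (card X) d) - pen X \<le> K * real (min (card Y) d) - pen Y"
  proof (cases "X = Y \<or> card Y \<noteq> d")
    case True
    then show ?thesis using le pen(1)[of X] pen(3)[of Y] by auto
  next
    case False
    then have lt: "card X < d" using * psubset_card_mono[OF finY, of X] by auto
    then have "K * real (Suc (card X)) \<le> K * real d" using K0 by (intro mult_left_mono) auto
    then have "K * real (card X) + K \<le> K * real d" by (simp add: distrib_left)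
    then show ?thesis using lt False pen(1)[of X] pen(2)[of Y] K by simp
  qed
  then show "ereal (K * real (min (card X) d) - pen X) \<le> ereal (K * real (min (card Y) d) - pen Y)" by simp
qed

text \<open>Among all bases X containing I and Y containing J take a pair with largest intersection.
  Maximality and the exchange property force \<open>X - Y \<subseteq> I\<close>. If I had no
  augmentation from J, then \<open>J \<inter> X \<subseteq> I\<close>, and counting the differences
  contradicts \<open>card I < card J\<close>.\<close>

lemma matroid_of_bases:
  assumes fin: "finite U" and B: "\<B> \<subseteq> Pow U" "\<B> \<noteq> {}" "\<And>X. X \<in> \<B> \<Longrightarrow> card X = r"
    and exch: "\<And>X Y i. X \<in> \<B> \<Longrightarrow> Y \<in> \<B> \<Longrightarrow> i \<in> X - Y \<Longrightarrow> \<exists>j\<in>Y - X. insert j (X - {i}) \<in> \<B>"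
  shows "matroid U {I. \<exists>X\<in>\<B>. I \<subseteq> X}"
  unfolding matroid_def
proof (intro conjI ballI allI impI)
  fix I J assume I: "I \<in> {I. \<exists>X\<in>\<B>. I \<subseteq> X}" and J: "J \<in> {I. \<exists>X\<in>\<B>. I \<subseteq> X}" and lt: "card I < card J"
  let ?S = "{(X, Y). X \<in> \<B> \<and> Y \<in> \<B> \<and> I \<subseteq> X \<and> J \<subseteq> Y}"
  have finU: "finite X" if "X \<in> \<B>" for X using that B(1) fin finite_subset by blast
  obtain XY where XY: "XY \<in> ?S" "\<forall>Z. Z \<in> ?S \<longrightarrow> card (fst Z \<inter> snd Z) \<le> card (fst XY \<inter> snd XY)"
  proof -
    obtain Z0 where Z0: "Z0 \<in> ?S" using I J by auto
    have bnd: "\<forall>Z. Z \<in> ?S \<longrightarrow> card (fst Z \<inter> snd Z) < Suc (card U)"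
    proof (intro allI impI)
      fix Z assume "Z \<in> ?S"
      then have "fst Z \<inter> snd Z \<subseteq> U" using B(1) by fastforce
      from card_mono[OF fin this] show "card (fst Z \<inter> snd Z) < Suc (card U)" by simp
    qed
    show ?thesis
      using ex_has_greatest_nat[of "\<lambda>Z. Z \<in> ?S", OF Z0 bnd] that by blast
  qed
  obtain X Y where eq: "XY = (X, Y)" by (cases XY)
  have X: "X \<in> \<B>" "Y \<in> \<B>" "I \<subseteq> X" "J \<subseteq> Y" using XY(1) eq by auto
  show "\<exists>j\<in>J - I. insert j I \<in> {I. \<exists>X\<in>\<B>. I \<subseteq> X}"
  proof (rule ccontr)
    assume no: "\<not> ?thesis"
    have JX: "J \<inter> X \<subseteq> I" using no X(1,3) by blast
    have "X - Y \<subseteq> I"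
    proof
      fix i assume i: "i \<in> X - Y"
      show "i \<in> I"
      proof (rule ccontr)
        assume nI: "i \<notin> I"
        obtain j where j: "j \<in> Y - X" "insert j (X - {i}) \<in> \<B>" using exch[OF X(1,2) i] by blast
        have "(insert j (X - {i}), Y) \<in> ?S" using j X nI by auto
        then have "card (insert j (X - {i}) \<inter> Y) \<le> card (X \<inter> Y)" using XY(2) eq by fastforce
        moreover have "insert j (X - {i}) \<inter> Y = insert j (X \<inter> Y)" using i j by auto
        ultimately show False using j finU[OF X(1)] by simp
      qed
    qed
    have finI: "finite I" "finite J" using X finU finite_subset by blast+
    have "X - Y \<subseteq> I - J" using \<open>X - Y \<subseteq> I\<close> X by auto
    then have "card (X - Y) \<le> card (I - J)" using finI by (intro card_mono) auto
    moreover have "J - I \<subseteq> Y - X" using JX X by auto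
    then have "card (J - I) \<le> card (Y - X)" using finU[OF X(2)] by (intro card_mono) auto
    moreover have "card (X - Y) = card (Y - X)"
      using card_Diff_subset_Int[of X Y] card_Diff_subset_Int[of Y X] finU[OF X(1)] finU[OF X(2)] B(3)[OF X(1)] B(3)[OF X(2)]
      by (simp add: Int_commute)
    ultimately have "card (J - I) \<le> card (I - J)" by simp
    moreover have "card I = card (I - J) + card (I \<inter> J)" "card J = card (J - I) + card (I \<inter> J)"
      using card_Int_Diff[of I J] card_Int_Diff[of J I] finI by (simp_all add: Int_commute)
    ultimately show False using lt by simp
  qed
next
  fix I J assume "I \<in> {I. \<exists>X\<in>\<B>. I \<subseteq> X}" "J \<subseteq> I"
  then show "J \<in> {I. \<exists>X\<in>\<B>. I \<subseteq> X}" by blast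
qed (use B fin in auto)

lemma gmatroid_exchange:
  assumes "gmatroid U \<I>" "X \<in> \<I>" "Y \<in> \<I>" "card X = card Y" "i \<in> X - Y"
  shows "\<exists>j\<in>Y - X. insert j (X - {i}) \<in> \<I>"
proof (rule ccontr)
  assume no: "\<not> ?thesis"
  obtain g where g: "valuated_gmatroid U g" "\<forall>X\<subseteq>U. g X \<in> {0, -\<infinity>}" "\<I> = {I. I \<subseteq> U \<and> g I = 0}"
    using assms(1) unfolding gmatroid_def by blast
  have XY: "X \<subseteq> U" "Y \<subseteq> U" "g X = 0" "g Y = 0" using assms g(3) by auto
  have "g X + g Y \<le> (SUP j\<in>Y - X. g (insert j (X - {i})) + g (insert i Y - {j}))"
    using g(1) XY(1,2) assms(4,5) unfolding valuated_gmatroid_def by blast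
  also have "\<dots> \<le> -\<infinity>"
  proof (rule SUP_least)
    fix j assume j: "j \<in> Y - X"
    have sub: "insert j (X - {i}) \<subseteq> U" "insert i Y - {j} \<subseteq> U" using XY j assms(5) by auto
    have "insert j (X - {i}) \<notin> \<I>" using no j by blast
    then have "g (insert j (X - {i})) \<noteq> 0" using g(3) sub(1) by blast
    then have "g (insert j (X - {i})) = -\<infinity>" using g(2) sub(1) by blast
    moreover have "g (insert i Y - {j}) \<in> {0, -\<infinity>}" using sub(2) g(2) by blast
    then have "g (insert i Y - {j}) \<noteq> \<infinity>" by auto
    ultimately show "g (insert j (X - {i})) + g (insert i Y - {j}) \<le> -\<infinity>" by simp
  qed
  finally show False using XY by simp
qed

lemma SUP_ereal_attained:
  assumes "finite A" "(SUP a\<in>A. ereal (h a)) \<noteq> -\<infinity>"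
  shows "\<exists>a\<in>A. (SUP a\<in>A. ereal (h a)) = ereal (h a)"
proof -
  have ne: "A \<noteq> {}" using assms(2) by (auto simp: bot_ereal_def)
  have "Max (h ` A) \<in> h ` A" using assms(1) ne by (intro Max_in) auto
  then obtain a where a: "a \<in> A" "h a = Max (h ` A)" by auto
  have "(SUP a\<in>A. ereal (h a)) = ereal (h a)"
    using a assms(1) by (intro antisym SUP_least SUP_upper) auto
  then show ?thesis using a by blast
qed

section \<open>Matroid based valuations\<close>

text \<open>Disjoint unions are encoded in the even and the odd numbers.\<close>

definition join :: "nat set \<Rightarrow> nat set \<Rightarrow> nat set" where
  "join A B = (\<lambda>n. 2 * n) ` A \<union> (\<lambda>n. 2 * n + 1) ` B"

lemma join_mem: "2 * n \<in> join A B \<longleftrightarrow> n \<in> A" "Suc (2 * n) \<in> join A B \<longleftrightarrow> n \<in> B"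
  unfolding join_def by (auto, presburger+)

lemma join_cases: "\<exists>A B. Z = join A B"
proof (intro exI set_eqI)
  fix e :: nat
  show "e \<in> Z \<longleftrightarrow> e \<in> join {n. 2 * n \<in> Z} {n. Suc (2 * n) \<in> Z}"
    by (cases "even e") (auto elim!: evenE oddE simp: join_mem)
qed

lemma join_subset_iff: "join A B \<subseteq> join C D \<longleftrightarrow> A \<subseteq> C \<and> B \<subseteq> D"
proof
  assume sub: "join A B \<subseteq> join C D"
  show "A \<subseteq> C \<and> B \<subseteq> D"
    using subsetD[OF sub, of "2 * _"] subsetD[OF sub, of "Suc (2 * _)"] by (auto simp: join_mem)
qed (auto simp: join_def)

lemma join_disjoint: "(\<lambda>n. 2 * n) ` A \<inter> (\<lambda>n::nat. 2 * n + 1) ` B = {}"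
  by (auto, presburger)

lemma sum_join:
  assumes "finite A" "finite B"
  shows "sum f (join A B) = (\<Sum>n\<in>A. f (2 * n)) + (\<Sum>n\<in>B. f (2 * n + 1))"
proof -
  have "sum f (join A B) = sum f ((\<lambda>n. 2 * n) ` A) + sum f ((\<lambda>n. 2 * n + 1) ` B)"
    unfolding join_def using assms join_disjoint by (intro sum.union_disjoint) auto
  also have "sum f ((\<lambda>n. 2 * n) ` A) = (\<Sum>n\<in>A. f (2 * n))"
    by (subst sum.reindex) (auto simp: inj_on_def)
  also have "sum f ((\<lambda>n. 2 * n + 1) ` B) = (\<Sum>n\<in>B. f (2 * n + 1))"
    by (subst sum.reindex) (auto simp: inj_on_def)
  finally show ?thesis .
qed

lemma card_join: "finite A \<Longrightarrow> finite B \<Longrightarrow> card (join A B) = card A + card B"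
  using sum_join[of A B "\<lambda>_. 1::nat"] by simp

lemma finite_join: "finite A \<Longrightarrow> finite B \<Longrightarrow> finite (join A B)"
  by (simp add: join_def)

lemma matroid_join:
  assumes "matroid E1 \<I>1" "matroid E2 \<I>2"
  shows "matroid (join E1 E2) {join A B |A B. A \<in> \<I>1 \<and> B \<in> \<I>2}"
proof -
  note fin = matroidD(1)[OF assms(1)] matroidD(1)[OF assms(2)]
    and sub = matroidD(2)[OF assms(1)] matroidD(2)[OF assms(2)]
    and e = matroidD(3)[OF assms(1)] matroidD(3)[OF assms(2)]
    and her = matroidD(4)[OF assms(1)] matroidD(4)[OF assms(2)]
    and aug = matroidD(5)[OF assms(1)] matroidD(5)[OF assms(2)]
  have finI: "A \<in> \<I>1 \<Longrightarrow> finite A" "B \<in> \<I>2 \<Longrightarrow> finite B" for A B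
    using finite_subset[OF _ fin(1), of A] finite_subset[OF _ fin(2), of B] sub by auto
  show ?thesis
    unfolding matroid_def
  proof (intro conjI ballI allI impI)
    show "finite (join E1 E2)" using fin by (rule finite_join)
    show "{join A B |A B. A \<in> \<I>1 \<and> B \<in> \<I>2} \<subseteq> Pow (join E1 E2)"
      using sub by (auto simp: join_subset_iff) (meson PowD in_mono join_subset_iff)
    have "join {} {} = {}" by (simp add: join_def)
    then show "{} \<in> {join A B |A B. A \<in> \<I>1 \<and> B \<in> \<I>2}" using e by blast
  next
    fix I J assume "I \<in> {join A B |A B. A \<in> \<I>1 \<and> B \<in> \<I>2}" "J \<subseteq> I"
    then obtain A B C D where "I = join A B" "A \<in> \<I>1" "B \<in> \<I>2" "J = join C D" "C \<subseteq> A" "D \<subseteq> B"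
      using join_cases[of J] by (auto simp: join_subset_iff)
    then show "J \<in> {join A B |A B. A \<in> \<I>1 \<and> B \<in> \<I>2}" using her by blast
  next
    fix I J assume "I \<in> {join A B |A B. A \<in> \<I>1 \<and> B \<in> \<I>2}" "J \<in> {join A B |A B. A \<in> \<I>1 \<and> B \<in> \<I>2}"
      "card I < card J"
    then obtain A B C D where AB: "I = join A B" "A \<in> \<I>1" "B \<in> \<I>2" and CD: "J = join C D" "C \<in> \<I>1" "D \<in> \<I>2"
      and lt: "card (join A B) < card (join C D)" by blast
    have "card A + card B < card C + card D" using lt card_join finI AB CD by simp
    then consider "card A < card C" | "card B < card D" by linarith
    then show "\<exists>j\<in>J - I. insert j I \<in> {join A B |A B. A \<in> \<I>1 \<and> B \<in> \<I>2}"
    proof cases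
      case 1
      then obtain j where j: "j \<in> C - A" "insert j A \<in> \<I>1" using aug(1) AB CD by blast
      have "insert (2 * j) I = join (insert j A) B" by (auto simp: AB join_def)
      then have "insert (2 * j) I \<in> {join A B |A B. A \<in> \<I>1 \<and> B \<in> \<I>2}" using j(2) AB(3) by blast
      moreover have "2 * j \<in> J - I" using j(1) by (simp add: AB CD join_mem)
      ultimately show ?thesis by blast
    next
      case 2
      then obtain j where j: "j \<in> D - B" "insert j B \<in> \<I>2" using aug(2) AB CD by blast
      have "insert (Suc (2 * j)) I = join A (insert j B)" by (auto simp: AB join_def)
      then have "insert (Suc (2 * j)) I \<in> {join A B |A B. A \<in> \<I>1 \<and> B \<in> \<I>2}" using j(2) AB(2) by blast
      moreover have "Suc (2 * j) \<in> J - I" using j(1) by (simp add: AB CD join_mem)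
      ultimately show ?thesis by blast
    qed
  qed
qed

definition join_fun :: "(nat \<Rightarrow> 'b) \<Rightarrow> (nat \<Rightarrow> 'b) \<Rightarrow> nat \<Rightarrow> 'b" where
  "join_fun g h e = (if even e then g (e div 2) else h (e div 2))"

lemma join_fun_simps [simp]:
  "join_fun g h (2 * n) = g n" "join_fun g h (Suc (2 * n)) = h n"
  by (simp_all add: join_fun_def)

lemma image_join: "join_fun g h ` join A B = g ` A \<union> h ` B"
  by (simp add: join_def image_Un image_image)

lemma inj_on_join: "inj_on (join_fun g h) (join A B) \<longleftrightarrow> inj_on g A \<and> inj_on h B \<and> g ` A \<inter> h ` B = {}"
proof -
  have 1: "inj_on (join_fun g h) ((\<lambda>n. 2 * n) ` A) \<longleftrightarrow> inj_on g A"
    by (auto simp: inj_on_def)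
  have 2: "inj_on (join_fun g h) ((\<lambda>n. 2 * n + 1) ` B) \<longleftrightarrow> inj_on h B"
    by (auto simp: inj_on_def)
  have "(\<lambda>n. 2 * n) ` A - (\<lambda>n::nat. 2 * n + 1) ` B = (\<lambda>n. 2 * n) ` A"
    "(\<lambda>n::nat. 2 * n + 1) ` B - (\<lambda>n. 2 * n) ` A = (\<lambda>n::nat. 2 * n + 1) ` B"
    using join_disjoint[of A B] by blast+
  then show ?thesis
    unfolding join_def inj_on_Un 1 2 by (simp add: image_image)
qed

text \<open>The constant \<open>k\<close> absorbs the value that \<open>endowment\<close> subtracts.\<close>

definition represents :: "'b set \<Rightarrow> ('b set \<Rightarrow> ereal) \<Rightarrow> 'a set \<Rightarrow> 'a set set \<Rightarrow> ('a \<Rightarrow> 'b) \<Rightarrow> ('a \<Rightarrow> real) \<Rightarrow> 'b set \<Rightarrow> real \<Rightarrow> bool"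
  where "represents V f E \<I> l w W k \<longleftrightarrow> finite V \<and> matroid E \<I> \<and> finite W \<and> V \<inter> W = {} \<and> l ` E \<subseteq> V \<union> W \<and>
     (\<forall>X\<subseteq>V. (\<exists>Z\<in>\<I>. inj_on l Z \<and> l ` Z = X \<union> W \<and> f X = ereal (sum w Z + k)) \<and>
       (\<forall>Z\<in>\<I>. inj_on l Z \<longrightarrow> l ` Z = X \<union> W \<longrightarrow> ereal (sum w Z + k) \<le> f X))"

lemma representsD:
  assumes "represents V f E \<I> l w W k"
  shows "finite V" "matroid E \<I>" "finite W" "V \<inter> W = {}" "l ` E \<subseteq> V \<union> W"
    "\<And>X. X \<subseteq> V \<Longrightarrow> \<exists>Z\<in>\<I>. inj_on l Z \<and> l ` Z = X \<union> W \<and> f X = ereal (sum w Z + k)"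
    "\<And>X Z. X \<subseteq> V \<Longrightarrow> Z \<in> \<I> \<Longrightarrow> inj_on l Z \<Longrightarrow> l ` Z = X \<union> W \<Longrightarrow> ereal (sum w Z + k) \<le> f X"
  using assms by (auto simp: represents_def)

definition matching_rep :: "nat set \<Rightarrow> (nat set \<Rightarrow> ereal) \<Rightarrow> bool" where
  "matching_rep V f \<longleftrightarrow>
     (\<exists>(E :: nat set) \<I> (l :: nat \<Rightarrow> nat) w W k. represents V f E \<I> l w W k)"

lemma matching_repI: "represents V f (E :: nat set) \<I> l w W k \<Longrightarrow> matching_rep V f"
  unfolding matching_rep_def by blast

text \<open>Each label gets two elements. The even copy carries the matroid and the weights; the odd
  copy is free of weight zero and takes up the part of X outside the chosen independent set, so that
  every label of X is used exactly once.\<close>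

lemma matching_rep_weighted_rank:
  assumes mat: "matroid V \<I>"
  shows "matching_rep V (weighted_rank \<I> w)"
proof -
  have fin: "finite V" and sub: "\<I> \<subseteq> Pow V" and emp: "{} \<in> \<I>" using mat unfolding matroid_def by blast+
  have free: "matroid V (Pow V)"
    unfolding matroid_def
  proof (intro conjI ballI allI impI)
    fix I J assume *: "I \<in> Pow V" "J \<in> Pow V" "card I < card J"
    then have "finite I" using fin finite_subset by blast
    then have "\<not> J \<subseteq> I" using *(3) card_mono[of I J] by auto
    then show "\<exists>j\<in>J - I. insert j I \<in> Pow V" using * by blast
  qed (use fin in auto)
  have finI: "finite {I \<in> \<I>. I \<subseteq> X}" for X using sub fin by (auto intro: finite_subset[of _ "Pow V"])
  let ?w = "join_fun w (\<lambda>_. 0)"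
  let ?J = "{join A B |A B. A \<in> \<I> \<and> B \<in> Pow V}"
  have sum: "sum ?w (join A B) = sum w A" if "A \<subseteq> V" "B \<subseteq> V" for A B
    using sum_join[of A B ?w] that fin finite_subset by (auto simp: finite_subset)
  have rep: "(\<exists>Z\<in>?J. inj_on (join_fun id id) Z \<and> join_fun id id ` Z = X \<union> {} \<and> weighted_rank \<I> w X = ereal (sum ?w Z + 0)) \<and>
      (\<forall>Z\<in>?J. inj_on (join_fun id id) Z \<longrightarrow> join_fun id id ` Z = X \<union> {} \<longrightarrow> ereal (sum ?w Z + 0) \<le> weighted_rank \<I> w X)"
    if X: "X \<subseteq> V" for X
  proof
    have "ereal (sum w {}) \<le> (SUP I\<in>{I\<in>\<I>. I \<subseteq> X}. ereal (\<Sum>i\<in>I. w i))"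
      by (rule SUP_upper) (use emp in auto)
    then have "(SUP I\<in>{I\<in>\<I>. I \<subseteq> X}. ereal (\<Sum>i\<in>I. w i)) \<noteq> -\<infinity>" by auto
    then obtain I where I: "I \<in> \<I>" "I \<subseteq> X" "weighted_rank \<I> w X = ereal (sum w I)"
      using SUP_ereal_attained[OF finI, of "sum w" X] unfolding weighted_rank_def by auto
    have "join I (X - I) \<in> ?J" using I X by blast
    moreover have "inj_on (join_fun id id) (join I (X - I))" by (auto simp: inj_on_join)
    moreover have "join_fun id id ` join I (X - I) = X \<union> {}" using I by (auto simp: image_join)
    moreover have "weighted_rank \<I> w X = ereal (sum ?w (join I (X - I)) + 0)"
      using I X by (subst sum) auto
    ultimately show "\<exists>Z\<in>?J. inj_on (join_fun id id) Z \<and> join_fun id id ` Z = X \<union> {} \<and> weighted_rank \<I> w X = ereal (sum ?w Z + 0)"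
      by blast
    show "\<forall>Z\<in>?J. inj_on (join_fun id id) Z \<longrightarrow> join_fun id id ` Z = X \<union> {} \<longrightarrow> ereal (sum ?w Z + 0) \<le> weighted_rank \<I> w X"
    proof (intro ballI impI)
      fix Z assume "Z \<in> ?J" and im: "join_fun id id ` Z = X \<union> {}"
      then obtain A B where Z: "Z = join A B" "A \<in> \<I>" "B \<subseteq> V" by auto
      have "A \<subseteq> X" using im unfolding Z(1) image_join by auto
      then have "ereal (sum w A) \<le> weighted_rank \<I> w X"
        unfolding weighted_rank_def using Z(2) by (intro SUP_upper) auto
      then show "ereal (sum ?w Z + 0) \<le> weighted_rank \<I> w X"
        using Z sum[of A B] sub by auto
    qed
  qed
  have "join_fun id id ` join V V \<subseteq> V \<union> {}" by (simp add: image_join)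
  then have "represents V (weighted_rank \<I> w) (join V V) ?J (join_fun id id) ?w {} 0"
    unfolding represents_def by (intro conjI fin matroid_join[OF mat free] allI impI rep) auto
  then show ?thesis by (rule matching_repI)
qed

text \<open>The elements of T become compulsory labels, and the value at T is moved into the
  constant.\<close>

lemma matching_rep_endowment:
  assumes "matching_rep V f" "T \<subseteq> V"
  shows "matching_rep (V - T) (endowment T f)"
proof -
  obtain E \<I> l w W k where R: "represents V f (E :: nat set) \<I> l w W k"
    using assms(1) unfolding matching_rep_def by blast
  note fin = representsD(1)[OF R] and mat = representsD(2)[OF R] and W = representsD(3,4)[OF R]
    and lab = representsD(5)[OF R] and att = representsD(6)[OF R] and upp = representsD(7)[OF R]
  obtain c where c: "f T = ereal c" using att[OF assms(2)] by auto
  have main: "(\<exists>Z\<in>\<I>. inj_on l Z \<and> l ` Z = X \<union> (W \<union> T) \<and> endowment T f X = ereal (sum w Z + (k - c))) \<and>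
      (\<forall>Z\<in>\<I>. inj_on l Z \<longrightarrow> l ` Z = X \<union> (W \<union> T) \<longrightarrow> ereal (sum w Z + (k - c)) \<le> endowment T f X)"
    if X: "X \<subseteq> V - T" for X
  proof
    have XT: "X \<union> T \<subseteq> V" and eq: "X \<union> (W \<union> T) = X \<union> T \<union> W" using X assms(2) by auto
    obtain Z where Z: "Z \<in> \<I>" "inj_on l Z" "l ` Z = X \<union> T \<union> W" "f (X \<union> T) = ereal (sum w Z + k)"
      using att[OF XT] by blast
    have en: "endowment T f X = ereal (sum w Z + (k - c))" unfolding endowment_def Z(4) c by simp
    then show "\<exists>Z\<in>\<I>. inj_on l Z \<and> l ` Z = X \<union> (W \<union> T) \<and> endowment T f X = ereal (sum w Z + (k - c))"
      unfolding eq using Z by blast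
    show "\<forall>Z\<in>\<I>. inj_on l Z \<longrightarrow> l ` Z = X \<union> (W \<union> T) \<longrightarrow> ereal (sum w Z + (k - c)) \<le> endowment T f X"
      unfolding eq en using upp[OF XT] Z(4) by (auto simp: add.commute)
  qed
  have sub: "(V - T) \<inter> (W \<union> T) = {}" "l ` E \<subseteq> (V - T) \<union> (W \<union> T)" using W lab assms(2) by auto
  have finW: "finite (W \<union> T)" using W(1) fin assms(2) finite_subset by auto
  have "represents (V - T) (endowment T f) E \<I> l w (W \<union> T) (k - c)"
    unfolding represents_def using fin by (intro conjI mat finW sub allI impI main) auto
  then show ?thesis by (rule matching_repI)
qed

text \<open>In the disjoint union of two representations that share the labels V, injectivity
  distributes X over the two sides, which is the choice of Y in the merge. The auxiliary labels have
  to be renamed apart.\<close>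

lemma matching_rep_merge:
  assumes "matching_rep V f" "matching_rep V g"
  shows "matching_rep V (Defs.merge f g)"
proof -
  obtain E1 \<I>1 l1 w1 W1 k1 where R1: "represents V f (E1 :: nat set) \<I>1 l1 w1 W1 k1"
    using assms(1) unfolding matching_rep_def by blast
  obtain E2 \<I>2 l2 w2 W2 k2 where R2: "represents V g (E2 :: nat set) \<I>2 l2 w2 W2 k2"
    using assms(2) unfolding matching_rep_def by blast
  note fin = representsD(1)[OF R1]
  obtain N where "\<forall>v\<in>V. v < N" using fin finite_nat_set_iff_bounded by auto
  then have N: "v < N" if "v \<in> V" for v using that by blast
  \<comment> \<open>N lies above all of V, so renamed labels avoid V, and the bit b separates the
    two families by the parity of the offset from N.\<close>
  define \<phi> where "\<phi> b y = (if y \<in> V then y else N + 2 * y + b)" for b y :: nat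
  have inj: "inj (\<phi> b)" for b
    by (rule injI) (use N in \<open>fastforce simp: \<phi>_def split: if_splits\<close>)
  have phi_V: "\<phi> b v = v" if "v \<in> V" for b v using that by (simp add: \<phi>_def)
  have phi_image: "\<phi> b ` S = S" if "S \<subseteq> V" for b S
  proof -
    have "\<phi> b ` S = (\<lambda>v. v) ` S" by (intro image_cong refl phi_V) (use that in auto)
    then show ?thesis by simp
  qed
  have phi_in_V: "\<phi> b y \<in> V \<longleftrightarrow> y \<in> V" for b y
    using N[of "\<phi> b y"] by (auto simp: \<phi>_def split: if_splits)
  have phi_01: "\<phi> 0 y = \<phi> 1 z \<longleftrightarrow> y \<in> V \<and> y = z" for y z
  proof
    assume eq: "\<phi> 0 y = \<phi> 1 z"
    then have "y \<in> V \<longleftrightarrow> z \<in> V" using phi_in_V by metis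
    moreover have "2 * y \<noteq> 2 * z + 1" by presburger
    ultimately show "y \<in> V \<and> y = z" using eq by (auto simp: \<phi>_def split: if_splits)
  qed (auto simp: phi_V)
  have image_01: "\<phi> 0 y \<in> \<phi> 1 ` S \<longleftrightarrow> y \<in> V \<and> y \<in> S" for y S
    unfolding image_iff phi_01 by blast
  have phi_10: "\<phi> 1 y = \<phi> 0 z \<longleftrightarrow> y \<in> V \<and> y = z" for y z
    using phi_01[of z y] by metis
  have image_10: "\<phi> 1 y \<in> \<phi> 0 ` S \<longleftrightarrow> y \<in> V \<and> y \<in> S" for y S
    unfolding image_iff phi_10 by blast
  define l where "l = join_fun (\<phi> 0 \<circ> l1) (\<phi> 1 \<circ> l2)"
  define w where "w = join_fun w1 w2"
  define W where "W = \<phi> 0 ` W1 \<union> \<phi> 1 ` W2"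
  define \<J> where "\<J> = {join A B |A B. A \<in> \<I>1 \<and> B \<in> \<I>2}"
  have mat: "matroid (join E1 E2) \<J>"
    unfolding \<J>_def by (rule matroid_join[OF representsD(2)[OF R1] representsD(2)[OF R2]])
  have finI: "A \<in> \<I>1 \<Longrightarrow> finite A" "A \<in> \<I>2 \<Longrightarrow> finite A" for A
    using finite_subset[OF _ matroidD(1)[OF representsD(2)[OF R1]], of A] matroidD(2)[OF representsD(2)[OF R1]]
      finite_subset[OF _ matroidD(1)[OF representsD(2)[OF R2]], of A] matroidD(2)[OF representsD(2)[OF R2]]
    by auto
  have sum: "sum w (join A B) = sum w1 A + sum w2 B" if "A \<in> \<I>1" "B \<in> \<I>2" for A B
    unfolding w_def using sum_join[OF finI(1)[OF that(1)] finI(2)[OF that(2)], of "join_fun w1 w2"] by simp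
  have labI: "l1 ` A \<subseteq> V \<union> W1" if "A \<in> \<I>1" for A
    using matroidD(2)[OF representsD(2)[OF R1]] representsD(5)[OF R1] that by blast
  have labI2: "l2 ` B \<subseteq> V \<union> W2" if "B \<in> \<I>2" for B
    using matroidD(2)[OF representsD(2)[OF R2]] representsD(5)[OF R2] that by blast
  have VW: "V \<inter> W1 = {}" "V \<inter> W2 = {}" using representsD(4)[OF R1] representsD(4)[OF R2] .
  have inj_l: "inj_on l (join A B) \<longleftrightarrow> inj_on l1 A \<and> inj_on l2 B \<and> l1 ` A \<inter> l2 ` B \<inter> V = {}" for A B
  proof -
    have "inj_on (\<phi> 0 \<circ> l1) A \<longleftrightarrow> inj_on l1 A" "inj_on (\<phi> 1 \<circ> l2) B \<longleftrightarrow> inj_on l2 B"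
      using inj by (auto simp: inj_on_def inj_def)
    moreover have "(\<phi> 0 \<circ> l1) ` A \<inter> (\<phi> 1 \<circ> l2) ` B = {} \<longleftrightarrow> l1 ` A \<inter> l2 ` B \<inter> V = {}"
      using phi_01 by (auto simp: disjoint_iff image_iff)
    ultimately show ?thesis unfolding l_def inj_on_join by blast
  qed
  have im_l: "l ` join A B = \<phi> 0 ` (l1 ` A) \<union> \<phi> 1 ` (l2 ` B)" for A B
    by (simp add: l_def image_join image_comp)
  have split: "\<exists>Y\<subseteq>X. l1 ` A = Y \<union> W1 \<and> l2 ` B = (X - Y) \<union> W2"
    if X: "X \<subseteq> V" and A: "A \<in> \<I>1" "B \<in> \<I>2" and i: "inj_on l (join A B)" and im: "l ` join A B = X \<union> W" for X A B
  proof (intro exI conjI)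
    have mem: "\<phi> 0 y \<in> X \<union> W \<longleftrightarrow> y \<in> X \<union> W1" "\<phi> 1 y \<in> X \<union> W \<longleftrightarrow> y \<in> X \<union> W2" for y
    proof -
      have "\<phi> b y \<in> X \<longleftrightarrow> y \<in> X" for b using phi_in_V[of b y] phi_V[of y b] X by auto
      then show "\<phi> 0 y \<in> X \<union> W \<longleftrightarrow> y \<in> X \<union> W1" "\<phi> 1 y \<in> X \<union> W \<longleftrightarrow> y \<in> X \<union> W2"
        using image_01[of y W2] image_10[of y W1] VW by (auto simp: W_def inj_image_mem_iff[OF inj])
    qed
    have mem2: "\<phi> 0 y \<in> l ` join A B \<longleftrightarrow> y \<in> l1 ` A \<or> y \<in> V \<and> y \<in> l2 ` B"
      "\<phi> 1 y \<in> l ` join A B \<longleftrightarrow> y \<in> l2 ` B \<or> y \<in> V \<and> y \<in> l1 ` A" for y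
      unfolding im_l Un_iff inj_image_mem_iff[OF inj] image_01 image_10 by blast+
    have 1: "y \<in> l1 ` A \<or> y \<in> V \<and> y \<in> l2 ` B \<longleftrightarrow> y \<in> X \<union> W1"
      "y \<in> l2 ` B \<or> y \<in> V \<and> y \<in> l1 ` A \<longleftrightarrow> y \<in> X \<union> W2" for y
      unfolding mem2[unfolded im, symmetric] mem by (rule refl)+
    have dis: "l1 ` A \<inter> l2 ` B \<inter> V = {}" using i inj_l by blast
    show "l1 ` A \<inter> V \<subseteq> X" using 1 VW by blast
    show "l1 ` A = (l1 ` A \<inter> V) \<union> W1" using 1 VW labI[OF A(1)] by blast
    show "l2 ` B = (X - l1 ` A \<inter> V) \<union> W2" using 1 VW labI2[OF A(2)] dis X by blast
  qed
  have unsplit: "inj_on l (join A B) \<and> l ` join A B = X \<union> W"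
    if X: "X \<subseteq> V" "Y \<subseteq> X" and A: "inj_on l1 A" "l1 ` A = Y \<union> W1" and B: "inj_on l2 B" "l2 ` B = (X - Y) \<union> W2" for X Y A B
  proof
    show "inj_on l (join A B)" unfolding inj_l using A B X VW by auto
    have "\<phi> 0 ` Y = Y" "\<phi> 1 ` (X - Y) = X - Y" using X by (auto intro!: phi_image)
    then show "l ` join A B = X \<union> W"
      unfolding im_l A B W_def image_Un using X by auto
  qed
  have rep: "(\<exists>Z\<in>\<J>. inj_on l Z \<and> l ` Z = X \<union> W \<and> Defs.merge f g X = ereal (sum w Z + (k1 + k2))) \<and>
      (\<forall>Z\<in>\<J>. inj_on l Z \<longrightarrow> l ` Z = X \<union> W \<longrightarrow> ereal (sum w Z + (k1 + k2)) \<le> Defs.merge f g X)"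
    if X: "X \<subseteq> V" for X
  proof
    have finX: "finite X" using X fin finite_subset by blast
    have "Max ((\<lambda>Y. f Y + g (X - Y)) ` Pow X) \<in> (\<lambda>Y. f Y + g (X - Y)) ` Pow X"
      using finX by (intro Max_in) auto
    moreover have "Defs.merge f g X = Max ((\<lambda>Y. f Y + g (X - Y)) ` Pow X)"
      unfolding Defs.merge_def using finX by (intro Max_Sup[symmetric]) auto
    ultimately obtain Y where Y: "Y \<subseteq> X" "Defs.merge f g X = f Y + g (X - Y)" by auto
    have YV: "Y \<subseteq> V" "X - Y \<subseteq> V" using X Y by auto
    obtain A where A: "A \<in> \<I>1" "inj_on l1 A" "l1 ` A = Y \<union> W1" "f Y = ereal (sum w1 A + k1)"
      using representsD(6)[OF R1 YV(1)] by blast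
    obtain B where B: "B \<in> \<I>2" "inj_on l2 B" "l2 ` B = (X - Y) \<union> W2" "g (X - Y) = ereal (sum w2 B + k2)"
      using representsD(6)[OF R2 YV(2)] by blast
    have "join A B \<in> \<J>" using A B by (auto simp: \<J>_def)
    moreover have "Defs.merge f g X = ereal (sum w (join A B) + (k1 + k2))"
      using Y(2) A(4) B(4) sum[OF A(1) B(1)] by simp
    ultimately show "\<exists>Z\<in>\<J>. inj_on l Z \<and> l ` Z = X \<union> W \<and> Defs.merge f g X = ereal (sum w Z + (k1 + k2))"
      using unsplit[OF X Y(1) A(2,3) B(2,3)] by blast
    show "\<forall>Z\<in>\<J>. inj_on l Z \<longrightarrow> l ` Z = X \<union> W \<longrightarrow> ereal (sum w Z + (k1 + k2)) \<le> Defs.merge f g X"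
    proof (intro ballI impI)
      fix Z assume "Z \<in> \<J>" and Z: "inj_on l Z" "l ` Z = X \<union> W"
      then obtain A B where AB: "Z = join A B" "A \<in> \<I>1" "B \<in> \<I>2" by (auto simp: \<J>_def)
      obtain Y where Y: "Y \<subseteq> X" "l1 ` A = Y \<union> W1" "l2 ` B = (X - Y) \<union> W2"
        using split[OF X AB(2,3)] Z unfolding AB(1) by blast
      have inj12: "inj_on l1 A" "inj_on l2 B" using Z(1) unfolding AB(1) inj_l by blast+
      have YV: "Y \<subseteq> V" "X - Y \<subseteq> V" using X Y by auto
      have "ereal (sum w Z + (k1 + k2)) = ereal (sum w1 A + k1) + ereal (sum w2 B + k2)"
        using sum[OF AB(2,3)] AB(1) by simp
      also have "\<dots> \<le> f Y + g (X - Y)"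
        by (intro add_mono representsD(7)[OF R1 YV(1) AB(2) inj12(1) Y(2)] representsD(7)[OF R2 YV(2) AB(3) inj12(2) Y(3)])
      also have "\<dots> \<le> Defs.merge f g X" unfolding Defs.merge_def using Y(1) by (intro SUP_upper) auto
      finally show "ereal (sum w Z + (k1 + k2)) \<le> Defs.merge f g X" .
    qed
  qed
  have "V \<inter> W = {}" using VW phi_in_V by (auto simp: W_def)
  moreover have "l ` join E1 E2 \<subseteq> V \<union> W"
  proof -
    have V: "\<phi> b ` V = V" for b by (rule phi_image) simp
    have "\<phi> 0 ` (l1 ` E1) \<subseteq> V \<union> \<phi> 0 ` W1"
      using image_mono[OF representsD(5)[OF R1], of "\<phi> 0"] by (simp only: image_Un V)
    moreover have "\<phi> 1 ` (l2 ` E2) \<subseteq> V \<union> \<phi> 1 ` W2"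
      using image_mono[OF representsD(5)[OF R2], of "\<phi> 1"] by (simp only: image_Un V)
    ultimately show ?thesis unfolding im_l W_def by blast
  qed
  moreover have "finite W" using representsD(3)[OF R1] representsD(3)[OF R2] by (simp add: W_def)
  ultimately have "represents V (Defs.merge f g) (join E1 E2) \<J> l w W (k1 + k2)"
    unfolding represents_def by (intro conjI fin mat allI impI rep) auto
  then show ?thesis by (rule matching_repI)
qed

lemma matching_rep_matroid_based: "matroid_based_valuation V f \<Longrightarrow> matching_rep V f"
proof (induction rule: matroid_based_valuation.induct)
  case (rank V \<I> w)
  then show ?case by (intro matching_rep_weighted_rank)
next
  case (agree V f g)
  then obtain E \<I> l w W k where "represents V f (E :: nat set) \<I> l w W k" unfolding matching_rep_def by blast
  then have "represents V g E \<I> l w W k" using agree(2) by (auto simp: represents_def)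
  then show ?case by (rule matching_repI)
qed (auto intro: matching_rep_merge matching_rep_endowment)

section \<open>The counterexample\<close>

text \<open>A parallel extension: elements with the same image under g become parallel. It is used
  for edges with a common endpoint.\<close>

lemma matroid_inverse_image:
  assumes mat: "matroid U \<J>" and fin: "finite E"
  shows "matroid E {Z. Z \<subseteq> E \<and> inj_on g Z \<and> g ` Z \<in> \<J>}"
  unfolding matroid_def
proof (intro conjI ballI allI impI)
  fix I J assume "I \<in> {Z. Z \<subseteq> E \<and> inj_on g Z \<and> g ` Z \<in> \<J>}" "J \<subseteq> I"
  then show "J \<in> {Z. Z \<subseteq> E \<and> inj_on g Z \<and> g ` Z \<in> \<J>}"
    using matroidD(4)[OF mat, of "g ` I" "g ` J"] by (auto intro: inj_on_subset)
next
  fix I J assume I: "I \<in> {Z. Z \<subseteq> E \<and> inj_on g Z \<and> g ` Z \<in> \<J>}" and J: "J \<in> {Z. Z \<subseteq> E \<and> inj_on g Z \<and> g ` Z \<in> \<J>}"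
    and lt: "card I < card J"
  have "card (g ` I) < card (g ` J)" using I J lt card_image[of g I] card_image[of g J] by simp
  then obtain u where u: "u \<in> g ` J - g ` I" "insert u (g ` I) \<in> \<J>"
    using matroidD(5)[OF mat] I J by blast
  then obtain e where e: "e \<in> J" "g e = u" by blast
  then have "e \<notin> I" "g e \<notin> g ` I" using u by auto
  then show "\<exists>j\<in>J - I. insert j I \<in> {Z. Z \<subseteq> E \<and> inj_on g Z \<and> g ` Z \<in> \<J>}"
    using e u I J by (intro bexI[of _ e]) auto
qed (use fin matroidD(3)[OF mat] in auto)

definition pair :: "nat \<Rightarrow> nat set" where
  "pair i = {2 * i, Suc (2 * i)}"

lemma pairs_pair:
  assumes "finite W" "{..<14} \<inter> W = {}"
  shows "pairs pair W {..<14}"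
proof
  show "{..<14} = (\<Union>i<7. pair i)"
  proof (intro set_eqI iffI)
    fix v :: nat assume "v \<in> {..<14}"
    then have "v div 2 < 7" "v = 2 * (v div 2) \<or> v = Suc (2 * (v div 2))" by auto
    then show "v \<in> (\<Union>i<7. pair i)" unfolding pair_def by blast
  qed (auto simp: pair_def)
  show "pair i \<inter> pair j = {}" if "i \<noteq> j" for i j
    using that unfolding pair_def by (auto; presburger)
qed (use assms in \<open>auto simp: pair_def\<close>)

interpretation pair: pairs pair "{}" "{..<14}"
  by (rule pairs_pair) auto

definition penalty :: "nat set \<Rightarrow> real" where
  "penalty Y = (if Y = pair 0 \<union> pair 1 then 1 else if pair.special Y then 2 else 0)"

text \<open>The slope 4 is twice the largest penalty, as the exchange property of sparse paving
  valuations requires here.\<close>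

definition counterexample :: "nat set \<Rightarrow> ereal" where
  "counterexample X = ereal (4 * real (min (card X) 4) - penalty X)"

lemma pair_union_eq:
  assumes "pair i \<union> pair j = pair 0 \<union> pair 1" "i \<noteq> j"
  shows "{i, j} = {0, 1}"
proof -
  have "2 * i \<in> pair i \<union> pair j" "2 * j \<in> pair i \<union> pair j" by (auto simp: pair_def)
  then have "2 * i \<in> pair 0 \<union> pair 1" "2 * j \<in> pair 0 \<union> pair 1" unfolding assms(1) .
  then have "i \<le> 1" "j \<le> 1" by (auto simp: pair_def)
  then have "i = 0 \<or> i = 1" "j = 0 \<or> j = 1" by linarith+
  then show ?thesis using assms(2) by (elim disjE) auto
qed

lemma special_01: "pair.special (pair 0 \<union> pair 1)"
  unfolding pair.special_def by (intro exI[of _ 0] conjI exI[of _ 1]) (auto simp: doubleton_eq_iff)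

lemma penalty_bounds: "0 \<le> penalty Y" "penalty Y \<le> 2" "\<not> pair.special Y \<Longrightarrow> penalty Y = 0"
  using special_01 by (auto simp: penalty_def)

text \<open>The common core of both negative results. It speaks of 4-sets only, so a representation
  by sets of one fixed size suffices. The rigidity bound demands a penalty of at least 2 for the
  pairs 0 and 1, which have penalty 1.\<close>

lemma counterexample_not_represented:
  assumes mat: "matroid E \<I>" and W: "finite W" "{..<14} \<inter> W = {}" and lab: "l ` E \<subseteq> {..<14} \<union> W"
    and att: "\<And>X. X \<subseteq> {..<14} \<Longrightarrow> card X = 4 \<Longrightarrow> \<exists>Z\<in>\<I>. inj_on l Z \<and> l ` Z = X \<union> W \<and> counterexample X = ereal (sum w Z + k)"
    and upp: "\<And>X Z. X \<subseteq> {..<14} \<Longrightarrow> card X = 4 \<Longrightarrow> Z \<in> \<I> \<Longrightarrow> inj_on l Z \<Longrightarrow> l ` Z = X \<union> W \<Longrightarrow>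
      ereal (sum w Z + k) \<le> counterexample X"
  shows False
proof -
  interpret pairs pair W "{..<14}" by (rule pairs_pair[OF W])
  define F where "F Y = 16 - penalty Y - k" for Y
  have val: "counterexample Y = ereal (F Y + k)" if "card Y = 4" for Y
    using that by (simp add: counterexample_def F_def)
  have "F (pair 0 \<union> pair 1) \<le> (16 - k) - 2"
  proof (rule distinguished_value_bound[OF mat lab, of 2 w F])
    fix Y :: "nat set" assume Y: "Y \<subseteq> {..<14}" "card Y = 4"
    show "\<exists>Z\<in>\<I>. inj_on l Z \<and> l ` Z = Y \<union> W \<and> sum w Z = F Y"
      using att[OF Y] unfolding val[OF Y(2)] by auto
    show "sum w Z \<le> F Y" if "Z \<in> \<I>" "inj_on l Z" "l ` Z = Y \<union> W" for Z
      using upp[OF Y that] unfolding val[OF Y(2)] by auto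
    show "F Y = 16 - k" if "\<not> pair.special Y"
      using penalty_bounds(3)[OF that] by (simp add: F_def)
  next
    fix i j :: nat assume ij: "i < 7" "j < 7" "i \<noteq> j" "{i, j} \<noteq> {2, 3}" "{i, j} \<noteq> {0, 1}"
    have "pair.special (pair i \<union> pair j)"
      unfolding pair.special_def using ij(1-4) by (intro exI[of _ i] exI[of _ j] conjI) simp_all
    moreover have "pair i \<union> pair j \<noteq> pair 0 \<union> pair 1" using pair_union_eq[OF _ ij(3)] ij(5) by metis
    ultimately show "F (pair i \<union> pair j) \<le> 16 - k - 2" by (simp add: F_def penalty_def)
  qed (simp_all add: F_def penalty_def)
  then show False by (simp add: F_def penalty_def)
qed

lemma counterexample_valuated_gmatroid: "valuated_gmatroid {..<14} counterexample"
  unfolding counterexample_def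
proof (rule sparse_paving_valuated_gmatroid[where H = "Collect pair.special" and m = 2])
  show "card (A \<inter> B) + 1 < 4" if "A \<in> Collect pair.special" "B \<in> Collect pair.special" "A \<noteq> B" for A B
    using pair.special_sparse[of A B] that by simp
qed (use penalty_bounds pair.card_special in auto)

lemma counterexample_monotone: "monotone_setfun {..<14} counterexample"
  unfolding counterexample_def
proof (rule sparse_paving_monotone[where m = 2])
  show "penalty A = 0" if "card A \<noteq> 4" for A
    using penalty_bounds(3) pair.card_special that by blast
qed (use penalty_bounds in auto)

text \<open>For a 4-set X every admissible matching has r = 4 + \<open>card W\<close> edges, so only
  the members of the generalized matroid of size r enter. They are the bases of a matroid on U;
  pulled back along \<open>snd\<close> it becomes a matroid on the edges, and \<open>fst\<close>
  provides the labels.\<close>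

lemma counterexample_not_R_natural_minor: "\<not> R_natural_minor {..<14} counterexample"
proof
  assume "R_natural_minor {..<14} counterexample"
  note this[unfolded R_natural_minor_def, THEN conjunct2]
  then obtain W and U :: "nat set" and E c \<I> where rep: "finite W \<and> W \<inter> {..<14} = {} \<and> finite U \<and>
      E \<subseteq> ({..<14} \<union> W) \<times> U \<and> gmatroid U \<I> \<and> (\<forall>X\<subseteq>{..<14}. counterexample X =
        (SUP M\<in>{M. matching E M \<and> fst ` M = X \<union> W \<and> snd ` M \<in> \<I>}. ereal (\<Sum>e\<in>M. c e)))"
    by (elim exE) (rule that)
  then have W: "finite W" "W \<inter> {..<14} = {}" and U: "finite U"
    and E: "E \<subseteq> ({..<14} \<union> W) \<times> U" and gm: "gmatroid U \<I>"
    by - (elim conjE, assumption)+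
  have val: "counterexample X =
      (SUP M\<in>{M. matching E M \<and> fst ` M = X \<union> W \<and> snd ` M \<in> \<I>}. ereal (\<Sum>e\<in>M. c e))"
    if "X \<subseteq> {..<14}" for X
    using rep that by - (elim conjE, drule spec, drule mp, assumption+)
  define r where "r = 4 + card W"
  define \<B> where "\<B> = {B \<in> \<I>. card B = r}"
  define \<J> where "\<J> = {Z. Z \<subseteq> E \<and> inj_on snd Z \<and> snd ` Z \<in> {I. \<exists>B\<in>\<B>. I \<subseteq> B}}"
  have finE: "finite E" using E W(1) U by (meson finite_SigmaI finite_UnI finite_lessThan finite_subset)
  have IU: "\<I> \<subseteq> Pow U" using gm unfolding gmatroid_def by auto
  have card_r: "card (X \<union> W) = r" if "X \<subseteq> {..<14}" "card X = 4" for X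
  proof -
    have "finite X" "X \<inter> W = {}" using that W(2) finite_subset by blast+
    then show ?thesis using that(2) W(1) by (simp add: card_Un_disjoint r_def)
  qed
  have feas: "{M. matching E M \<and> fst ` M = X \<union> W \<and> snd ` M \<in> \<I>} = {Z \<in> \<J>. inj_on fst Z \<and> fst ` Z = X \<union> W}"
    if X: "X \<subseteq> {..<14}" "card X = 4" for X
  proof (intro set_eqI iffI)
    fix M assume "M \<in> {M. matching E M \<and> fst ` M = X \<union> W \<and> snd ` M \<in> \<I>}"
    then have M: "M \<subseteq> E" "inj_on fst M" "inj_on snd M" "fst ` M = X \<union> W" "snd ` M \<in> \<I>"
      by (auto simp: matching_def)
    have "card (snd ` M) = r" using card_image[OF M(2)] card_image[OF M(3)] M(4) card_r[OF X] by simp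
    then show "M \<in> {Z \<in> \<J>. inj_on fst Z \<and> fst ` Z = X \<union> W}" using M by (auto simp: \<J>_def \<B>_def)
  next
    fix M assume "M \<in> {Z \<in> \<J>. inj_on fst Z \<and> fst ` Z = X \<union> W}"
    then obtain B where M: "M \<subseteq> E" "inj_on fst M" "inj_on snd M" "fst ` M = X \<union> W" and B: "B \<in> \<I>" "card B = r" "snd ` M \<subseteq> B"
      by (auto simp: \<J>_def \<B>_def)
    have "card (snd ` M) = r" using card_image[OF M(2)] card_image[OF M(3)] M(4) card_r[OF X] by simp
    moreover have "finite B" using B(1) IU U finite_subset by blast
    ultimately have "snd ` M = B" using B by (intro card_subset_eq) auto
    then show "M \<in> {M. matching E M \<and> fst ` M = X \<union> W \<and> snd ` M \<in> \<I>}" using M B by (auto simp: matching_def)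
  qed
  have finJ: "finite \<J>" using finE by (auto simp: \<J>_def intro: finite_subset[of _ "Pow E"])
  have att: "\<exists>Z\<in>\<J>. inj_on fst Z \<and> fst ` Z = X \<union> W \<and> counterexample X = ereal (sum c Z + 0)"
    if X: "X \<subseteq> {..<14}" "card X = 4" for X
  proof -
    have eq: "counterexample X = (SUP M\<in>{Z \<in> \<J>. inj_on fst Z \<and> fst ` Z = X \<union> W}. ereal (sum c M))"
      using val[OF X(1)] unfolding feas[OF X] .
    have "(SUP M\<in>{Z \<in> \<J>. inj_on fst Z \<and> fst ` Z = X \<union> W}. ereal (sum c M)) \<noteq> -\<infinity>"
      unfolding eq[symmetric] by (simp add: counterexample_def)
    from SUP_ereal_attained[OF _ this] show ?thesis using finJ eq by auto
  qed
  have upp: "ereal (sum c Z + 0) \<le> counterexample X"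
    if X: "X \<subseteq> {..<14}" "card X = 4" and Z: "Z \<in> \<J>" "inj_on fst Z" "fst ` Z = X \<union> W" for X Z
  proof -
    have "counterexample X = (SUP M\<in>{Z \<in> \<J>. inj_on fst Z \<and> fst ` Z = X \<union> W}. ereal (sum c M))"
      using val[OF X(1)] unfolding feas[OF X] .
    then show ?thesis using Z by (auto intro!: SUP_upper)
  qed
  have "\<B> \<noteq> {}"
  proof -
    obtain Z where "Z \<in> \<J>" using att[of "pair 0 \<union> pair 1"] pair.card_special[OF special_01]
      by (auto simp: pair_def)
    then show ?thesis by (auto simp: \<J>_def)
  qed
  then have "matroid U {I. \<exists>B\<in>\<B>. I \<subseteq> B}"
  proof (rule matroid_of_bases[OF U, rotated])
    fix X Y i assume *: "X \<in> \<B>" "Y \<in> \<B>" "i \<in> X - Y"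
    then obtain j where j: "j \<in> Y - X" "insert j (X - {i}) \<in> \<I>"
      using gmatroid_exchange[OF gm, of X Y i] by (auto simp: \<B>_def)
    have "X \<subseteq> U" using *(1) IU by (auto simp: \<B>_def)
    then have "finite X" using U by (rule finite_subset)
    then have "card (insert j (X - {i})) = r" using * j card_gt_0_iff[of X] by (auto simp: \<B>_def)
    then show "\<exists>j\<in>Y - X. insert j (X - {i}) \<in> \<B>" using j by (auto simp: \<B>_def)
  qed (use IU in \<open>auto simp: \<B>_def\<close>)
  then have mat: "matroid E \<J>" unfolding \<J>_def using finE by (rule matroid_inverse_image)
  have lab: "fst ` E \<subseteq> {..<14} \<union> W" using E by auto
  have disj: "{..<14} \<inter> W = {}" using W(2) by auto
  show False by (rule counterexample_not_represented[OF mat W(1) disj lab att upp])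
qed

lemma counterexample_not_matroid_based: "\<not> matroid_based_valuation {..<14} counterexample"
proof
  assume "matroid_based_valuation {..<14} counterexample"
  then obtain E \<I> l w W k where R: "represents {..<14} counterexample (E :: nat set) \<I> l w W k"
    using matching_rep_matroid_based unfolding matching_rep_def by blast
  show False
    by (rule counterexample_not_represented[OF representsD(2-5)[OF R] representsD(6,7)[OF R]])
qed

theorem theorem7p14:
  shows "{(V :: nat set, f). R_natural_minor V f} \<noteq> {(V, f). valuated_gmatroid V f}
    \<and> (\<exists>(V :: nat set) f. valuated_gmatroid V f \<and> \<not> R_natural_minor V f)
    \<and> {(V :: nat set, f). matroid_based_valuation V f} \<noteq>
       {(V, f). valuated_gmatroid V f \<and> monotone_setfun V f \<and> f {} = 0 \<and> (\<forall>X\<subseteq>V. f X \<noteq> -\<infinity>)}"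
proof (intro conjI)
  show "{(V :: nat set, f). R_natural_minor V f} \<noteq> {(V, f). valuated_gmatroid V f}"
    using counterexample_valuated_gmatroid counterexample_not_R_natural_minor by blast
  show "\<exists>(V :: nat set) f. valuated_gmatroid V f \<and> \<not> R_natural_minor V f"
    using counterexample_valuated_gmatroid counterexample_not_R_natural_minor by blast
  have "penalty {} = 0"
    using penalty_bounds(3)[of "{}"] pair.card_special[of "{}"] by fastforce
  then have "counterexample {} = 0" by (simp add: counterexample_def zero_ereal_def)
  moreover have "\<forall>X\<subseteq>{..<14}. counterexample X \<noteq> -\<infinity>" by (simp add: counterexample_def)
  ultimately show "{(V :: nat set, f). matroid_based_valuation V f} \<noteq>
       {(V, f). valuated_gmatroid V f \<and> monotone_setfun V f \<and> f {} = 0 \<and> (\<forall>X\<subseteq>V. f X \<noteq> -\<infinity>)}"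
    using counterexample_valuated_gmatroid counterexample_monotone counterexample_not_matroid_based by blast
qed

end
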